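(* Let $k$ be an even integer and let $f$ be a nonzero weakly holomorphic modular form of weight $k$ for $SL_2(\mathbb{Z})$ with real Fourier coefficients, having at least one zero in $\mathbb{H}$ and such that every zero of $f$ in $\mathcal{F}_1$ lies on $\mathcal{A}_1$. Let $\vartheta_k(f)=Df-\frac{k}{12}E_2f$, and write $\vartheta_k(f)(\tau)=E_4(\tau)^{\varepsilon'}E_6(\tau)^{\delta'}\Delta(\tau)^{m'}P_{\vartheta_k(f)}(j(\tau))$ with $(\varepsilon',\delta',m')\in\{0,1,2\}\times\{0,1\}\times\mathbb{Z}$, $k+2=4\varepsilon'+6\delta'+12m'$, and $P_{\vartheta_k(f)}\in\mathbb{C}[X]$. Then all roots of $P_{\vartheta_k(f)}$ lie in the closed interval $[0,1728]$.
   Context: $\mathbb{H}$ is the upper half-plane, $q=e^{2\pi i\tau}$, $D=\frac{1}{2\pi i}\frac{d}{d\tau}$. A weakly holomorphic modular form of weight $k$ for $SL_2(\mathbb{Z})$ is a holomorphic $f:\mathbb{H}\to\mathbb{C}$ with $f(\frac{a\tau+b}{c\tau+d})=(c\tau+d)^kf(\tau)$ for all $\begin{psmallmatrix}a&b\\c&d\end{psmallmatrix}\in SL_2(\mathbb{Z})$ and Fourier expansion $\sum_{n\in\mathbb{Z}}a_f(n)q^n$ with $a_f(n)=0$ for all $n$ below some $n_0$. $E_2(\tau)=1-24\sum_{n\ge1}(\sum_{d\mid n}d)q^n$; for even $k\ge4$, $E_k(\tau)=1-\frac{2k}{B_k}\sum_{n\ge1}(\sum_{d\mid n}d^{k-1})q^n$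 with $B_k$ the Bernoulli number; $\Delta=\frac{1}{1728}(E_4^3-E_6^2)$ and $j=E_4^3/\Delta$. Every nonzero weakly holomorphic modular form $g$ of weight $w$ for $SL_2(\mathbb{Z})$ can be written uniquely as $g=E_4^{\varepsilon}E_6^{\delta}\Delta^mP_g(j)$ with $(\varepsilon,\delta,m)\in\{0,1,2\}\times\{0,1\}\times\mathbb{Z}$, $w=4\varepsilon+6\delta+12m$, $P_g\in\mathbb{C}[X]$; $\vartheta_k(f)$ is a weakly holomorphic modular form of weight $k+2$. $\mathcal{F}_1=\{\tau\in\mathbb{H}: |\tau|\ge1,\ -1/2\le\mathrm{Re}\,\tau\le0\}\cup\{\tau\in\mathbb{H}:|\tau|>1,\ 0<\mathrm{Re}\,\tau<1/2\}$ and $\mathcal{A}_1=\{\tau\in\mathcal{F}_1: |\tau|=1,\ -1/2\le\mathrm{Re}\,\tau\le 0\}$. *)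

theory Defs
  imports "HOL-Complex_Analysis.Complex_Analysis" "HOL-Computational_Algebra.Polynomial"
begin

definition upper_half_plane :: "complex set" where
  "upper_half_plane = {\<tau>. Im \<tau> > 0}"

text \<open>The variable \<open>q\<close> of Fourier expansions.\<close>

definition nome :: "complex \<Rightarrow> complex" where
  "nome \<tau> = exp (2 * of_real pi * \<i> * \<tau>)"

text \<open>
  Forms are total functions on \<^typ>\<open>complex\<close> whose values outside the upper half-plane are
  irrelevant.  The coefficients in a \<open>q\<close>-expansion are determined by the function.  Unconditional
  summability is no restriction: a Laurent series converges absolutely on its (open) annulus of
  convergence.
\<close>

definition has_q_expansion :: "(complex \<Rightarrow> complex) \<Rightarrow> (int \<Rightarrow> complex) \<Rightarrow> bool" where
  "has_q_expansion f a \<longleftrightarrow>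
     (\<exists>n0. \<forall>n<n0. a n = 0) \<and>
     (\<forall>\<tau>\<in>upper_half_plane. ((\<lambda>n. a n * nome \<tau> powi n) has_sum f \<tau>) UNIV)"

definition weakly_holomorphic_modular_form :: "int \<Rightarrow> (complex \<Rightarrow> complex) \<Rightarrow> bool" where
  "weakly_holomorphic_modular_form k f \<longleftrightarrow>
     f holomorphic_on upper_half_plane \<and>
     (\<forall>a b c d :: int. a * d - b * c = 1 \<longrightarrow>
        (\<forall>\<tau>\<in>upper_half_plane.
           f ((of_int a * \<tau> + of_int b) / (of_int c * \<tau> + of_int d)) =
             (of_int c * \<tau> + of_int d) powi k * f \<tau>)) \<and>
     (\<exists>a. has_q_expansion f a)"

definition real_fourier_coefficients :: "(complex \<Rightarrow> complex) \<Rightarrow> bool" where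
  "real_fourier_coefficients f \<longleftrightarrow> (\<exists>a. has_q_expansion f a \<and> (\<forall>n. a n \<in> \<real>))"

text \<open>Bernoulli numbers, with the convention \<open>B\<^sub>1 = -1/2\<close> (immaterial below).\<close>

fun bernoulli_number :: "nat \<Rightarrow> real" where
  "bernoulli_number n =
     (if n = 0 then 1
      else - (\<Sum>k<n. of_nat (Suc n choose k) * bernoulli_number k) / of_nat (Suc n))"

declare bernoulli_number.simps [simp del]

definition divisor_power_sum :: "nat \<Rightarrow> nat \<Rightarrow> nat" where
  "divisor_power_sum r n = (\<Sum>d | d dvd n. d ^ r)"

definition eisenstein_E2 :: "complex \<Rightarrow> complex" where
  "eisenstein_E2 \<tau> = 1 - 24 * (\<Sum>n. of_nat (divisor_power_sum 1 (Suc n)) * nome \<tau> ^ Suc n)"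

text \<open>Meant for even \<open>k \<ge> 4\<close>.\<close>

definition eisenstein_E :: "nat \<Rightarrow> complex \<Rightarrow> complex" where
  "eisenstein_E k \<tau> =
     1 - of_real (2 * of_nat k / bernoulli_number k) *
         (\<Sum>n. of_nat (divisor_power_sum (k - 1) (Suc n)) * nome \<tau> ^ Suc n)"

definition modular_discriminant :: "complex \<Rightarrow> complex" where
  "modular_discriminant \<tau> = (eisenstein_E 4 \<tau> ^ 3 - eisenstein_E 6 \<tau> ^ 2) / 1728"

definition modular_j :: "complex \<Rightarrow> complex" where
  "modular_j \<tau> = eisenstein_E 4 \<tau> ^ 3 / modular_discriminant \<tau>"

definition D_op :: "(complex \<Rightarrow> complex) \<Rightarrow> complex \<Rightarrow> complex" where
  "D_op f \<tau> = 1 / (2 * of_real pi * \<i>) * deriv f \<tau>"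

definition serre_derivative :: "int \<Rightarrow> (complex \<Rightarrow> complex) \<Rightarrow> complex \<Rightarrow> complex" where
  "serre_derivative k f \<tau> = D_op f \<tau> - of_int k / 12 * eisenstein_E2 \<tau> * f \<tau>"

definition j_representation ::
    "int \<Rightarrow> (complex \<Rightarrow> complex) \<Rightarrow> nat \<Rightarrow> nat \<Rightarrow> int \<Rightarrow> complex poly \<Rightarrow> bool" where
  "j_representation w g \<epsilon> \<delta> m P \<longleftrightarrow>
     \<epsilon> \<in> {0, 1, 2} \<and> \<delta> \<in> {0, 1} \<and> w = 4 * int \<epsilon> + 6 * int \<delta> + 12 * m \<and>
     (\<forall>\<tau>\<in>upper_half_plane.
        g \<tau> = eisenstein_E 4 \<tau> ^ \<epsilon> * eisenstein_E 6 \<tau> ^ \<delta> * modular_discriminant \<tau> powi m *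
              poly P (modular_j \<tau>))"

definition fundamental_domain :: "complex set" where
  "fundamental_domain =
     {\<tau> \<in> upper_half_plane. norm \<tau> \<ge> 1 \<and> - 1 / 2 \<le> Re \<tau> \<and> Re \<tau> \<le> 0} \<union>
     {\<tau> \<in> upper_half_plane. norm \<tau> > 1 \<and> 0 < Re \<tau> \<and> Re \<tau> < 1 / 2}"

definition fundamental_arc :: "complex set" where
  "fundamental_arc = {\<tau> \<in> fundamental_domain. norm \<tau> = 1 \<and> - 1 / 2 \<le> Re \<tau> \<and> Re \<tau> \<le> 0}"

lemma bernoulli_number_4: "bernoulli_number 4 = - 1 / 30"
  and bernoulli_number_6: "bernoulli_number 6 = 1 / 42"
proof -
  have b0: "bernoulli_number 0 = 1"
    by (simp add: bernoulli_number.simps)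
  have b1: "bernoulli_number 1 = - 1 / 2"
    by (subst bernoulli_number.simps) (simp add: b0)
  have b2: "bernoulli_number 2 = 1 / 6"
    using b0 b1 by (subst bernoulli_number.simps) (simp add: eval_nat_numeral)
  have b3: "bernoulli_number 3 = 0"
    using b0 b1 b2 by (subst bernoulli_number.simps) (simp add: eval_nat_numeral)
  show b4: "bernoulli_number 4 = - 1 / 30"
    using b0 b1 b2 b3 by (subst bernoulli_number.simps) (simp add: eval_nat_numeral)
  have b5: "bernoulli_number 5 = 0"
    using b0 b1 b2 b3 b4 by (subst bernoulli_number.simps) (simp add: eval_nat_numeral)
  show "bernoulli_number 6 = 1 / 42"
    using b0 b1 b2 b3 b4 b5 by (subst bernoulli_number.simps) (simp add: eval_nat_numeral)
qed

end

theory Submission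
  imports Defs "HOL-Computational_Algebra.Fundamental_Theorem_Algebra"
begin

text \<open>
  The quotient \<open>f\<^sup>1\<^sup>2 / \<Delta>\<^sup>k\<close> has weight \<open>0\<close>, hence equals \<open>Q(j)\<close> for a polynomial \<open>Q\<close>, all of
  whose roots are values of \<open>j\<close> at zeros of \<open>f\<close> on the arc and therefore lie in \<open>[0, 1728]\<close>.  As
  \<open>D \<Delta> = E\<^sub>2 \<Delta>\<close>, the logarithmic derivative of this quotient is \<open>12 \<vartheta>\<^sub>k(f) / f\<close>, so at a point
  with \<open>j(\<tau>) \<notin> [0, 1728]\<close>, where \<open>f\<close> and \<open>Dj = - E\<^sub>4\<^sup>2 E\<^sub>6 / \<Delta>\<close> do not vanish, \<open>\<vartheta>\<^sub>k(f)\<close> can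
  only vanish together with \<open>Q'(j(\<tau>))\<close>, which is excluded by the Gauss--Lucas theorem.

  Modular functions are handled through one principle: a holomorphic function of weight \<open>0\<close> that
  tends to \<open>0\<close> at the cusp is \<open>0\<close>, by the maximum modulus principle.  It gives the surjectivity of
  \<open>j\<close>, the representation by polynomials in \<open>j\<close>, and the uniqueness of forms of weight \<open>< 12\<close>, from
  which Ramanujan's identities follow once \<open>E\<^sub>4\<close>, \<open>E\<^sub>6\<close> are known to be proportional to lattice
  sums and \<open>E\<^sub>2\<close> to be quasimodular.
\<close>

section \<open>The Lipschitz summation formula\<close>

text \<open>The Eisenstein series are given only as \<open>q\<close>-series, so their modularity
  must first be extracted from lattice sums. A circle threatens here: uniqueness arguments divide by
  a form without zeros, while the discriminant is defined through \<open>E4\<close> and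
  \<open>E6\<close>, whose modularity is itself obtained from such a uniqueness argument. Hence a
  second discriminant is built beforehand as \<open>q\<close> times an exponential. It is visibly
  nonzero, its logarithmic derivative is \<open>E2\<close>, and the anomaly of \<open>E2\<close>
  under \<open>-1 / \<tau>\<close> integrates to weight 12. The two discriminants are identified
  once \<open>E4\<close> and \<open>E6\<close> are known to be modular.

  The twelfth power of \<open>f\<close> avoids a case distinction: if \<open>f\<close> itself has
  exponents \<open>\<epsilon>\<close>, \<open>\<delta>\<close> and polynomial \<open>P_f\<close>,
  then \<open>Q = X^(4 \<epsilon>) (X - 1728)^(6 \<delta>) P_f^12\<close>, so every zero of
  \<open>f\<close> is recorded by \<open>Q\<close> alone. The representation of the Serre derivative
  serves only to produce a point at which that derivative vanishes.

  The bounds on \<open>j\<close> along the arc come from the signs of \<open>E6\<close> and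
  \<open>\<Delta>\<close>, made real by powers of \<open>\<tau>\<close>, not from mapping properties
  of \<open>j\<close>.\<close>

lemma Digamma_reflection:
  fixes z :: complex
  assumes "z \<notin> \<int>"
  shows "Digamma (1 - z) - Digamma z = of_real pi * cot (of_real pi * z)"
proof -
  have z1: "z \<notin> \<int>\<^sub>\<le>\<^sub>0" using assms nonpos_Ints_subset_Ints by blast
  have z2: "1 - z \<notin> \<int>\<^sub>\<le>\<^sub>0"
  proof
    assume "1 - z \<in> \<int>\<^sub>\<le>\<^sub>0"
    then have "1 - (1 - z) \<in> \<int>" using nonpos_Ints_subset_Ints by (intro Ints_diff) auto
    with assms show False by simp
  qed
  have s: "sin (of_real pi * z) \<noteq> 0"
  proof
    assume "sin (of_real pi * z) = 0"
    then obtain n where "of_real pi * z = of_real (of_int n * pi)"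
      by (auto simp: sin_eq_0)
    then have "z = of_int n" by (simp add: mult.commute)
    with assms show False by simp
  qed
  \<comment> \<open>\<open>d1\<close> and \<open>d2\<close> differentiate the two sides of Euler's
    reflection formula; cancelling their common nonzero value \<open>pi / sin (pi z)\<close> then
    leaves the logarithmic derivatives.\<close>
  have d1: "((\<lambda>z. Gamma z * Gamma (1 - z)) has_field_derivative
      Gamma z * Gamma (1 - z) * (Digamma z - Digamma (1 - z))) (at z)"
    by (auto intro!: derivative_eq_intros z1 z2 simp: algebra_simps)
  have d2: "((\<lambda>z. of_real pi / sin (of_real pi * z)) has_field_derivative
      - (of_real pi * (of_real pi * cos (of_real pi * z))) / (sin (of_real pi * z))^2) (at z)"
    using s by (auto intro!: derivative_eq_intros simp: power2_eq_square)
  have "(\<lambda>z::complex. Gamma z * Gamma (1 - z)) = (\<lambda>z. of_real pi / sin (of_real pi * z))"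
    by (rule ext) (rule Gamma_reflection_complex)
  then have "Gamma z * Gamma (1 - z) * (Digamma z - Digamma (1 - z))
      = - (of_real pi * (of_real pi * cos (of_real pi * z))) / (sin (of_real pi * z))^2"
    using d1 d2 DERIV_unique by metis
  then have "of_real pi / sin (of_real pi * z) * (Digamma z - Digamma (1 - z)) =
      - (of_real pi / sin (of_real pi * z) * (of_real pi * cot (of_real pi * z)))"
    unfolding Gamma_reflection_complex by (simp add: cot_def power2_eq_square)
  also have "\<dots> = of_real pi / sin (of_real pi * z) * (- (of_real pi * cot (of_real pi * z)))"
    by (rule mult_minus_right [symmetric])
  finally have "Digamma z - Digamma (1 - z) = - (of_real pi * cot (of_real pi * z))"
    by (rule mult_left_cancel[THEN iffD1, rotated]) (use s in simp)
  then show ?thesis by (metis minus_diff_eq minus_minus)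
qed

text \<open>With \<open>inverse 0 = 0\<close> and \<open>cot 0 = 0\<close> this is also true for \<open>z = 0\<close>.\<close>

lemma cot_symmetric_partial_fractions:
  fixes z :: complex
  assumes "z \<notin> \<int> - {0}"
  shows "(\<lambda>N. \<Sum>m\<in>{- int N..int N}. inverse (z + of_int m)) \<longlonglongrightarrow> of_real pi * cot (of_real pi * z)"
proof (cases "z = 0")
  case True
  have "(\<Sum>m\<in>{- int N..int N}. inverse (of_int m :: complex)) = 0" for N
  proof -
    have "(\<Sum>m\<in>{- int N..int N}. inverse (of_int m :: complex)) =
          (\<Sum>m\<in>{- int N..int N}. inverse (of_int (- m) :: complex))"
      by (rule sum.reindex_bij_witness[of _ uminus uminus]) auto
    also have "\<dots> = - (\<Sum>m\<in>{- int N..int N}. inverse (of_int m :: complex))"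
      by (simp add: sum_negf)
    finally show ?thesis by simp
  qed
  then show ?thesis using True by simp
next
  case False
  with assms have zI: "z \<notin> \<int>" by auto
  then have z1: "z \<noteq> 0" "1 - z \<noteq> 0" by auto
  \<comment> \<open>The terms \<open>m = 0..N-1\<close> and \<open>m = -N..-1\<close> form the
    truncated digamma series at \<open>z\<close> and at \<open>1 - z\<close>. The logarithms cancel,
    and the term \<open>m = N\<close> is left over; it tends to 0.\<close>
  have sp: "(\<Sum>m\<in>{- int N..int N}. inverse (z + of_int m)) =
      (of_real (ln (real N)) - (\<Sum>n<N. inverse (1 - z + of_nat n)))
      - (of_real (ln (real N)) - (\<Sum>n<N. inverse (z + of_nat n)))
      + inverse (z + of_nat N)" for N
  proof (induction N)
    case (Suc N)
    have e: "{- int (Suc N)..int (Suc N)} = insert (- int (Suc N)) (insert (int (Suc N)) {- int N..int N})"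
      by auto
    have n: "1 - z + of_nat N = - (z + of_int (- int (Suc N)))" by simp
    have "(\<Sum>m\<in>{- int (Suc N)..int (Suc N)}. inverse (z + of_int m)) =
       inverse (z + of_int (- int (Suc N))) + (inverse (z + of_int (int (Suc N))) + (\<Sum>m\<in>{- int N..int N}. inverse (z + of_int m)))"
      unfolding e by (subst sum.insert, simp, simp)+ simp
    then show ?case using Suc n
      unfolding sum.lessThan_Suc n inverse_minus_eq by simp
  qed simp
  have lim0: "(\<lambda>N. inverse (z + of_nat N)) \<longlonglongrightarrow> 0"
    by (rule tendsto_inverse_0[THEN filterlim_compose])
       (rule tendsto_add_filterlim_at_infinity[OF tendsto_const tendsto_of_nat])
  have "(\<lambda>N. \<Sum>m\<in>{- int N..int N}. inverse (z + of_int m)) \<longlonglongrightarrow> Digamma (1 - z) - Digamma z + 0"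
    unfolding sp by (intro tendsto_intros Digamma_LIMSEQ z1 lim0)
  then show ?thesis using Digamma_reflection[OF zI] by simp
qed

lemma upper_half_plane_not_Ints: "z \<in> upper_half_plane \<Longrightarrow> z \<notin> \<int>"
  by (auto simp: upper_half_plane_def elim!: Ints_cases)

lemma norm_nome_less_1: "\<tau> \<in> upper_half_plane \<Longrightarrow> norm (nome \<tau>) < 1"
  by (auto simp: nome_def upper_half_plane_def)

lemma nome_nonzero [simp]: "nome \<tau> \<noteq> 0"
  by (simp add: nome_def)


lemma has_field_derivative_eval_fps_nome:
  assumes "fps_conv_radius F \<ge> 1" "\<tau> \<in> upper_half_plane"
  shows "((\<lambda>\<tau>. eval_fps F (nome \<tau>)) has_field_derivative
           2 * of_real pi * \<i> * eval_fps (fps_XD F) (nome \<tau>)) (at \<tau>)"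
proof -
  have *: "ereal (norm (nome \<tau>)) < fps_conv_radius F"
    using norm_nome_less_1[OF assms(2)] assms(1) by (metis ereal_less(3) less_le_trans)
  have d: "(nome has_field_derivative 2 * of_real pi * \<i> * nome \<tau>) (at \<tau>)"
    unfolding nome_def[abs_def] by (auto intro!: derivative_eq_intros)
  have "((\<lambda>\<tau>. eval_fps F (nome \<tau>)) has_field_derivative
           eval_fps (fps_deriv F) (nome \<tau>) * (2 * of_real pi * \<i> * nome \<tau>)) (at \<tau>)"
    by (rule DERIV_chain2[OF has_field_derivative_eval_fps d]) fact
  moreover have "eval_fps (fps_XD F) (nome \<tau>) = nome \<tau> * eval_fps (fps_deriv F) (nome \<tau>)"
    unfolding fps_XD_def o_def using * fps_conv_radius_deriv[of F]
    by (subst eval_fps_mult) (auto intro: less_le_trans)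
  ultimately show ?thesis by (simp add: mult_ac)
qed

text \<open>The polylogarithm of order \<open>- n\<close>. For \<open>n = 0\<close> the convention
  \<open>0 ^ 0 = 1\<close> gives the full geometric series \<open>1 / (1 - q)\<close>; for
  \<open>n > 0\<close> the constant coefficient is 0.\<close>

definition power_nat_fps :: "nat \<Rightarrow> complex fps" where
  "power_nat_fps n = Abs_fps (\<lambda>r. of_nat r ^ n)"

lemma fps_conv_radius_XD: "fps_conv_radius (fps_XD F) \<ge> fps_conv_radius (F :: complex fps)"
  unfolding fps_XD_def o_def
  by (rule order_trans[OF _ fps_conv_radius_mult]) (auto intro: fps_conv_radius_deriv)

lemma power_nat_fps_Suc: "power_nat_fps (Suc n) = fps_XD (power_nat_fps n)"
  by (rule fps_ext) (simp add: power_nat_fps_def)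

lemma conv_radius_power_nat_fps: "fps_conv_radius (power_nat_fps n) \<ge> 1"
proof (induction n)
  case 0
  have "conv_radius (\<lambda>n. 1 :: complex) \<ge> 1"
    by (rule conv_radius_geI_ex') (auto intro!: summable_geometric)
  then have "fps_conv_radius (power_nat_fps 0) \<ge> 1"
    unfolding fps_conv_radius_def power_nat_fps_def by simp
  then show ?case by simp
next
  case (Suc n)
  then show ?case using fps_conv_radius_XD[of "power_nat_fps n"]
    unfolding power_nat_fps_Suc by (rule order_trans)
qed

lemma cot_conv_exp:
  fixes w :: complex
  assumes "exp (2 * (\<i> * w)) \<noteq> 1"
  shows "cot w = \<i> * ((exp (2 * (\<i> * w)) + 1) / (exp (2 * (\<i> * w)) - 1))"
proof -
  define E where "E = exp (\<i> * w)"
  have E0: "E \<noteq> 0" by (simp add: E_def)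
  have e: "exp (2 * (\<i> * w)) = E ^ 2" unfolding E_def by (metis exp_double)
  have ne: "E ^ 2 - 1 \<noteq> 0" using assms e by auto
  have e2: "exp (- (\<i> * w)) = 1 / E" by (simp add: E_def exp_minus inverse_eq_divide)
  have s: "sin w = (E ^ 2 - 1) / (2 * \<i> * E)" and c: "cos w = (E ^ 2 + 1) / (2 * E)"
    unfolding sin_exp_eq cos_exp_eq e2 E_def[symmetric] using E0
    by (simp_all add: field_simps power2_eq_square)
  show ?thesis
    unfolding cot_def s c e using E0 by simp
qed

text \<open>This is the \<open>n\<close>-th derivative of the cotangent formula. Each
  differentiation changes the sign of the term at \<open>1 - z\<close> and applies
  \<open>2 pi \<i> q d/dq\<close> to the \<open>q\<close>-series, which raises the order of
  \<open>power_nat_fps\<close> by one; the constant \<open>pi \<i>\<close> disappears after the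
  first.\<close>

lemma Polygamma_reflection:
  assumes "z \<in> upper_half_plane"
  shows "(-1) ^ n * Polygamma n (1 - z) - Polygamma n z =
    (if n = 0 then of_real pi * \<i> else 0) - (2 * of_real pi * \<i>) ^ Suc n * eval_fps (power_nat_fps n) (nome z)"
  using assms
proof (induction n arbitrary: z)
  case 0
  define w where "w = of_real pi * z"
  have q: "nome z = exp (2 * (\<i> * w))" by (simp add: nome_def w_def mult_ac)
  have q1: "norm (nome z) < 1" using norm_nome_less_1 0 by auto
  then have q1': "nome z \<noteq> 1" by auto
  have "eval_fps (power_nat_fps 0) (nome z) = 1 / (1 - nome z)"
    unfolding eval_fps_def power_nat_fps_def using suminf_geometric[OF q1] by simp
  moreover have "of_real pi * cot w = of_real pi * \<i> - 2 * of_real pi * \<i> * (1 / (1 - nome z))"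
  proof -
    have ne: "nome z - 1 \<noteq> 0" using q1' by auto
    have "cot w = \<i> * ((nome z + 1) / (nome z - 1))"
      using cot_conv_exp[of w] q1' unfolding q by simp
    also have "(nome z + 1) / (nome z - 1) = 1 - 2 * (1 / (1 - nome z))"
      using ne by (simp add: field_simps)
    finally show ?thesis
      by (simp add: right_diff_distrib mult.assoc flip: times_divide_eq_right)
  qed
  ultimately show ?case using Digamma_reflection[OF upper_half_plane_not_Ints[OF 0]]
    by (simp add: w_def)
next
  case (Suc n)
  have z1: "z \<notin> \<int>\<^sub>\<le>\<^sub>0" and z2: "1 - z \<notin> \<int>\<^sub>\<le>\<^sub>0"
    using upper_half_plane_not_Ints[OF Suc.prems] nonpos_Ints_subset_Ints
    by (auto dest!: subsetD[OF nonpos_Ints_subset_Ints] dest: Ints_diff[OF Ints_1, of "1 - z"])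
  have "((\<lambda>z. (-1) ^ n * Polygamma n (1 - z) - Polygamma n z) has_field_derivative
      (-1) ^ Suc n * Polygamma (Suc n) (1 - z) - Polygamma (Suc n) z) (at z)"
    by (rule derivative_eq_intros z1 z2 refl | simp)+
  moreover have "((\<lambda>z. (if n = 0 then of_real pi * \<i> else 0) -
        (2 * of_real pi * \<i>) ^ Suc n * eval_fps (power_nat_fps n) (nome z)) has_field_derivative
      0 - (2 * of_real pi * \<i>) ^ Suc n *
        (2 * of_real pi * \<i> * eval_fps (power_nat_fps (Suc n)) (nome z))) (at z)"
    unfolding power_nat_fps_Suc
    by (intro DERIV_diff DERIV_const DERIV_cmult has_field_derivative_eval_fps_nome
         conv_radius_power_nat_fps Suc.prems)
  then have "((\<lambda>z. (-1) ^ n * Polygamma n (1 - z) - Polygamma n z) has_field_derivative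
      0 - (2 * of_real pi * \<i>) ^ Suc n *
        (2 * of_real pi * \<i> * eval_fps (power_nat_fps (Suc n)) (nome z))) (at z)"
    by (rule has_field_derivative_transform_within_open[of _ _ _ upper_half_plane])
       (use Suc in \<open>auto simp: upper_half_plane_def open_halfspace_Im_gt\<close>)
  ultimately have "(-1) ^ Suc n * Polygamma (Suc n) (1 - z) - Polygamma (Suc n) z =
     0 - (2 * of_real pi * \<i>) ^ Suc n *
        (2 * of_real pi * \<i> * eval_fps (power_nat_fps (Suc n)) (nome z))"
    by (rule DERIV_unique)
  then show ?case by (simp add: mult_ac)
qed

section \<open>Lattice sums\<close>

text \<open>Splitting the integers into \<open>n\<close> and \<open>- n - 1\<close> matches the
  polygamma series at \<open>z\<close> and \<open>1 - z\<close>, because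
  \<open>z - n - 1 = - (1 - z + n)\<close>.\<close>

lemma UNIV_int_split: "(UNIV :: int set) = range int \<union> range (\<lambda>n. - int n - 1)"
  by (auto simp: image_iff) (metis add.inverse_inverse diff_add_cancel int_cases minus_diff_eq negD of_nat_Suc uminus_add_conv_diff add.commute)

lemma has_sum_int:
  fixes f :: "int \<Rightarrow> 'a :: {topological_comm_monoid_add}"
  assumes "((\<lambda>n. f (int n)) has_sum a) UNIV" "((\<lambda>n. f (- int n - 1)) has_sum b) UNIV"
  shows "(f has_sum (a + b)) UNIV"
  unfolding UNIV_int_split
proof (rule has_sum_Un_disjoint)
  show "(f has_sum a) (range int)"
    using assms(1) by (subst has_sum_reindex) (auto simp: o_def)
  show "(f has_sum b) (range (\<lambda>n. - int n - 1))"
    using assms(2) by (subst has_sum_reindex) (auto simp: o_def inj_on_def)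
qed auto

text \<open>The exponent 3/2 is half of 3: an inverse cube that is controlled by both coordinates
  splits into a product of two such weights, and \<open>3/2 > 1\<close> keeps each of them
  summable.\<close>

definition lattice_weight :: "int \<Rightarrow> real" where
  "lattice_weight m = (1 + \<bar>real_of_int m\<bar>) powr (-3/2)"

lemma lattice_weight_nonneg [simp]: "lattice_weight m \<ge> 0"
  by (simp add: lattice_weight_def)

lemma summable_lattice_weight: "lattice_weight summable_on UNIV"
proof -
  have s: "summable (\<lambda>n. real (Suc n) powr (-3/2))"
    by (subst summable_Suc_iff) (simp add: summable_real_powr_iff)
  have 1: "(\<lambda>n. lattice_weight (int n)) summable_on UNIV"
    by (rule norm_summable_imp_summable_on) (use s in \<open>simp add: lattice_weight_def add_ac\<close>)
  have "summable (\<lambda>n. real (Suc (Suc n)) powr (-3/2))"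
    using s by (subst (asm) summable_Suc_iff [symmetric])
  moreover have "1 + \<bar>real_of_int (- int n - 1)\<bar> = real (Suc (Suc n))" for n by simp
  ultimately have 2: "(\<lambda>n. lattice_weight (- int n - 1)) summable_on UNIV"
    by (intro norm_summable_imp_summable_on) (simp only: lattice_weight_def real_norm_def abs_of_nonneg powr_ge_zero)
  from 1 2 show ?thesis unfolding summable_on_def using has_sum_int by blast
qed

text \<open>The imaginary part of the lattice point controls \<open>m\<close>, and then the triangle
  inequality controls \<open>n\<close>. Away from the origin one coordinate has absolute value at
  least 1, so the added 1 costs only a factor 2 in the constant.\<close>

lemma lattice_point_bound:
  assumes "\<tau> \<in> upper_half_plane"
  obtains K where "K > 0"
    "\<And>m n :: int. (m, n) \<noteq> (0, 0) \<Longrightarrow> 1 + \<bar>real_of_int m\<bar> \<le> K * norm (of_int m * \<tau> + of_int n)"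
    "\<And>m n :: int. (m, n) \<noteq> (0, 0) \<Longrightarrow> 1 + \<bar>real_of_int n\<bar> \<le> K * norm (of_int m * \<tau> + of_int n)"
proof
  define y where "y = Im \<tau>"
  have y: "y > 0" using assms by (simp add: upper_half_plane_def y_def)
  define K where "K = 1 / y + (1 + norm \<tau> / y)"
  have K: "K > 0" unfolding K_def using y by (intro add_pos_pos add_pos_nonneg) auto
  show "2 * K > 0" using K by simp
  fix m n :: int assume mn: "(m, n) \<noteq> (0, 0)"
  define z where "z = of_int m * \<tau> + of_int n"
  have m1: "\<bar>real_of_int m\<bar> \<le> norm z / y"
  proof -
    have "\<bar>real_of_int m\<bar> * y = \<bar>Im z\<bar>" using y by (simp add: z_def y_def abs_mult)
    also have "\<dots> \<le> norm z" by (rule abs_Im_le_cmod)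
    finally show ?thesis using y by (simp add: field_simps)
  qed
  have m: "\<bar>real_of_int m\<bar> \<le> K * norm z"
  proof -
    have "norm z / y \<le> norm z / y + (1 + norm \<tau> / y) * norm z" using y by simp
    then show ?thesis using m1 by (simp add: K_def algebra_simps)
  qed
  have n: "\<bar>real_of_int n\<bar> \<le> K * norm z"
  proof -
    have "of_int n = z - of_int m * \<tau>" by (simp add: z_def)
    then have "norm (of_int n :: complex) \<le> norm z + norm (of_int m * \<tau>)"
      by (metis norm_triangle_ineq4)
    also have "\<dots> = norm z + \<bar>real_of_int m\<bar> * norm \<tau>" by (simp add: norm_mult)
    also have "\<dots> \<le> norm z + norm z / y * norm \<tau>" using m1 by (intro add_left_mono mult_right_mono) auto
    also have "\<dots> \<le> norm z / y + (norm z + norm z / y * norm \<tau>)" using y by simp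
    also have "\<dots> = K * norm z" by (simp add: K_def algebra_simps)
    finally show ?thesis by simp
  qed
  have "max \<bar>real_of_int m\<bar> \<bar>real_of_int n\<bar> \<ge> 1" using mn by (cases "m = 0") auto
  with m n have "1 \<le> K * norm z" by linarith
  with m n show "1 + \<bar>real_of_int m\<bar> \<le> 2 * K * norm (of_int m * \<tau> + of_int n)"
    and "1 + \<bar>real_of_int n\<bar> \<le> 2 * K * norm (of_int m * \<tau> + of_int n)"
    unfolding z_def by linarith+
qed

lemma summable_lattice_row:
  assumes "\<tau> \<in> upper_half_plane" "k \<ge> 2"
  shows "(\<lambda>n::int. inverse ((of_int m * \<tau> + of_int n) ^ k)) summable_on UNIV"
proof -
  obtain K where K: "K > 0"
    "\<And>m n :: int. (m, n) \<noteq> (0, 0) \<Longrightarrow> 1 + \<bar>real_of_int m\<bar> \<le> K * norm (of_int m * \<tau> + of_int n)"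
    "\<And>m n :: int. (m, n) \<noteq> (0, 0) \<Longrightarrow> 1 + \<bar>real_of_int n\<bar> \<le> K * norm (of_int m * \<tau> + of_int n)"
    using lattice_point_bound[OF assms(1)] by blast
  have "norm (inverse ((of_int m * \<tau> + of_int n) ^ k)) \<le> K ^ k * lattice_weight n" for n :: int
  proof (cases "(m, n) = (0, 0)")
    case False
    define t where "t = 1 + \<bar>real_of_int n\<bar>"
    have t: "t \<ge> 1" by (simp add: t_def)
    define N where "N = norm (of_int m * \<tau> + of_int n) ^ k"
    have "t \<le> K * norm (of_int m * \<tau> + of_int n)" using K(3)[OF False] by (simp add: t_def)
    then have "t ^ k \<le> (K * norm (of_int m * \<tau> + of_int n)) ^ k" using t by (intro power_mono) auto
    then have le: "t ^ k \<le> K ^ k * N" by (simp add: N_def power_mult_distrib)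
    have tk: "t ^ k > 0" using t by simp
    then have "K ^ k * N > 0" using le by linarith
    then have "N > 0" using K(1) by (simp add: zero_less_mult_iff)
    then have "inverse N \<le> K ^ k * inverse (t ^ k)" using le tk by (simp add: field_simps)
    also have "inverse (t ^ k) = t powr (- real k)"
      using t by (simp add: powr_minus powr_realpow)
    also have "\<dots> \<le> t powr (-3/2)" using t assms(2) by (intro powr_mono) auto
    finally show ?thesis using K(1) by (simp add: lattice_weight_def t_def N_def norm_inverse norm_power)
  qed (use assms(2) K(1) in \<open>auto simp: zero_power\<close>)
  then have "(\<lambda>n::int. norm (inverse ((of_int m * \<tau> + of_int n) ^ k))) summable_on UNIV"
    by (intro summable_on_comparison_test[OF summable_on_cmult_right[OF summable_lattice_weight, of "K ^ k"]]) auto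
  then show ?thesis by (rule abs_summable_summable)
qed

text \<open>Up to sign and the factor \<open>fact (k - 1)\<close>, the two halves of the bilateral
  series are the polygamma series of order \<open>k - 1\<close> at \<open>z\<close> and at
  \<open>1 - z\<close>; the reflection formula evaluates their sum. As \<open>k - 1 \<ge> 1\<close>,
  no constant term remains.\<close>

theorem Lipschitz_formula:
  assumes "z \<in> upper_half_plane" "k \<ge> 2"
  shows "((\<lambda>m::int. inverse ((z + of_int m) ^ k)) has_sum
          (- (2 * of_real pi * \<i>)) ^ k / fact (k - 1) * eval_fps (power_nat_fps (k - 1)) (nome z)) UNIV"
proof -
  obtain n where k: "k = Suc n" and n: "n \<ge> 1" using assms(2) by (cases k) auto
  let ?f = "\<lambda>m::int. inverse ((z + of_int m) ^ k)"
  have s: "?f summable_on UNIV" using summable_lattice_row[OF assms, of 1] by simp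
  have s1: "(\<lambda>n. ?f (int n)) summable_on UNIV"
    using summable_on_reindex[of int UNIV ?f] summable_on_subset[OF s, of "range int"] by (simp add: o_def)
  have s2: "(\<lambda>n. ?f (- int n - 1)) summable_on UNIV"
    using summable_on_reindex[of "\<lambda>n. - int n - 1" UNIV ?f] summable_on_subset[OF s, of "range (\<lambda>n. - int n - 1)"]
    by (simp add: o_def inj_on_def)
  have z0: "z \<noteq> 0" "1 - z \<noteq> 0" using assms(1) by (auto simp: upper_half_plane_def complex_eq_iff)
  have e1: "((\<lambda>n. ?f (int n)) has_sum (-1) ^ k * Polygamma n z / fact n) UNIV"
  proof -
    have "(\<lambda>n. ?f (int n)) sums ((-1) ^ k * Polygamma n z / fact n)"
      using Polygamma_LIMSEQ[OF z0(1), of n] n by (simp add: k)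
    moreover have "((\<lambda>n. ?f (int n)) has_sum infsum (\<lambda>n. ?f (int n)) UNIV) UNIV" using s1 by simp
    ultimately show ?thesis using has_sum_imp_sums sums_unique2 by metis
  qed
  have e2: "((\<lambda>n. ?f (- int n - 1)) has_sum Polygamma n (1 - z) / fact n) UNIV"
  proof -
    have eq: "?f (- int j - 1) = (-1) ^ k * inverse ((1 - z + of_nat j) ^ Suc n)" for j
    proof -
      have "z + of_int (- int j - 1) = - 1 * (1 - z + of_nat j)" by simp
      then show ?thesis unfolding k by (simp only: power_mult_distrib inverse_mult_distrib) (simp flip: power_inverse)
    qed
    have "(\<lambda>j. (-1) ^ k * inverse ((1 - z + of_nat j) ^ Suc n)) sums ((-1) ^ k * ((-1) ^ k * Polygamma n (1 - z) / fact n))"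
      using Polygamma_LIMSEQ[OF z0(2), of n] n unfolding k by (intro sums_mult) auto
    then have "(\<lambda>n. ?f (- int n - 1)) sums (Polygamma n (1 - z) / fact n)"
      unfolding eq by (simp add: k flip: mult.assoc power_add)
    moreover have "((\<lambda>n. ?f (- int n - 1)) has_sum infsum (\<lambda>n. ?f (- int n - 1)) UNIV) UNIV" using s2 by simp
    ultimately show ?thesis using has_sum_imp_sums sums_unique2 by metis
  qed
  have "(-1) ^ k * Polygamma n z / fact n + Polygamma n (1 - z) / fact n
     = (-1) ^ n * ((-1) ^ n * Polygamma n (1 - z) - Polygamma n z) / fact n"
    by (simp add: k field_simps flip: power_add mult.assoc)
  also have "\<dots> = (- (2 * of_real pi * \<i>)) ^ k / fact (k - 1) * eval_fps (power_nat_fps (k - 1)) (nome z)"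
    unfolding Polygamma_reflection[OF assms(1)] using n
    by (simp add: k power_minus[of "2 * complex_of_real pi * \<i>" "Suc n"] del: power_Suc) simp
  finally show ?thesis using has_sum_int[OF e1 e2] by simp
qed

text \<open>The common majorant for everything below: higher powers are compared with the cube
  because nonzero lattice points stay away from 0, and the corrected series of weight 2 has terms of
  cubic size.\<close>

lemma abs_summable_lattice_cube:
  assumes "\<tau> \<in> upper_half_plane"
  shows "(\<lambda>(m::int, n::int). inverse (norm (of_int m * \<tau> + of_int n) ^ 3)) summable_on UNIV"
proof -
  obtain K where K: "K > 0"
    "\<And>m n :: int. (m, n) \<noteq> (0, 0) \<Longrightarrow> 1 + \<bar>real_of_int m\<bar> \<le> K * norm (of_int m * \<tau> + of_int n)"
    "\<And>m n :: int. (m, n) \<noteq> (0, 0) \<Longrightarrow> 1 + \<bar>real_of_int n\<bar> \<le> K * norm (of_int m * \<tau> + of_int n)"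
    using lattice_point_bound[OF assms(1)] by blast
  have "(\<lambda>(m, n). lattice_weight m * lattice_weight n) summable_on UNIV \<times> UNIV"
    using summable_lattice_weight
    by (intro summable_on_SigmaI[where g = "\<lambda>m. lattice_weight m * infsum lattice_weight UNIV"])
       (auto intro!: has_sum_cmult_right summable_on_cmult_left)
  then have S: "(\<lambda>(m, n). lattice_weight m * lattice_weight n) summable_on UNIV" by simp
  have "inverse (norm (of_int m * \<tau> + of_int n) ^ 3) \<le> K ^ 3 * (lattice_weight m * lattice_weight n)" for m n :: int
  proof (cases "(m, n) = (0, 0)")
    case False
    define a b where "a = 1 + \<bar>real_of_int m\<bar>" and "b = 1 + \<bar>real_of_int n\<bar>"
    define z where "z = norm (of_int m * \<tau> + of_int n)"
    have ab: "a \<ge> 1" "b \<ge> 1" "a \<le> K * z" "b \<le> K * z"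
      using K(2,3)[OF False] by (auto simp: a_def b_def z_def)
    then have Kz: "K * z > 0" by linarith
    then have z: "z > 0" using K(1) by (simp add: zero_less_mult_iff)
    have "a powr (3/2) * b powr (3/2) \<le> (K * z) powr (3/2) * (K * z) powr (3/2)"
      using ab by (intro mult_mono powr_mono2) auto
    also have "\<dots> = (K * z) ^ 3"
      using Kz powr_realpow[of "K * z" 3] by (simp flip: powr_add)
    finally have "inverse ((K * z) ^ 3) \<le> inverse (a powr (3/2) * b powr (3/2))"
      using ab by (intro le_imp_inverse_le) auto
    then have "K ^ 3 * inverse ((K * z) ^ 3) \<le> K ^ 3 * inverse (a powr (3/2) * b powr (3/2))"
      using K(1) by (intro mult_left_mono) auto
    then have "inverse (z ^ 3) \<le> K ^ 3 * (inverse (a powr (3/2)) * inverse (b powr (3/2)))"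
      using K(1) by (simp add: power_mult_distrib del: mult_le_cancel_left_pos flip: mult.assoc)
    then show ?thesis by (simp add: lattice_weight_def powr_minus a_def b_def z_def)
  qed (use K(1) in auto)
  then show ?thesis
    by (intro summable_on_comparison_test[OF summable_on_cmult_right[OF S, of "K ^ 3"]]) auto
qed

lemma summable_lattice_power:
  assumes "\<tau> \<in> upper_half_plane" "k \<ge> 3"
  shows "(\<lambda>(m::int, n::int). inverse ((of_int m * \<tau> + of_int n) ^ k)) summable_on UNIV"
proof -
  obtain K where K: "K > 0"
    "\<And>m n :: int. (m, n) \<noteq> (0, 0) \<Longrightarrow> 1 + \<bar>real_of_int m\<bar> \<le> K * norm (of_int m * \<tau> + of_int n)"
    "\<And>m n :: int. (m, n) \<noteq> (0, 0) \<Longrightarrow> 1 + \<bar>real_of_int n\<bar> \<le> K * norm (of_int m * \<tau> + of_int n)"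
    using lattice_point_bound[OF assms(1)] by blast
  have "norm (inverse ((of_int m * \<tau> + of_int n) ^ k)) \<le>
     K ^ (k - 3) * inverse (norm (of_int m * \<tau> + of_int n) ^ 3)" for m n :: int
  proof (cases "(m, n) = (0, 0)")
    case False
    define z where "z = norm (of_int m * \<tau> + of_int n)"
    have "1 \<le> K * z" using K(2)[OF False] by (simp add: z_def)
    then have z: "z > 0" using K(1) by (smt (verit) zero_less_mult_iff)
    have "1 \<le> (K * z) ^ (k - 3)" using \<open>1 \<le> K * z\<close> by (rule one_le_power)
    then have "inverse (z ^ (k - 3)) \<le> K ^ (k - 3)"
      using z by (simp add: power_mult_distrib field_simps)
    then have "inverse (z ^ (k - 3)) * inverse (z ^ 3) \<le> K ^ (k - 3) * inverse (z ^ 3)"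
      using z by (intro mult_right_mono) auto
    moreover have "z ^ (k - 3) * z ^ 3 = z ^ k" using assms(2) by (simp flip: power_add)
    ultimately show ?thesis by (simp add: norm_inverse norm_power z_def flip: inverse_mult_distrib)
  qed (use assms(2) K(1) in \<open>auto simp: power_0_left\<close>)
  then have "(\<lambda>p. norm ((\<lambda>(m::int, n::int). inverse ((of_int m * \<tau> + of_int n) ^ k)) p)) summable_on UNIV"
    by (intro summable_on_comparison_test[OF summable_on_cmult_right[OF abs_summable_lattice_cube[OF assms(1)], of "K ^ (k - 3)"]]) auto
  then show ?thesis by (rule abs_summable_summable)
qed

text \<open>The origin contributes \<open>inverse 0 = 0\<close>.\<close>

definition lattice_eisenstein :: "nat \<Rightarrow> complex \<Rightarrow> complex" where
  "lattice_eisenstein k \<tau> = (\<Sum>\<^sub>\<infinity>(m::int, n::int)\<in>UNIV. inverse ((of_int m * \<tau> + of_int n) ^ k))"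

lemma upper_half_plane_S: "\<tau> \<in> upper_half_plane \<Longrightarrow> - 1 / \<tau> \<in> upper_half_plane"
  by (auto simp: upper_half_plane_def Im_divide power2_eq_square intro!: divide_pos_pos add_nonneg_pos)

lemma upper_half_plane_nonzero: "\<tau> \<in> upper_half_plane \<Longrightarrow> \<tau> \<noteq> 0"
  by (auto simp: upper_half_plane_def)

lemma lattice_eisenstein_S:
  assumes "\<tau> \<in> upper_half_plane"
  shows "lattice_eisenstein k (- 1 / \<tau>) = \<tau> ^ k * lattice_eisenstein k \<tau>"
proof -
  have t: "\<tau> \<noteq> 0" using upper_half_plane_nonzero[OF assms] .
  have "lattice_eisenstein k (- 1 / \<tau>) =
      (\<Sum>\<^sub>\<infinity>(m::int, n::int)\<in>UNIV. inverse ((of_int (- n) * (- 1 / \<tau>) + of_int m) ^ k))"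
    unfolding lattice_eisenstein_def
    by (rule infsum_reindex_bij_witness[of _ "\<lambda>(m, n). (- n, m)" "\<lambda>(m, n). (n, - m)"]) auto
  also have "\<dots> = (\<Sum>\<^sub>\<infinity>p\<in>UNIV. \<tau> ^ k * (\<lambda>(m::int, n::int). inverse ((of_int m * \<tau> + of_int n) ^ k)) p)"
  proof (rule infsum_cong, clarify)
    fix m n :: int
    have "of_int (- n) * (- 1 / \<tau>) + of_int m = (of_int m * \<tau> + of_int n) / \<tau>"
      using t by (simp add: field_simps)
    then show "inverse ((of_int (- n) * (- 1 / \<tau>) + of_int m) ^ k) =
       \<tau> ^ k * inverse ((of_int m * \<tau> + of_int n) ^ k)"
      by (simp add: power_mult_distrib divide_inverse power_inverse)
  qed
  also have "\<dots> = \<tau> ^ k * lattice_eisenstein k \<tau>"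
    unfolding lattice_eisenstein_def by (rule infsum_cmult_right')
  finally show ?thesis .
qed

section \<open>Divisor sums, Lambert series and the rows of the lattice sum\<close>

definition divisor_fps :: "nat \<Rightarrow> complex fps" where
  "divisor_fps r = Abs_fps (\<lambda>n. if n = 0 then 0 else of_nat (divisor_power_sum r n))"

lemma divisor_power_sum_le: "divisor_power_sum r n \<le> n ^ Suc r" if "n > 0"
proof -
  have "divisor_power_sum r n \<le> (\<Sum>d | d dvd n. n ^ r)"
    unfolding divisor_power_sum_def using that by (intro sum_mono power_mono) (auto dest: dvd_imp_le)
  also have "\<dots> = card {d. d dvd n} * n ^ r" by simp
  also have "card {d. d dvd n} \<le> card {1..n}"
    using that by (intro card_mono) (auto dest: dvd_imp_le intro: Nat.gr0I simp: Suc_le_eq)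
  then have "card {d. d dvd n} * n ^ r \<le> n * n ^ r" by (intro mult_right_mono) auto
  finally show ?thesis by simp
qed

lemma fps_conv_radius_ge_1_mono:
  fixes F G :: "complex fps"
  assumes le: "\<And>n. norm (fps_nth F n) \<le> norm (fps_nth G n)" and G: "fps_conv_radius G \<ge> 1"
  shows "fps_conv_radius F \<ge> 1"
proof -
  have "summable (\<lambda>n. fps_nth F n * of_real t ^ n)" if "0 < t" "t < 1" for t
  proof (rule summable_comparison_test'[of _ 0])
    have "ereal (norm (complex_of_real t)) < 1" using that by simp
    then have "ereal (norm (complex_of_real t)) < conv_radius (fps_nth G)"
      using G unfolding fps_conv_radius_def by (rule less_le_trans)
    then show "summable (\<lambda>n. norm (fps_nth G n * of_real t ^ n))"
      by (rule abs_summable_in_conv_radius)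
    show "norm (fps_nth F n * of_real t ^ n) \<le> norm (fps_nth G n * of_real t ^ n)" for n
      unfolding norm_mult by (intro mult_right_mono le) simp
  qed
  then show ?thesis
    unfolding fps_conv_radius_def by (intro conv_radius_geI_ex') auto
qed

lemma conv_radius_divisor_fps: "fps_conv_radius (divisor_fps r) \<ge> 1"
proof -
  have le: "norm (fps_nth (divisor_fps r) n) \<le> norm (fps_nth (power_nat_fps (Suc r)) n)" for n
  proof (cases "n = 0")
    case False
    then have "real (divisor_power_sum r n) \<le> real n ^ Suc r"
      using divisor_power_sum_le[of n r] by (metis gr0I of_nat_mono of_nat_power)
    then show ?thesis using False by (simp add: divisor_fps_def power_nat_fps_def norm_mult norm_power del: power_Suc)
  qed (simp add: divisor_fps_def)
  then show ?thesis using conv_radius_power_nat_fps by (rule fps_conv_radius_ge_1_mono)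
qed

lemma nome_power: "nome (of_nat m * \<tau>) = nome \<tau> ^ m"
  unfolding nome_def by (simp flip: exp_of_nat_mult add: mult_ac)

text \<open>Since \<open>(m + 1) (d + 1) \<ge> m + (d + 1)\<close>, the double series is dominated
  by the product of a geometric series in \<open>m\<close> and a convergent series in
  \<open>d\<close>.\<close>

lemma abs_summable_lambert:
  fixes x :: complex
  assumes x: "norm x < 1"
  shows "(\<lambda>p. norm ((\<lambda>(m, d). of_nat (Suc d) ^ r * x ^ (Suc m * Suc d)) p)) summable_on UNIV"
proof -
  have 1: "summable (\<lambda>d. norm (of_nat d ^ r * x ^ d))"
  proof -
    have "ereal (norm x) < fps_conv_radius (power_nat_fps r)"
      using x conv_radius_power_nat_fps[of r] by (metis ereal_less(3) less_le_trans)
    then show ?thesis unfolding fps_conv_radius_def power_nat_fps_def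
      using abs_summable_in_conv_radius[of x] by fastforce
  qed
  define y where "y = norm x"
  have y: "0 \<le> y" "y < 1" using x by (auto simp: y_def)
  have "summable (\<lambda>d. norm (of_nat (Suc d) ^ r * x ^ Suc d))"
    using 1 by (subst summable_Suc_iff)
  then have A: "(\<lambda>d. real (Suc d) ^ r * y ^ Suc d) summable_on UNIV"
    by (intro norm_summable_imp_summable_on) (simp add: norm_mult norm_power y_def del: of_nat_Suc power_Suc)
  have B: "(\<lambda>m. y ^ m) summable_on UNIV"
    by (rule norm_summable_imp_summable_on) (use y in \<open>simp add: summable_geometric norm_power\<close>)
  have "(\<lambda>(m, d). y ^ m * (real (Suc d) ^ r * y ^ Suc d)) summable_on UNIV \<times> UNIV"
    using A B y
    by (intro summable_on_SigmaI[where g = "\<lambda>m. y ^ m * infsum (\<lambda>d. real (Suc d) ^ r * y ^ Suc d) UNIV"])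
       (auto intro!: has_sum_cmult_right summable_on_cmult_left simp del: power_Suc)
  then have "(\<lambda>(m, d). y ^ m * (real (Suc d) ^ r * y ^ Suc d)) summable_on UNIV" by simp
  then show ?thesis
  proof (rule summable_on_comparison_test)
    fix p :: "nat \<times> nat"
    obtain m d where p: "p = (m, d)" by (cases p)
    have "y ^ (Suc m * Suc d) \<le> y ^ (m + Suc d)"
      using y by (intro power_decreasing) auto
    then have "real (Suc d) ^ r * y ^ (Suc m * Suc d) \<le> real (Suc d) ^ r * y ^ (m + Suc d)"
      by (intro mult_left_mono) auto
    then show "norm (case p of (m, d) \<Rightarrow> of_nat (Suc d) ^ r * x ^ (Suc m * Suc d))
       \<le> (case p of (m, d) \<Rightarrow> y ^ m * (real (Suc d) ^ r * y ^ Suc d))"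
      unfolding p by (simp add: norm_mult norm_power y_def power_add mult_ac del: of_nat_Suc)
  qed auto
qed

lemma summable_on_sums_has_sum:
  fixes f :: "nat \<Rightarrow> 'a :: {t2_space, topological_comm_monoid_add}"
  assumes "f summable_on UNIV" "f sums s"
  shows "(f has_sum s) UNIV"
proof -
  have "(f has_sum infsum f UNIV) UNIV" using assms(1) by simp
  moreover have "infsum f UNIV = s"
    using has_sum_imp_sums[OF calculation] assms(2) by (rule sums_unique2)
  ultimately show ?thesis by simp
qed

text \<open>The sum of \<open>d ^ r * x ^ (m * d)\<close> over positive \<open>m\<close>,
  \<open>d\<close> is taken once with \<open>m\<close> fixed and once with the product
  \<open>n = m * d\<close> fixed. The condition \<open>r > 0\<close> removes the constant
  coefficient of \<open>power_nat_fps r\<close>, so that its series starts at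
  \<open>d = 1\<close>.\<close>

lemma lambert_series:
  assumes x: "norm x < 1" and r: "r > 0"
  shows "((\<lambda>m. eval_fps (power_nat_fps r) (x ^ Suc m)) has_sum eval_fps (divisor_fps r) x) UNIV"
proof -
  let ?F = "\<lambda>(m, d). of_nat (Suc d) ^ r * x ^ (Suc m * Suc d)"
  have S: "?F summable_on UNIV \<times> UNIV" 
    unfolding UNIV_Times_UNIV by (rule abs_summable_summable[OF abs_summable_lambert[OF x]])
  then obtain L where L: "(?F has_sum L) (UNIV \<times> UNIV)" by (auto simp: summable_on_def)
  have row: "((\<lambda>d. ?F (m, d)) has_sum eval_fps (power_nat_fps r) (x ^ Suc m)) UNIV" for m
  proof -
    have s: "(\<lambda>d. ?F (m, d)) summable_on UNIV"
      unfolding prod.case by (rule summable_on_SigmaD1[OF S UNIV_I])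
    have "(\<lambda>d. ?F (m, d)) sums eval_fps (power_nat_fps r) (x ^ Suc m)"
    proof -
      have "norm (x ^ Suc m) < 1" unfolding norm_power using x by (simp add: power_less_one_iff del: power_Suc)
      then have "ereal (norm (x ^ Suc m)) < fps_conv_radius (power_nat_fps r)"
        using conv_radius_power_nat_fps[of r] by (metis ereal_less(3) less_le_trans)
      then have "(\<lambda>d. fps_nth (power_nat_fps r) d * (x ^ Suc m) ^ d) sums eval_fps (power_nat_fps r) (x ^ Suc m)"
        by (rule sums_eval_fps)
      moreover have "fps_nth (power_nat_fps r) 0 = 0" using r by (simp add: power_nat_fps_def)
      ultimately have "(\<lambda>d. fps_nth (power_nat_fps r) (Suc d) * (x ^ Suc m) ^ Suc d) sums eval_fps (power_nat_fps r) (x ^ Suc m)"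
        by (subst sums_Suc_iff [where f = "\<lambda>d. fps_nth (power_nat_fps r) d * (x ^ Suc m) ^ d"]) simp
      then show ?thesis by (simp only: prod.case power_mult power_nat_fps_def fps_nth_Abs_fps)
    qed
    then show ?thesis by (rule summable_on_sums_has_sum[OF s])
  qed
  have A: "((\<lambda>m. eval_fps (power_nat_fps r) (x ^ Suc m)) has_sum L) UNIV"
    by (rule has_sum_SigmaD[OF L]) (rule row)
  have "bij_betw (\<lambda>(m, d). (Suc m * Suc d, Suc d)) (UNIV \<times> UNIV) (SIGMA n:{0<..}. {d. d dvd n})"
  proof (rule bij_betwI[where g = "\<lambda>(n, d). (n div d - 1, d - 1)"])
    have "(n div d - 1, d - 1) \<in> UNIV \<and> (Suc (n div d - 1) * Suc (d - 1), Suc (d - 1)) = (n, d)"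
      if nd: "n > 0" "d dvd n" for n d :: nat
    proof -
      have "d > 0" "n div d > 0"
        using nd by (auto intro: Nat.gr0I simp: div_greater_zero_iff dvd_imp_le)
      then show ?thesis using nd by simp
    qed
    then show "(case (case p of (n, d) \<Rightarrow> (n div d - 1, d - 1)) of (m, d) \<Rightarrow> (Suc m * Suc d, Suc d)) = p"
      if "p \<in> (SIGMA n:{0<..}. {d. d dvd n})" for p using that by auto
  qed (auto simp del: mult_Suc mult_Suc_right)
  from has_sum_reindex_bij_betw[OF this, of "\<lambda>(n, d). of_nat d ^ r * x ^ n" L] L
  have "((\<lambda>(n, d). of_nat d ^ r * x ^ n) has_sum L) (SIGMA n:{0<..}. {d. d dvd n})"
    by (simp only: case_prod_unfold fst_conv snd_conv)
  then have "((\<lambda>n. of_nat (divisor_power_sum r n) * x ^ n) has_sum L) {0<..}"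
  proof (rule has_sum_SigmaD)
    fix n :: nat assume "n \<in> {0<..}"
    then show "((\<lambda>d. case (n, d) of (n, d) \<Rightarrow> of_nat d ^ r * x ^ n) has_sum
        of_nat (divisor_power_sum r n) * x ^ n) {d. d dvd n}"
      by (intro has_sum_finiteI) (simp_all add: divisor_power_sum_def sum_distrib_right)
  qed
  also have "?this \<longleftrightarrow> ((\<lambda>n. fps_nth (divisor_fps r) n * x ^ n) has_sum L) UNIV"
    by (rule has_sum_cong_neutral) (auto simp: divisor_fps_def)
  finally have "((\<lambda>n. fps_nth (divisor_fps r) n * x ^ n) has_sum L) UNIV" .
  then have "L = eval_fps (divisor_fps r) x"
    unfolding eval_fps_def by (intro sums_unique has_sum_imp_sums)
  with A show ?thesis by simp
qed

lemma has_sum_nat_Suc: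
  fixes f :: "nat \<Rightarrow> 'a :: {topological_comm_monoid_add}"
  assumes "((\<lambda>n. f (Suc n)) has_sum s) UNIV"
  shows "(f has_sum (f 0 + s)) UNIV"
proof -
  have "(f has_sum s) (range Suc)" using assms by (subst has_sum_reindex) (auto simp: o_def)
  then have "(f has_sum (f 0 + s)) (insert 0 (range Suc))" by (intro has_sum_insert) auto
  then show ?thesis by (simp flip: UNIV_nat_eq)
qed

lemma filterlim_symmetric_int_intervals:
  "filterlim (\<lambda>N. {- int N..int N}) (finite_subsets_at_top UNIV) sequentially"
  unfolding filterlim_finite_subsets_at_top
proof (intro allI impI)
  fix X :: "int set" assume X: "finite X \<and> X \<subseteq> UNIV"
  define B where "B = Max (insert 0 (abs ` X))"
  have B: "\<bar>x\<bar> \<le> B" if "x \<in> X" for x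
    unfolding B_def using X that by (intro Max_ge) auto
  show "\<forall>\<^sub>F N in sequentially. finite {- int N..int N} \<and> X \<subseteq> {- int N..int N} \<and> {- int N..int N} \<subseteq> UNIV"
    using eventually_ge_at_top[of "nat B"]
  proof eventually_elim
    case (elim N)
    have "x \<in> {- int N..int N}" if "x \<in> X" for x using B[OF that] elim by auto
    then show ?case by auto
  qed
qed

lemma has_sum_imp_symmetric_limit:
  assumes "(f has_sum s) (UNIV :: int set)"
  shows "(\<lambda>N. sum f {- int N..int N}) \<longlonglongrightarrow> s"
  using filterlim_compose[OF assms[unfolded has_sum_def] filterlim_symmetric_int_intervals] .

lemma sum_telescope_symmetric:
  fixes g :: "int \<Rightarrow> 'a :: ab_group_add"
  shows "(\<Sum>n\<in>{- int N..int N}. g n - g (n + 1)) = g (- int N) - g (int N + 1)"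
proof (induction N)
  case (Suc N)
  have e: "{- int (Suc N)..int (Suc N)} = insert (- int (Suc N)) (insert (int (Suc N)) {- int N..int N})"
    by auto
  show ?case unfolding e by (subst sum.insert, simp, simp)+ (simp add: Suc algebra_simps)
qed simp

definition lipschitz_const :: "nat \<Rightarrow> complex" where
  "lipschitz_const k = (- (2 * of_real pi * \<i>)) ^ k / fact (k - 1)"

text \<open>For even \<open>k \<ge> 2\<close> these are the row sums over \<open>n\<close>. Row 0 is
  \<open>2 * zeta k\<close>, deliberately left unevaluated; the other rows depend only on the
  absolute value of \<open>m\<close> because \<open>k\<close> is even.\<close>

definition lattice_row :: "nat \<Rightarrow> complex \<Rightarrow> int \<Rightarrow> complex" where
  "lattice_row k \<tau> m = (if m = 0 then (\<Sum>\<^sub>\<infinity>n::int. inverse (of_int n ^ k))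
     else lipschitz_const k * eval_fps (power_nat_fps (k - 1)) (nome \<tau> ^ nat \<bar>m\<bar>))"

lemma upper_half_plane_mult_nat: "\<tau> \<in> upper_half_plane \<Longrightarrow> m > 0 \<Longrightarrow> of_nat m * \<tau> \<in> upper_half_plane"
  by (simp add: upper_half_plane_def)

lemma has_sum_lattice_row:
  assumes "\<tau> \<in> upper_half_plane" "k \<ge> 2" "even k"
  shows "((\<lambda>n::int. inverse ((of_int m * \<tau> + of_int n) ^ k)) has_sum lattice_row k \<tau> m) UNIV"
proof -
  have pos: "((\<lambda>n::int. inverse ((of_nat m * \<tau> + of_int n) ^ k)) has_sum
      lipschitz_const k * eval_fps (power_nat_fps (k - 1)) (nome \<tau> ^ m)) UNIV" if "m > 0" for m :: nat
    using Lipschitz_formula[OF upper_half_plane_mult_nat[OF assms(1) that] assms(2)]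
    by (simp add: lipschitz_const_def nome_power)
  consider "m = 0" | "m > 0" | "m < 0" by linarith
  then show ?thesis
  proof cases
    case 1
    then show ?thesis using summable_lattice_row[OF assms(1,2), of 0] by (simp add: lattice_row_def)
  next
    case 2
    then show ?thesis using pos[of "nat m"] by (simp add: lattice_row_def)
  next
    case 3
    have "((\<lambda>n::int. inverse ((of_int m * \<tau> + of_int n) ^ k)) has_sum lattice_row k \<tau> m) UNIV \<longleftrightarrow>
       ((\<lambda>n::int. inverse ((of_nat (nat (- m)) * \<tau> + of_int n) ^ k)) has_sum lattice_row k \<tau> m) UNIV"
    proof (rule has_sum_reindex_bij_witness[of _ uminus uminus])
      fix n :: int
      have "of_nat (nat (- m)) * \<tau> + of_int (- n) = - (of_int m * \<tau> + of_int n)" using 3 by simp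
      then show "inverse ((of_nat (nat (- m)) * \<tau> + of_int (- n)) ^ k) = inverse ((of_int m * \<tau> + of_int n) ^ k)"
        using assms(3) by (simp only: power_minus_even)
    qed auto
    then show ?thesis using pos[of "nat (- m)"] 3 by (simp add: lattice_row_def)
  qed
qed

lemma has_sum_lattice_rows:
  assumes "\<tau> \<in> upper_half_plane" "k \<ge> 2"
  shows "(lattice_row k \<tau> has_sum
     ((\<Sum>\<^sub>\<infinity>n::int. inverse (of_int n ^ k)) + 2 * lipschitz_const k * eval_fps (divisor_fps (k - 1)) (nome \<tau>))) UNIV"
proof -
  let ?S = "lipschitz_const k * eval_fps (divisor_fps (k - 1)) (nome \<tau>)"
  have l: "((\<lambda>n. lipschitz_const k * eval_fps (power_nat_fps (k - 1)) (nome \<tau> ^ Suc n)) has_sum ?S) UNIV"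
    using assms by (intro has_sum_cmult_right lambert_series norm_nome_less_1) auto
  have "((\<lambda>n. lattice_row k \<tau> (int n)) has_sum (lattice_row k \<tau> (int 0) + ?S)) UNIV"
    using l by (intro has_sum_nat_Suc) (simp add: lattice_row_def nat_add_distrib)
  moreover have "((\<lambda>n. lattice_row k \<tau> (- int n - 1)) has_sum ?S) UNIV"
  proof -
    have "nat \<bar>- int n - 1\<bar> = Suc n" for n by simp
    then show ?thesis using l by (simp add: lattice_row_def del: power_Suc)
  qed
  ultimately have "(lattice_row k \<tau> has_sum (lattice_row k \<tau> (int 0) + ?S + ?S)) UNIV"
    by (rule has_sum_int)
  then show ?thesis by (simp add: lattice_row_def algebra_simps)
qed

lemma lattice_eisenstein_q_expansion:
  assumes "\<tau> \<in> upper_half_plane" "k \<ge> 4" "even k"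
  shows "lattice_eisenstein k \<tau> = (\<Sum>\<^sub>\<infinity>n::int. inverse (of_int n ^ k)) +
     2 * lipschitz_const k * eval_fps (divisor_fps (k - 1)) (nome \<tau>)"
proof -
  let ?f = "\<lambda>(m::int, n::int). inverse ((of_int m * \<tau> + of_int n) ^ k)"
  have "?f summable_on UNIV" using assms by (intro summable_lattice_power) auto
  then have "(?f has_sum lattice_eisenstein k \<tau>) (UNIV \<times> UNIV)"
    unfolding lattice_eisenstein_def UNIV_Times_UNIV by simp
  then have "(lattice_row k \<tau> has_sum lattice_eisenstein k \<tau>) UNIV"
    by (rule has_sum_SigmaD) (use assms in \<open>simp add: has_sum_lattice_row\<close>)
  then show ?thesis using has_sum_lattice_rows assms by (intro has_sum_unique) auto
qed

section \<open>Weight 2: Hecke's correction and the interchange of summations\<close>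

lemma has_sum_subtract:
  fixes f g :: "'a \<Rightarrow> 'b :: topological_ab_group_add"
  assumes "(f has_sum a) A" "(g has_sum b) A"
  shows "((\<lambda>x. f x - g x) has_sum (a - b)) A"
  using has_sum_add[OF assms(1), of "\<lambda>x. - g x" "- b"] assms(2) by (simp add: has_sum_uminus)

lemma summable_on_Times_row:
  fixes f :: "'a \<times> 'b \<Rightarrow> 'c :: {complete_uniform_space, uniform_topological_group_add, ab_group_add, topological_comm_monoid_add}"
  assumes "f summable_on UNIV"
  shows "(\<lambda>n. f (m, n)) summable_on UNIV"
  by (rule summable_on_SigmaD1[where f = "\<lambda>m n. f (m, n)" and A = UNIV and B = "\<lambda>_. UNIV"])
     (use assms in auto)

text \<open>Subtracting a telescoping difference, which does not change the sums over \<open>n\<close>, makes the double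
  series of weight \<open>2\<close> absolutely convergent.  Because of \<open>inverse 0 = 0\<close> the row \<open>m = 0\<close> needs no
  special treatment.\<close>

definition hecke_term :: "complex \<Rightarrow> int \<times> int \<Rightarrow> complex" where
  "hecke_term \<tau> = (\<lambda>(m, n). inverse ((of_int m * \<tau> + of_int n) ^ 2)
     - (inverse (of_int m * \<tau> + of_int n) - inverse (of_int m * \<tau> + of_int (n + 1))))"

lemma summable_hecke_term:
  assumes "\<tau> \<in> upper_half_plane"
  shows "hecke_term \<tau> summable_on UNIV"
proof -
  let ?g = "\<lambda>(m::int, n::int). inverse (norm (of_int m * \<tau> + of_int n) ^ 3)"
  have g: "?g summable_on UNIV" by (rule abs_summable_lattice_cube[OF assms])
  then have g': "(\<lambda>(m, n). ?g (m, n + 1)) summable_on UNIV"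
    by (subst summable_on_reindex_bij_witness[of _ "\<lambda>(m, n). (m, n - 1)" "\<lambda>(m, n). (m, n + 1)" UNIV ?g]) auto
  \<comment> \<open>Away from 0 and -1 the expression equals \<open>1 / (z^2 (z + 1))\<close>. The
    factor 2 is dictated by \<open>z = -1\<close>, where \<open>inverse 0 = 0\<close> makes the left
    side equal to 2.\<close>
  have key: "norm (inverse (z ^ 2) - (inverse z - inverse (z + 1))) \<le>
      2 * (inverse (norm z ^ 3) + inverse (norm (z + 1) ^ 3))" for z :: complex
  proof -
    consider "z = 0" | "z = -1" | "z \<noteq> 0" "z + 1 \<noteq> 0" by (metis add_eq_0_iff2)
    then show ?thesis
    proof cases
      case 3
      have "inverse (z ^ 2) - (inverse z - inverse (z + 1)) = inverse z ^ 2 * inverse (z + 1)"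
      proof -
        have d: "inverse z - inverse (z + 1) = inverse z * inverse (z + 1)"
          using division_ring_inverse_diff[OF 3] by simp
        have "inverse (z ^ 2) - (inverse z - inverse (z + 1)) = inverse z * inverse z - inverse z * inverse (z + 1)"
          unfolding d by (simp add: power2_eq_square)
        also have "\<dots> = inverse z * (inverse z - inverse (z + 1))" by (rule right_diff_distrib [symmetric])
        finally show ?thesis unfolding d by (simp add: power2_eq_square)
      qed
      then have "norm (inverse (z ^ 2) - (inverse z - inverse (z + 1))) =
          inverse (norm z) ^ 2 * inverse (norm (z + 1))"
        by (simp add: norm_mult norm_power norm_inverse)
      also have "\<dots> \<le> max (inverse (norm z)) (inverse (norm (z + 1))) ^ 3"
        unfolding power3_eq_cube power2_eq_square by (intro mult_mono) (auto simp: le_max_iff_disj)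
      also have "\<dots> \<le> 2 * (inverse (norm z) ^ 3 + inverse (norm (z + 1)) ^ 3)"
        by (simp add: max_def)
      finally show ?thesis by (simp add: power_inverse)
    qed auto
  qed
  have le: "norm (hecke_term \<tau> (m, n)) \<le> 2 * (?g (m, n) + ?g (m, n + 1))" for m n
    using key[of "of_int m * \<tau> + of_int n"] by (simp only: hecke_term_def prod.case of_int_add of_int_1 add.assoc)
  have "(\<lambda>p. norm (hecke_term \<tau> p)) summable_on UNIV"
    by (rule summable_on_comparison_test[OF summable_on_cmult_right[OF summable_on_add[OF g g'], of 2]])
       (use le in auto)
  then show ?thesis by (rule abs_summable_summable)
qed

text \<open>Both series are summable, so their difference may be summed over symmetric intervals;
  there it telescopes, and its boundary terms \<open>1 / (m \<tau> + n)\<close> tend to 0.\<close>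

lemma hecke_row:
  assumes "\<tau> \<in> upper_half_plane"
  shows "((\<lambda>n. hecke_term \<tau> (m, n)) has_sum lattice_row 2 \<tau> m) UNIV"
proof -
  let ?g = "\<lambda>n::int. inverse (of_int m * \<tau> + of_int n)"
  have 1: "((\<lambda>n::int. inverse ((of_int m * \<tau> + of_int n) ^ 2)) has_sum lattice_row 2 \<tau> m) UNIV"
    by (rule has_sum_lattice_row) (use assms in auto)
  obtain s where s: "((\<lambda>n. hecke_term \<tau> (m, n)) has_sum s) UNIV"
    using summable_on_Times_row[OF summable_hecke_term[OF assms]] by (auto simp: summable_on_def)
  have "((\<lambda>n. inverse ((of_int m * \<tau> + of_int n) ^ 2) - hecke_term \<tau> (m, n)) has_sum (lattice_row 2 \<tau> m - s)) UNIV"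
    using has_sum_subtract[OF 1 s] by simp
  then have "((\<lambda>n. ?g n - ?g (n + 1)) has_sum (lattice_row 2 \<tau> m - s)) UNIV"
    by (simp add: hecke_term_def)
  then have "(\<lambda>N. ?g (- int N) - ?g (int N + 1)) \<longlonglongrightarrow> lattice_row 2 \<tau> m - s"
    by (drule_tac has_sum_imp_symmetric_limit) (simp only: sum_telescope_symmetric[of ?g])
  moreover have "(\<lambda>N. ?g (- int N) - ?g (int N + 1)) \<longlonglongrightarrow> 0 - 0"
  proof (rule tendsto_diff)
    have "filterlim (\<lambda>N. of_int m * \<tau> + of_int (int N + 1)) at_infinity sequentially"
      using tendsto_add_filterlim_at_infinity[OF tendsto_const[of "of_int m * \<tau> + 1"] tendsto_of_nat]
      by (simp add: add_ac)
    then show "(\<lambda>N. ?g (int N + 1)) \<longlonglongrightarrow> 0" by (rule filterlim_compose[OF tendsto_inverse_0])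
    have "filterlim (\<lambda>N. - (of_int m * \<tau> + of_int (- int N))) at_infinity sequentially"
      using tendsto_add_filterlim_at_infinity[OF tendsto_const[of "- (of_int m * \<tau>)"] tendsto_of_nat]
      by (simp add: add_ac)
    then have "(\<lambda>N. - ?g (- int N)) \<longlonglongrightarrow> 0"
      unfolding inverse_minus_eq[symmetric] by (rule filterlim_compose[OF tendsto_inverse_0])
    then show "(\<lambda>N. ?g (- int N)) \<longlonglongrightarrow> 0" using tendsto_minus by fastforce
  qed
  ultimately have "lattice_row 2 \<tau> m - s = 0" using LIMSEQ_unique by fastforce
  then show ?thesis using s by simp
qed

text \<open>Dividing by \<open>\<tau>\<close> turns a column into the cotangent series at
  \<open>n / \<tau>\<close>. This point is never a nonzero integer, and for \<open>n = 0\<close>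
  both sides are 0 by the conventions at poles.\<close>

lemma column_partial_fractions:
  assumes "\<tau> \<in> upper_half_plane"
  shows "(\<lambda>N. \<Sum>m\<in>{- int N..int N}. inverse (of_int m * \<tau> + of_int n)) \<longlonglongrightarrow>
     of_real pi / \<tau> * cot (of_real pi * (of_int n / \<tau>))"
proof -
  have t: "\<tau> \<noteq> 0" using upper_half_plane_nonzero[OF assms] .
  have "of_int n / \<tau> \<notin> \<int> - {0}"
  proof
    assume a: "of_int n / \<tau> \<in> \<int> - {0}"
    then obtain j where j: "of_int n / \<tau> = of_int j" by (auto elim: Ints_cases)
    with a have "j \<noteq> 0" by auto
    have "of_int n = of_int j * \<tau>" using j t by (simp add: field_simps)
    then have "Im (of_int n) = Im (of_int j * \<tau>)" by (rule arg_cong)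
    then show False using assms \<open>j \<noteq> 0\<close> by (simp add: upper_half_plane_def)
  qed
  from tendsto_mult_left[OF cot_symmetric_partial_fractions[OF this], of "inverse \<tau>"]
  have "(\<lambda>N. \<Sum>m\<in>{- int N..int N}. inverse \<tau> * inverse (of_int n / \<tau> + of_int m)) \<longlonglongrightarrow>
     inverse \<tau> * (of_real pi * cot (of_real pi * (of_int n / \<tau>)))"
    by (simp add: sum_distrib_left)
  moreover have "inverse \<tau> * inverse (of_int n / \<tau> + of_int m) = inverse (of_int m * \<tau> + of_int n)" for m
    using t by (simp add: distrib_left add.commute mult.commute flip: inverse_mult_distrib)
  ultimately show ?thesis by (simp add: divide_inverse mult_ac)
qed

text \<open>The points \<open>N / \<tau>\<close> run to infinity in the lower half-plane, where the
  cotangent tends to \<open>\<i>\<close>. Working with \<open>- w\<close> replaces the growing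
  exponential by \<open>x ^ N\<close> with \<open>norm x < 1\<close>.\<close>

lemma cot_limit:
  assumes "\<tau> \<in> upper_half_plane"
  shows "(\<lambda>N. cot (of_real pi * (of_int (int N) / \<tau>))) \<longlonglongrightarrow> \<i>"
proof -
  define x where "x = nome (- 1 / \<tau>)"
  have x1: "norm x < 1" unfolding x_def by (intro norm_nome_less_1 upper_half_plane_S assms)
  have "(\<lambda>N. - (\<i> * ((x ^ N + 1) / (x ^ N - 1)))) \<longlonglongrightarrow> - (\<i> * ((0 + 1) / (0 - 1)))"
    by (intro tendsto_intros LIMSEQ_power_zero x1) auto
  then have lim: "(\<lambda>N. - (\<i> * ((x ^ N + 1) / (x ^ N - 1)))) \<longlonglongrightarrow> \<i>" by simp
  have eq: "- (\<i> * ((x ^ N + 1) / (x ^ N - 1))) = cot (of_real pi * (of_int (int N) / \<tau>))" if "N > 0" for N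
  proof -
    define w where "w = of_real pi * (of_int (int N) / \<tau>)"
    have "2 * (\<i> * (- w)) = 2 * of_real pi * \<i> * (of_nat N * (- 1 / \<tau>))"
      by (simp add: w_def mult_ac)
    moreover have "nome (of_nat N * (- 1 / \<tau>)) = x ^ N" by (simp only: x_def nome_power)
    ultimately have e: "exp (2 * (\<i> * (- w))) = x ^ N" by (simp only: nome_def)
    have "norm (x ^ N) < 1" unfolding norm_power using x1 that by (simp add: power_less_one_iff)
    then have "x ^ N \<noteq> 1" by auto
    then have "cot (- w) = \<i> * ((x ^ N + 1) / (x ^ N - 1))"
      using cot_conv_exp[of "- w"] unfolding e by simp
    then have "- (\<i> * ((x ^ N + 1) / (x ^ N - 1))) = cot w" by (metis cot_minus minus_minus)
    then show ?thesis unfolding w_def .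
  qed
  show ?thesis
    by (rule Lim_transform_eventually[OF lim]) (rule eventually_mono[OF eventually_gt_at_top[of 0]], rule eq)
qed

text \<open>The absolutely convergent Hecke series is summed in both orders. Rows give
  \<open>A\<close>; columns give \<open>B / \<tau> ^ 2\<close> minus the sum of
  \<open>g n - g (n + 1)\<close>. That sum telescopes, but now the boundary values do not vanish:
  \<open>g\<close> tends to \<open>pi \<i> / \<tau>\<close> and \<open>- pi \<i> / \<tau>\<close> at
  the two ends, which produces the anomaly.\<close>

lemma lattice_row_2_S:
  assumes t: "\<tau> \<in> upper_half_plane"
    and A: "(lattice_row 2 \<tau> has_sum A) UNIV" and B: "(lattice_row 2 (- 1 / \<tau>) has_sum B) UNIV"
  shows "A = B / \<tau> ^ 2 + 2 * of_real pi * \<i> / \<tau>"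
proof -
  define \<sigma> where "\<sigma> = - 1 / \<tau>"
  have \<sigma>: "\<sigma> \<in> upper_half_plane" and t0: "\<tau> \<noteq> 0"
    using upper_half_plane_S[OF t] upper_half_plane_nonzero[OF t] by (auto simp: \<sigma>_def)
  define g where "g = (\<lambda>n::int. of_real pi / \<tau> * cot (of_real pi * (of_int n / \<tau>)))"
  obtain L where L: "(hecke_term \<tau> has_sum L) (UNIV \<times> UNIV)"
    using summable_hecke_term[OF t] by (auto simp: summable_on_def)
  have "(lattice_row 2 \<tau> has_sum L) UNIV"
    by (rule has_sum_SigmaD[OF L]) (rule hecke_row[OF t])
  then have LA: "L = A" using A has_sum_unique by blast
  have L': "((\<lambda>(n, m). hecke_term \<tau> (m, n)) has_sum L) (UNIV \<times> UNIV)"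
    using L by (subst (asm) has_sum_swap)
  have col: "((\<lambda>m. hecke_term \<tau> (m, n)) has_sum (inverse (\<tau> ^ 2) * lattice_row 2 \<sigma> n - (g n - g (n + 1)))) UNIV" for n
  proof -
    have "((\<lambda>m::int. inverse ((of_int n * \<sigma> + of_int m) ^ 2)) has_sum lattice_row 2 \<sigma> n) UNIV"
      by (rule has_sum_lattice_row) (use \<sigma> in auto)
    also have "?this \<longleftrightarrow> ((\<lambda>m::int. inverse ((of_int n * \<sigma> + of_int (- m)) ^ 2)) has_sum lattice_row 2 \<sigma> n) UNIV"
      by (rule has_sum_reindex_bij_witness[of _ uminus uminus]) auto
    finally have "((\<lambda>m::int. inverse (\<tau> ^ 2) * inverse ((of_int n * \<sigma> + of_int (- m)) ^ 2)) has_sum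
       inverse (\<tau> ^ 2) * lattice_row 2 \<sigma> n) UNIV" by (rule has_sum_cmult_right)
    moreover have "inverse (\<tau> ^ 2) * inverse ((of_int n * \<sigma> + of_int (- m)) ^ 2) =
        inverse ((of_int m * \<tau> + of_int n) ^ 2)" for m
    proof -
      have "\<tau> * (of_int n * \<sigma> + of_int (- m)) = - (of_int m * \<tau> + of_int n)"
        using t0 by (simp add: \<sigma>_def field_simps)
      then have "(\<tau> * (of_int n * \<sigma> + of_int (- m))) ^ 2 = (of_int m * \<tau> + of_int n) ^ 2"
        by (simp only: power2_minus)
      then show ?thesis by (simp only: power_mult_distrib inverse_mult_distrib [symmetric])
    qed
    ultimately have C: "((\<lambda>m::int. inverse ((of_int m * \<tau> + of_int n) ^ 2)) has_sum
        inverse (\<tau> ^ 2) * lattice_row 2 \<sigma> n) UNIV" by simp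
    \<comment> \<open>The column sum \<open>s\<close> exists by absolute convergence. Its linear
      parts have known sums only as symmetric limits, which is enough to identify
      \<open>s\<close>.\<close>
    have "(\<lambda>(n, m). hecke_term \<tau> (m, n)) summable_on UNIV"
      using L' by (auto simp: summable_on_def)
    from summable_on_Times_row[OF this, of n]
    obtain s where s: "((\<lambda>m. hecke_term \<tau> (m, n)) has_sum s) UNIV" by (auto simp: summable_on_def)
    have "((\<lambda>m. inverse ((of_int m * \<tau> + of_int n) ^ 2) - hecke_term \<tau> (m, n)) has_sum
       (inverse (\<tau> ^ 2) * lattice_row 2 \<sigma> n - s)) UNIV"
      using has_sum_subtract[OF C s] by simp
    then have "((\<lambda>m::int. inverse (of_int m * \<tau> + of_int n) - inverse (of_int m * \<tau> + of_int (n + 1))) has_sum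
       (inverse (\<tau> ^ 2) * lattice_row 2 \<sigma> n - s)) UNIV"
      by (simp add: hecke_term_def)
    from has_sum_imp_symmetric_limit[OF this]
    have "(\<lambda>N. (\<Sum>m\<in>{- int N..int N}. inverse (of_int m * \<tau> + of_int n))
        - (\<Sum>m\<in>{- int N..int N}. inverse (of_int m * \<tau> + of_int (n + 1)))) \<longlonglongrightarrow> inverse (\<tau> ^ 2) * lattice_row 2 \<sigma> n - s"
      by (simp only: sum_subtractf)
    moreover have "(\<lambda>N. (\<Sum>m\<in>{- int N..int N}. inverse (of_int m * \<tau> + of_int n))
        - (\<Sum>m\<in>{- int N..int N}. inverse (of_int m * \<tau> + of_int (n + 1)))) \<longlonglongrightarrow> g n - g (n + 1)"
      unfolding g_def by (intro tendsto_diff column_partial_fractions t)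
    ultimately have "inverse (\<tau> ^ 2) * lattice_row 2 \<sigma> n - s = g n - g (n + 1)"
      by (rule LIMSEQ_unique)
    then have "s = inverse (\<tau> ^ 2) * lattice_row 2 \<sigma> n - (g n - g (n + 1))" by (simp add: algebra_simps)
    then show ?thesis using s by simp
  qed
  have "((\<lambda>n. inverse (\<tau> ^ 2) * lattice_row 2 \<sigma> n - (g n - g (n + 1))) has_sum L) UNIV"
    by (rule has_sum_SigmaD[OF L']) (simp only: prod.case col)
  moreover have "((\<lambda>n. inverse (\<tau> ^ 2) * lattice_row 2 \<sigma> n) has_sum inverse (\<tau> ^ 2) * B) UNIV"
    using B unfolding \<sigma>_def by (rule has_sum_cmult_right)
  ultimately have "((\<lambda>n. inverse (\<tau> ^ 2) * lattice_row 2 \<sigma> n - (inverse (\<tau> ^ 2) * lattice_row 2 \<sigma> n - (g n - g (n + 1))))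
      has_sum (inverse (\<tau> ^ 2) * B - L)) UNIV"
    by (intro has_sum_subtract)
  then have "((\<lambda>n. g n - g (n + 1)) has_sum (inverse (\<tau> ^ 2) * B - L)) UNIV" by simp
  from has_sum_imp_symmetric_limit[OF this]
  have "(\<lambda>N. g (- int N) - g (int N + 1)) \<longlonglongrightarrow> inverse (\<tau> ^ 2) * B - L"
    by (simp only: sum_telescope_symmetric)
  moreover have "(\<lambda>N. g (- int N) - g (int N + 1)) \<longlonglongrightarrow> - (of_real pi / \<tau> * \<i>) - of_real pi / \<tau> * \<i>"
  proof (rule tendsto_diff)
    have lim: "(\<lambda>N. g (int N)) \<longlonglongrightarrow> of_real pi / \<tau> * \<i>"
      unfolding g_def by (intro tendsto_mult tendsto_const cot_limit t)
    have "g (- int N) = - g (int N)" for N by (simp add: g_def)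
    then show "(\<lambda>N. g (- int N)) \<longlonglongrightarrow> - (of_real pi / \<tau> * \<i>)"
      using tendsto_minus[OF lim] by simp
    show "(\<lambda>N. g (int N + 1)) \<longlonglongrightarrow> of_real pi / \<tau> * \<i>"
      using LIMSEQ_Suc[OF lim] by (simp add: add.commute)
  qed
  ultimately have "inverse (\<tau> ^ 2) * B - L = - (of_real pi / \<tau> * \<i>) - of_real pi / \<tau> * \<i>"
    by (rule LIMSEQ_unique)
  then show ?thesis unfolding LA by (simp add: field_simps)
qed

section \<open>Modular functions vanishing at the cusp\<close>

lemma Im_neg_inverse: "Im (- 1 / \<tau>) = Im \<tau> / (norm \<tau>)\<^sup>2"
  by (simp add: Im_divide cmod_power2)

lemma upper_half_plane_add_int: "\<tau> \<in> upper_half_plane \<Longrightarrow> \<tau> + of_int n \<in> upper_half_plane"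
  by (simp add: upper_half_plane_def)

lemma periodic_add_int:
  assumes T: "\<And>\<tau>. \<tau> \<in> upper_half_plane \<Longrightarrow> h (\<tau> + 1) = h \<tau>" and t: "\<tau> \<in> upper_half_plane"
  shows "h (\<tau> + of_int n) = h \<tau>"
proof -
  have nat: "h (\<tau> + of_nat n) = h \<tau>" if "\<tau> \<in> upper_half_plane" for n \<tau>
  proof (induction n)
    case (Suc n)
    have "h (\<tau> + of_nat n + 1) = h (\<tau> + of_nat n)"
      using that upper_half_plane_add_int[of \<tau> "int n"] by (intro T) auto
    then show ?case using Suc by (simp add: add_ac)
  qed simp
  show ?thesis
  proof (cases "n \<ge> 0")
    case True
    then show ?thesis using nat[OF t, of "nat n"] by simp
  next
    case False
    have "h (\<tau> + of_int n + of_nat (nat (- n))) = h (\<tau> + of_int n)"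
      by (rule nat) (rule upper_half_plane_add_int[OF t])
    then show ?thesis using False by simp
  qed
qed

lemma int_translate_Re:
  obtains n :: int where "\<bar>Re (\<tau> + of_int n)\<bar> \<le> 1 / 2"
proof
  show "\<bar>Re (\<tau> + of_int (- round (Re \<tau>)))\<bar> \<le> 1 / 2"
    using of_int_round_abs_le[of "Re \<tau>"] by (simp add: abs_minus_commute)
qed

text \<open>Inverting a point of \<open>|Re \<tau>| \<le> 1/2\<close>, \<open>Im \<tau> < 1/2\<close> at least doubles its imaginary part.\<close>

lemma modular_invariant_reduce:
  fixes h :: "complex \<Rightarrow> 'a"
  assumes T: "\<And>\<tau>. \<tau> \<in> upper_half_plane \<Longrightarrow> h (\<tau> + 1) = h \<tau>"
    and S: "\<And>\<tau>. \<tau> \<in> upper_half_plane \<Longrightarrow> h (- 1 / \<tau>) = h \<tau>"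
    and t: "\<tau> \<in> upper_half_plane"
  obtains \<tau>' where "h \<tau>' = h \<tau>" "\<bar>Re \<tau>'\<bar> \<le> 1 / 2" "Im \<tau>' \<ge> 1 / 2"
proof -
  have "\<exists>\<tau>'. h \<tau>' = h \<tau> \<and> \<bar>Re \<tau>'\<bar> \<le> 1 / 2 \<and> Im \<tau>' \<ge> 1 / 2"
    if "\<tau> \<in> upper_half_plane" "Im \<tau> * 2 ^ N \<ge> 1 / 2" for N \<tau>
    using that
  proof (induction N arbitrary: \<tau>)
    case 0
    obtain n :: int where n: "\<bar>Re (\<tau> + of_int n)\<bar> \<le> 1 / 2" using int_translate_Re .
    show ?case using periodic_add_int[of h, OF T 0(1)] 0 n by (intro exI[of _ "\<tau> + of_int n"]) auto
  next
    case (Suc N)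
    obtain n :: int where n: "\<bar>Re (\<tau> + of_int n)\<bar> \<le> 1 / 2" using int_translate_Re .
    define w where "w = \<tau> + of_int n"
    have w: "w \<in> upper_half_plane" unfolding w_def by (rule upper_half_plane_add_int[OF Suc.prems(1)])
    have hw: "h w = h \<tau>" unfolding w_def by (rule periodic_add_int[of h, OF T Suc.prems(1)])
    have imw: "Im w = Im \<tau>" by (simp add: w_def)
    show ?case
    proof (cases "Im w \<ge> 1 / 2")
      case True
      then show ?thesis using hw n by (auto simp: w_def)
    next
      case False
      have pos: "Im w > 0" using w by (simp add: upper_half_plane_def)
      have "(norm w)\<^sup>2 = (Re w)\<^sup>2 + (Im w)\<^sup>2" by (rule cmod_power2)
      also have "\<dots> \<le> (1/2)\<^sup>2 + (1/2)\<^sup>2"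
        using False n pos by (intro add_mono power2_le_iff_abs_le[THEN iffD2]) (auto simp: w_def)
      finally have "(norm w)\<^sup>2 \<le> 1 / 2" by (simp add: power2_eq_square)
      moreover have "(norm w)\<^sup>2 > 0" using pos by auto
      ultimately have "Im w * 2 \<le> Im (- 1 / w)"
        unfolding Im_neg_inverse using pos by (simp add: field_simps mult_left_mono)
      then have "Im w * 2 * 2 ^ N \<le> Im (- 1 / w) * 2 ^ N" by (intro mult_right_mono) auto
      then have "Im (- 1 / w) * 2 ^ N \<ge> 1 / 2" using Suc.prems(2) imw by (simp add: mult_ac)
      from Suc.IH[OF upper_half_plane_S[OF w] this] show ?thesis using S[OF w] hw by metis
    qed
  qed
  moreover obtain N where "Im \<tau> * 2 ^ N \<ge> 1 / 2"
  proof -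
    have "Im \<tau> > 0" using t by (simp add: upper_half_plane_def)
    obtain N where "1 / (2 * Im \<tau>) < 2 ^ N" using real_arch_pow[of 2 "1 / (2 * Im \<tau>)"] by auto
    then show ?thesis using \<open>Im \<tau> > 0\<close> by (intro that[of N]) (simp add: field_simps)
  qed
  ultimately show ?thesis using t that by blast
qed

abbreviation at_cusp :: "complex filter" where
  "at_cusp \<equiv> filtercomap Im at_top"

lemma eventually_at_cusp: "eventually P at_cusp \<longleftrightarrow> (\<exists>Y. \<forall>\<tau>. Im \<tau> \<ge> Y \<longrightarrow> P \<tau>)"
proof -
  have "eventually P at_cusp \<longleftrightarrow> (\<exists>Q. (\<exists>Y. \<forall>y\<ge>Y. Q y) \<and> (\<forall>\<tau>. Q (Im \<tau>) \<longrightarrow> P \<tau>))"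
    unfolding eventually_filtercomap eventually_at_top_linorder ..
  also have "\<dots> \<longleftrightarrow> (\<exists>Y. \<forall>\<tau>. Im \<tau> \<ge> Y \<longrightarrow> P \<tau>)"
    by (metis (full_types))
  finally show ?thesis .
qed

lemma open_upper_half_plane: "open upper_half_plane"
  unfolding upper_half_plane_def by (rule open_halfspace_Im_gt)

lemma connected_upper_half_plane: "connected upper_half_plane"
  unfolding upper_half_plane_def by (intro convex_connected convex_halfspace_Im_gt)

lemma compact_truncated_strip: "compact {\<tau>. \<bar>Re \<tau>\<bar> \<le> 1 / 2 \<and> 1 / 2 \<le> Im \<tau> \<and> Im \<tau> \<le> Y}"
proof -
  have "{\<tau>. \<bar>Re \<tau>\<bar> \<le> 1 / 2 \<and> 1 / 2 \<le> Im \<tau> \<and> Im \<tau> \<le> Y} = cbox (Complex (-1/2) (1/2)) (Complex (1/2) Y)"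
    by (auto simp: in_cbox_complex_iff)
  then show ?thesis by simp
qed

text \<open>A modular function that vanishes at the cusp attains its maximum modulus.\<close>

theorem modular_function_vanishing_at_cusp:
  assumes hol: "h holomorphic_on upper_half_plane"
    and T: "\<And>\<tau>. \<tau> \<in> upper_half_plane \<Longrightarrow> h (\<tau> + 1) = h \<tau>"
    and S: "\<And>\<tau>. \<tau> \<in> upper_half_plane \<Longrightarrow> h (- 1 / \<tau>) = h \<tau>"
    and lim: "(h \<longlongrightarrow> 0) at_cusp"
    and t: "\<tau> \<in> upper_half_plane"
  shows "h \<tau> = 0"
proof (rule ccontr)
  assume nz: "h \<tau> \<noteq> 0"
  have "\<forall>\<^sub>F \<tau>' in at_cusp. norm (h \<tau>') < norm (h \<tau>)"
    using tendstoD[OF lim, of "norm (h \<tau>)"] nz by simp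
  then obtain Y where Y: "\<And>\<tau>'. Im \<tau>' \<ge> Y \<Longrightarrow> norm (h \<tau>') < norm (h \<tau>)"
    unfolding eventually_at_cusp by blast
  define C where "C = {\<tau>. \<bar>Re \<tau>\<bar> \<le> 1 / 2 \<and> 1 / 2 \<le> Im \<tau> \<and> Im \<tau> \<le> Y}"
  have CU: "C \<subseteq> upper_half_plane" by (auto simp: C_def upper_half_plane_def)
  \<comment> \<open>Reduction preserves \<open>h\<close>, and above height \<open>Y\<close> its
    modulus is too small; so every value of modulus at least \<open>norm (h \<tau>)\<close> recurs
    in the compact set \<open>C\<close>, and the maximum over \<open>C\<close> is a global
    one.\<close>
  have inC: "\<exists>w\<in>C. h w = h \<tau>'" if t': "\<tau>' \<in> upper_half_plane" and le: "norm (h \<tau>') \<ge> norm (h \<tau>)" for \<tau>'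
  proof -
    obtain w where w: "h w = h \<tau>'" "\<bar>Re w\<bar> \<le> 1 / 2" "Im w \<ge> 1 / 2"
      using modular_invariant_reduce[of h, OF T S t'] by blast
    have "Im w < Y" using Y[of w] w(1) le by force
    then show ?thesis using w by (auto simp: C_def)
  qed
  have "compact C" unfolding C_def by (rule compact_truncated_strip)
  moreover have "C \<noteq> {}" using inC[OF t] by auto
  moreover have "continuous_on C (\<lambda>z. norm (h z))"
    using holomorphic_on_imp_continuous_on[OF hol] CU by (intro continuous_intros) (rule continuous_on_subset)
  ultimately obtain \<xi> where xi: "\<xi> \<in> C" "\<And>z. z \<in> C \<Longrightarrow> norm (h z) \<le> norm (h \<xi>)"
    using continuous_attains_sup[of C "\<lambda>z. norm (h z)"] by blast
  have big: "norm (h \<xi>) \<ge> norm (h \<tau>)" using inC[OF t] xi(2) by force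
  have max: "norm (h z) \<le> norm (h \<xi>)" if "z \<in> upper_half_plane" for z
    using inC[OF that] xi(2) big by (cases "norm (h z) \<ge> norm (h \<tau>)") force+
  have "h constant_on upper_half_plane"
    by (rule maximum_modulus_principle[OF hol open_upper_half_plane connected_upper_half_plane
          open_upper_half_plane order_refl _ max]) (use xi CU in auto)
  then obtain c where c: "\<And>z. z \<in> upper_half_plane \<Longrightarrow> h z = c" by (auto simp: constant_on_def)
  have "Complex 0 (max Y 1) \<in> upper_half_plane" by (simp add: upper_half_plane_def)
  from c[OF this] c[OF t] Y[of "Complex 0 (max Y 1)"] show False by simp
qed

section \<open>Quasimodularity of \<open>E\<^sub>2\<close>\<close>

definition q_derivative :: "(complex \<Rightarrow> complex) \<Rightarrow> complex \<Rightarrow> complex" where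
  "q_derivative F q = q * deriv F q"

text \<open>Being a holomorphic function of \<open>q\<close> on the whole disc encodes both
  invariance under translation and holomorphy at the cusp, so only the transformation under
  inversion has to be required.\<close>

definition modular_q_function :: "nat \<Rightarrow> (complex \<Rightarrow> complex) \<Rightarrow> bool" where
  "modular_q_function k F \<longleftrightarrow> F holomorphic_on ball 0 1 \<and>
     (\<forall>\<tau>\<in>upper_half_plane. F (nome (- 1 / \<tau>)) = \<tau> ^ k * F (nome \<tau>))"

lemma nome_in_ball: "\<tau> \<in> upper_half_plane \<Longrightarrow> nome \<tau> \<in> ball 0 1"
  using norm_nome_less_1 by simp

lemma nome_surj:
  assumes "q \<in> ball 0 1" "q \<noteq> 0"
  obtains \<tau> where "\<tau> \<in> upper_half_plane" "nome \<tau> = q"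
proof
  have "Im (Ln q / (2 * of_real pi * \<i>)) = - Re (Ln q) / (2 * pi)"
    by (simp add: Im_divide power2_eq_square field_simps)
  also have "\<dots> > 0" using assms by (auto simp: divide_neg_pos ln_less_zero)
  finally show "Ln q / (2 * of_real pi * \<i>) \<in> upper_half_plane" by (simp add: upper_half_plane_def)
  show "nome (Ln q / (2 * of_real pi * \<i>)) = q" using assms(2) by (simp add: nome_def)
qed

lemma nome_add_1: "nome (\<tau> + 1) = nome \<tau>"
  by (simp add: nome_def distrib_left exp_add)

lemma filterlim_nome_at_cusp: "filterlim nome (at 0) at_cusp"
proof (rule filterlim_atI)
  show "(nome \<longlongrightarrow> 0) at_cusp"
  proof (rule tendsto_norm_zero_cancel)
    have "((\<lambda>y. exp (- (2 * pi * y))) \<longlongrightarrow> 0) at_top"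
      by (rule filterlim_compose[OF exp_at_bot]) (auto intro!: filterlim_tendsto_pos_mult_at_top filterlim_ident simp: filterlim_uminus_at_bot)
    then have "((\<lambda>\<tau>. exp (- (2 * pi * Im \<tau>))) \<longlongrightarrow> 0) at_cusp"
      by (rule filterlim_compose) (rule filterlim_filtercomap)
    then show "((\<lambda>\<tau>. norm (nome \<tau>)) \<longlongrightarrow> 0) at_cusp" by (simp add: nome_def)
  qed
qed simp

lemma has_field_derivative_nome:
  assumes "F holomorphic_on ball 0 1" "\<tau> \<in> upper_half_plane"
  shows "((\<lambda>\<tau>. F (nome \<tau>)) has_field_derivative 2 * of_real pi * \<i> * q_derivative F (nome \<tau>)) (at \<tau>)"
proof -
  have d: "(nome has_field_derivative 2 * of_real pi * \<i> * nome \<tau>) (at \<tau>)"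
    unfolding nome_def[abs_def] by (auto intro!: derivative_eq_intros)
  have "((\<lambda>\<tau>. F (nome \<tau>)) has_field_derivative deriv F (nome \<tau>) * (2 * of_real pi * \<i> * nome \<tau>)) (at \<tau>)"
    by (rule DERIV_chain2[OF holomorphic_derivI[OF assms(1) open_ball nome_in_ball[OF assms(2)]] d])
  then show ?thesis by (simp add: q_derivative_def mult_ac)
qed

lemma holomorphic_q_derivative: "F holomorphic_on ball 0 1 \<Longrightarrow> q_derivative F holomorphic_on ball 0 1"
  unfolding q_derivative_def[abs_def] by (intro holomorphic_intros) auto

lemma q_derivative_0 [simp]: "q_derivative F 0 = 0"
  by (simp add: q_derivative_def)

lemma DERIV_q_derivative_0:
  assumes "F holomorphic_on ball 0 1" "(F has_field_derivative c) (at 0)"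
  shows "(q_derivative F has_field_derivative c) (at 0)"
proof -
  have "deriv F holomorphic_on ball 0 1" using assms by (intro holomorphic_intros) auto
  then have "(deriv F has_field_derivative deriv (deriv F) 0) (at 0)"
    by (rule holomorphic_derivI) auto
  from DERIV_mult[OF DERIV_ident this] DERIV_imp_deriv[OF assms(2)]
  show ?thesis unfolding q_derivative_def[abs_def] by simp
qed

lemma modular_q_function_add:
  "modular_q_function k F \<Longrightarrow> modular_q_function k G \<Longrightarrow> modular_q_function k (\<lambda>q. F q + G q)"
  unfolding modular_q_function_def by (auto intro!: holomorphic_intros simp: distrib_left)

lemma modular_q_function_cmult:
  "modular_q_function k F \<Longrightarrow> modular_q_function k (\<lambda>q. c * F q)"
  unfolding modular_q_function_def by (auto intro!: holomorphic_intros)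

lemma modular_q_function_diff:
  "modular_q_function k F \<Longrightarrow> modular_q_function k G \<Longrightarrow> modular_q_function k (\<lambda>q. F q - G q)"
  unfolding modular_q_function_def by (auto intro!: holomorphic_intros simp: right_diff_distrib)

lemma modular_q_function_power:
  "modular_q_function k F \<Longrightarrow> modular_q_function (k * n) (\<lambda>q. F q ^ n)"
  unfolding modular_q_function_def by (auto intro!: holomorphic_intros simp: power_mult_distrib power_mult)

definition E2_q :: "complex \<Rightarrow> complex" where "E2_q q = 1 - 24 * eval_fps (divisor_fps 1) q"
definition E4_q :: "complex \<Rightarrow> complex" where "E4_q q = 1 + 240 * eval_fps (divisor_fps 3) q"
definition E6_q :: "complex \<Rightarrow> complex" where "E6_q q = 1 - 504 * eval_fps (divisor_fps 5) q"

lemma divisor_sum_eval_fps: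
  assumes "\<tau> \<in> upper_half_plane"
  shows "(\<Sum>n. of_nat (divisor_power_sum r (Suc n)) * nome \<tau> ^ Suc n) = eval_fps (divisor_fps r) (nome \<tau>)"
proof -
  have "ereal (norm (nome \<tau>)) < 1" using norm_nome_less_1[OF assms] by simp
  then have "ereal (norm (nome \<tau>)) < fps_conv_radius (divisor_fps r)"
    using conv_radius_divisor_fps less_le_trans by blast
  from sums_eval_fps[OF this]
  have "(\<lambda>n. fps_nth (divisor_fps r) n * nome \<tau> ^ n) sums eval_fps (divisor_fps r) (nome \<tau>)" .
  then have "(\<lambda>n. fps_nth (divisor_fps r) (Suc n) * nome \<tau> ^ Suc n) sums eval_fps (divisor_fps r) (nome \<tau>)"
    by (subst sums_Suc_iff [where f = "\<lambda>n. fps_nth (divisor_fps r) n * nome \<tau> ^ n"]) (simp add: divisor_fps_def)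
  then show ?thesis by (simp add: divisor_fps_def sums_iff)
qed

lemma eisenstein_E2_nome: "\<tau> \<in> upper_half_plane \<Longrightarrow> eisenstein_E2 \<tau> = E2_q (nome \<tau>)"
  unfolding eisenstein_E2_def E2_q_def by (simp only: divisor_sum_eval_fps)

lemma eisenstein_E4_nome: "\<tau> \<in> upper_half_plane \<Longrightarrow> eisenstein_E 4 \<tau> = E4_q (nome \<tau>)"
  unfolding eisenstein_E_def E4_q_def by (simp only: divisor_sum_eval_fps bernoulli_number_4) simp

lemma eisenstein_E6_nome: "\<tau> \<in> upper_half_plane \<Longrightarrow> eisenstein_E 6 \<tau> = E6_q (nome \<tau>)"
  unfolding eisenstein_E_def E6_q_def by (simp only: divisor_sum_eval_fps bernoulli_number_6) simp

lemma holomorphic_eval_fps_ball: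
  fixes F :: "complex fps"
  assumes "fps_conv_radius F \<ge> 1"
  shows "eval_fps F holomorphic_on ball 0 1"
proof (rule holomorphic_on_eval_fps)
  show "ball (0 :: complex) 1 \<subseteq> eball 0 (fps_conv_radius F)"
  proof
    fix x :: complex assume "x \<in> ball 0 1"
    then have "ereal (norm x) < 1" by simp
    then show "x \<in> eball 0 (fps_conv_radius F)" using less_le_trans[OF _ assms] by simp
  qed
qed

lemma DERIV_divisor_fps_0: "(eval_fps (divisor_fps r) has_field_derivative 1) (at 0)"
proof -
  have "fps_conv_radius (divisor_fps r) > 0"
    using conv_radius_divisor_fps[of r] by (rule less_le_trans[rotated]) simp
  then have "(eval_fps (divisor_fps r) has_field_derivative eval_fps (fps_deriv (divisor_fps r)) 0) (at 0)"
    by (intro has_field_derivative_eval_fps) (simp add: zero_ereal_def)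
  moreover have "{d::nat. d dvd Suc 0} = {1}" by auto
  ultimately show ?thesis by (simp add: eval_fps_at_0 divisor_fps_def divisor_power_sum_def)
qed

lemma divisor_fps_at_0 [simp]: "eval_fps (divisor_fps r) 0 = 0"
  by (simp add: eval_fps_at_0 divisor_fps_def)

lemma E_q_0 [simp]: "E2_q 0 = 1" "E4_q 0 = 1" "E6_q 0 = 1"
  by (simp_all add: E2_q_def E4_q_def E6_q_def)

lemma DERIV_E2_q_0: "(E2_q has_field_derivative -24) (at 0)"
  and DERIV_E4_q_0: "(E4_q has_field_derivative 240) (at 0)"
  and DERIV_E6_q_0: "(E6_q has_field_derivative -504) (at 0)"
  unfolding E2_q_def[abs_def] E4_q_def[abs_def] E6_q_def[abs_def]
  by (rule derivative_eq_intros DERIV_divisor_fps_0 refl | simp)+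

lemma holomorphic_E2_q: "E2_q holomorphic_on ball 0 1"
  and holomorphic_E4_q: "E4_q holomorphic_on ball 0 1"
  and holomorphic_E6_q: "E6_q holomorphic_on ball 0 1"
  unfolding E2_q_def[abs_def] E4_q_def[abs_def] E6_q_def[abs_def]
  by (intro holomorphic_intros holomorphic_eval_fps_ball conv_radius_divisor_fps)+

lemma infsum_inverse_square_int: "(\<Sum>\<^sub>\<infinity>n::int. inverse (of_int n ^ 2) :: complex) = of_real (pi ^ 2 / 3)"
proof -
  have "(\<lambda>n. 1 / (real n + 1)\<^sup>2) sums (pi\<^sup>2 / 6)"
    using inverse_squares_sums by (simp only: of_nat_add of_nat_1 of_nat_power)
  then have "((\<lambda>n. 1 / (real n + 1)\<^sup>2) has_sum pi\<^sup>2 / 6) UNIV"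
    by (rule sums_nonneg_imp_has_sum) simp
  then have "((\<lambda>n. complex_of_real (1 / (real n + 1)\<^sup>2)) has_sum of_real (pi\<^sup>2 / 6)) UNIV"
    by (rule has_sum_of_real)
  then have 1: "((\<lambda>n. inverse (of_nat (Suc n) ^ 2) :: complex) has_sum of_real (pi\<^sup>2 / 6)) UNIV"
    by (simp add: inverse_eq_divide add_ac)
  have "((\<lambda>n. inverse (of_int (int n) ^ 2) :: complex) has_sum (inverse (of_int (int 0) ^ 2) + of_real (pi\<^sup>2 / 6))) UNIV"
    using 1 by (intro has_sum_nat_Suc) simp
  moreover have "((\<lambda>n. inverse (of_int (- int n - 1) ^ 2) :: complex) has_sum of_real (pi\<^sup>2 / 6)) UNIV"
  proof -
    have "(of_int (- int n - 1) :: complex) ^ 2 = of_nat (Suc n) ^ 2" for n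
      by (simp add: power2_eq_square algebra_simps)
    then show ?thesis using 1 by (simp only:)
  qed
  ultimately have "((\<lambda>n::int. inverse (of_int n ^ 2) :: complex) has_sum
      (inverse (of_int (int 0) ^ 2) + of_real (pi\<^sup>2 / 6) + of_real (pi\<^sup>2 / 6))) UNIV"
    by (rule has_sum_int)
  from infsumI[OF this] show ?thesis by simp
qed

theorem E2_q_S:
  assumes t: "\<tau> \<in> upper_half_plane"
  shows "E2_q (nome (- 1 / \<tau>)) = \<tau> ^ 2 * E2_q (nome \<tau>) + 6 * \<tau> / (of_real pi * \<i>)"
proof -
  have *: "(lattice_row 2 \<sigma> has_sum of_real (pi ^ 2 / 3) * E2_q (nome \<sigma>)) UNIV" if "\<sigma> \<in> upper_half_plane" for \<sigma>
  proof -
    \<comment> \<open>Twice this constant is \<open>- 8 pi^2 = - 24 * (pi^2 / 3)\<close>, which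
      accounts for the coefficient -24 of \<open>E2\<close>.\<close>
    have "lipschitz_const 2 = - 4 * of_real (pi ^ 2)"
      by (simp add: lipschitz_const_def power2_eq_square)
    then show ?thesis using has_sum_lattice_rows[OF that, of 2]
      by (simp add: infsum_inverse_square_int E2_q_def algebra_simps)
  qed
  define p where "p = complex_of_real pi"
  define X Y where "X = E2_q (nome \<tau>)" and "Y = E2_q (nome (- 1 / \<tau>))"
  have nz: "\<tau> \<noteq> 0" "p \<noteq> 0" using upper_half_plane_nonzero[OF t] by (auto simp: p_def)
  have "of_real (pi ^ 2 / 3) * E2_q (nome \<tau>) =
     of_real (pi ^ 2 / 3) * E2_q (nome (- 1 / \<tau>)) / \<tau> ^ 2 + 2 * of_real pi * \<i> / \<tau>"
    by (rule lattice_row_2_S[OF t * *]) (use t upper_half_plane_S in auto)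
  then have "p ^ 2 / 3 * X = p ^ 2 / 3 * Y / \<tau> ^ 2 + 2 * p * \<i> / \<tau>"
    by (simp add: p_def X_def Y_def)
  then have "3 * (p * (p * (\<tau> ^ 2 * X))) = 3 * (p * (p * Y + 6 * \<i> * \<tau>))"
    using nz by (simp add: field_simps power2_eq_square)
  then have "p * (p * (\<tau> ^ 2 * X)) = p * (p * Y + 6 * \<i> * \<tau>)" by simp
  then have "p * (\<tau> ^ 2 * X) = p * Y + 6 * \<i> * \<tau>" using nz by simp
  then have "\<i> * (p * Y) = \<i> * (p * (\<tau> ^ 2 * X)) + 6 * \<tau>" by (simp add: algebra_simps)
  then show ?thesis
    using nz unfolding p_def[symmetric] X_def[symmetric] Y_def[symmetric] by (simp add: field_simps)
qed

section \<open>The discriminant as an exponential\<close>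

text \<open>This is \<open>- log (\<Prod>(1 - q ^ n))\<close>: the sum of \<open>1 / d\<close> over
  the divisors of \<open>n\<close> is \<open>divisor_power_sum 1 n / n\<close>. Applying
  \<open>q d/dq\<close> gives the divisor series of \<open>E2\<close>, and no infinite product has
  to be handled.\<close>

definition log_eta_fps :: "complex fps" where
  "log_eta_fps = Abs_fps (\<lambda>n. if n = 0 then 0 else of_nat (divisor_power_sum 1 n) / of_nat n)"

lemma conv_radius_log_eta_fps: "fps_conv_radius log_eta_fps \<ge> 1"
proof (rule fps_conv_radius_ge_1_mono[OF _ conv_radius_divisor_fps])
  fix n :: nat
  show "norm (fps_nth log_eta_fps n) \<le> norm (fps_nth (divisor_fps 1) n)"
  proof (cases "n = 0")
    case False
    then have "real (divisor_power_sum 1 n) / real n \<le> real (divisor_power_sum 1 n) / 1"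
      by (intro divide_left_mono) auto
    then show ?thesis using False by (simp add: log_eta_fps_def divisor_fps_def norm_divide)
  qed (simp add: log_eta_fps_def)
qed

lemma XD_log_eta_fps: "fps_XD log_eta_fps = divisor_fps 1"
  by (rule fps_ext) (simp add: log_eta_fps_def divisor_fps_def)

text \<open>The function \<open>Delta_unit_q q = Delta_q q / q\<close> is the expansion of \<open>\<Prod>(1 - q\<^sup>n)\<^sup>2\<^sup>4\<close>.\<close>

definition Delta_unit_q :: "complex \<Rightarrow> complex" where
  "Delta_unit_q q = exp (- 24 * eval_fps log_eta_fps q)"

definition Delta_q :: "complex \<Rightarrow> complex" where
  "Delta_q q = q * Delta_unit_q q"

lemma holomorphic_Delta_unit_q: "Delta_unit_q holomorphic_on ball 0 1"
  unfolding Delta_unit_q_def[abs_def]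
  by (intro holomorphic_intros holomorphic_eval_fps_ball conv_radius_log_eta_fps)

lemma holomorphic_Delta_q: "Delta_q holomorphic_on ball 0 1"
  unfolding Delta_q_def[abs_def] by (intro holomorphic_intros holomorphic_Delta_unit_q)

lemma Delta_unit_q_nonzero [simp]: "Delta_unit_q q \<noteq> 0"
  by (simp add: Delta_unit_q_def)

lemma Delta_unit_q_0 [simp]: "Delta_unit_q 0 = 1"
  by (simp add: Delta_unit_q_def eval_fps_at_0 log_eta_fps_def)

lemma Delta_q_nome_nonzero [simp]: "Delta_q (nome \<tau>) \<noteq> 0"
  by (simp add: Delta_q_def)

lemma DERIV_Delta_q_nome:
  assumes "\<tau> \<in> upper_half_plane"
  shows "((\<lambda>\<tau>. Delta_q (nome \<tau>)) has_field_derivative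
     2 * of_real pi * \<i> * (E2_q (nome \<tau>) * Delta_q (nome \<tau>))) (at \<tau>)"
proof -
  have n: "(nome has_field_derivative 2 * of_real pi * \<i> * nome \<tau>) (at \<tau>)"
    unfolding nome_def[abs_def] by (auto intro!: derivative_eq_intros)
  have l: "((\<lambda>\<tau>. eval_fps log_eta_fps (nome \<tau>)) has_field_derivative
      2 * of_real pi * \<i> * eval_fps (divisor_fps 1) (nome \<tau>)) (at \<tau>)"
    using has_field_derivative_eval_fps_nome[OF conv_radius_log_eta_fps assms] unfolding XD_log_eta_fps .
  show ?thesis unfolding Delta_q_def Delta_unit_q_def E2_q_def
    by (rule derivative_eq_intros n l refl)+ (simp add: algebra_simps)
qed

lemma DERIV_compose_S:
  assumes "\<tau> \<in> upper_half_plane" "(f has_field_derivative d) (at (- 1 / \<tau>))"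
  shows "((\<lambda>\<tau>. f (- 1 / \<tau>)) has_field_derivative d / \<tau> ^ 2) (at \<tau>)"
proof -
  have "((\<lambda>\<tau>. - 1 / \<tau>) has_field_derivative 1 / \<tau> ^ 2) (at \<tau>)"
    using upper_half_plane_nonzero[OF assms(1)]
    by (auto intro!: derivative_eq_intros simp: power2_eq_square)
  from DERIV_chain2[OF assms(2) this] show ?thesis by simp
qed

text \<open>The quotient \<open>R\<close> of the two sides has derivative 0: the anomaly
  \<open>6 \<tau> / (pi \<i>)\<close> of \<open>E2\<close> contributes \<open>12 / \<tau>\<close> to
  the logarithmic derivative, exactly that of \<open>\<tau> ^ 12\<close>. The constant is read off
  at the fixed point \<open>\<i>\<close>, where \<open>\<i> ^ 12 = 1\<close>.\<close>

lemma Delta_q_S: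
  assumes "\<tau> \<in> upper_half_plane"
  shows "Delta_q (nome (- 1 / \<tau>)) = \<tau> ^ 12 * Delta_q (nome \<tau>)"
proof -
  define R where "R = (\<lambda>\<tau>. Delta_q (nome (- 1 / \<tau>)) / (\<tau> ^ 12 * Delta_q (nome \<tau>)))"
  have "(R has_field_derivative 0) (at \<tau> within upper_half_plane)" if t: "\<tau> \<in> upper_half_plane" for \<tau>
  proof -
    define A B X Y P where "A = Delta_q (nome (- 1 / \<tau>))" and "B = Delta_q (nome \<tau>)"
      and "X = E2_q (nome \<tau>)" and "Y = E2_q (nome (- 1 / \<tau>))" and "P = complex_of_real pi"
    have nz: "\<tau> \<noteq> 0" "B \<noteq> 0" "P \<noteq> 0" using upper_half_plane_nonzero[OF t] by (auto simp: B_def P_def)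
    have dA: "((\<lambda>\<tau>. Delta_q (nome (- 1 / \<tau>))) has_field_derivative 2 * P * \<i> * (Y * A) / \<tau> ^ 2) (at \<tau>)"
      unfolding A_def Y_def P_def by (rule DERIV_compose_S[OF t DERIV_Delta_q_nome[OF upper_half_plane_S[OF t]]])
    have dB: "((\<lambda>\<tau>. Delta_q (nome \<tau>)) has_field_derivative 2 * P * \<i> * (X * B)) (at \<tau>)"
      unfolding B_def X_def P_def by (rule DERIV_Delta_q_nome[OF t])
    have dC: "((\<lambda>\<tau>. \<tau> ^ 12 * Delta_q (nome \<tau>)) has_field_derivative
        12 * \<tau> ^ 11 * B + \<tau> ^ 12 * (2 * P * \<i> * (X * B))) (at \<tau>)"
      by (rule derivative_eq_intros dB refl)+ (simp add: B_def)
    have "(R has_field_derivative (2 * P * \<i> * (Y * A) / \<tau> ^ 2 * (\<tau> ^ 12 * B)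
        - A * (12 * \<tau> ^ 11 * B + \<tau> ^ 12 * (2 * P * \<i> * (X * B)))) / (\<tau> ^ 12 * B * (\<tau> ^ 12 * B))) (at \<tau>)"
      unfolding R_def A_def B_def
      by (rule DERIV_divide[OF dA[unfolded A_def] dC[unfolded B_def]]) (use nz in auto)
    moreover have "2 * P * \<i> * (Y * A) / \<tau> ^ 2 * (\<tau> ^ 12 * B)
        - A * (12 * \<tau> ^ 11 * B + \<tau> ^ 12 * (2 * P * \<i> * (X * B))) = 0"
    proof -
      have Y: "P * \<i> * Y = P * \<i> * \<tau> ^ 2 * X + 6 * \<tau>"
        using E2_q_S[OF t] nz unfolding X_def[symmetric] Y_def[symmetric] P_def[symmetric]
        by (simp add: field_simps)
      define u where "u = \<tau> ^ 10"
      have p: "\<tau> ^ 12 = u * \<tau> ^ 2" "\<tau> ^ 11 = u * \<tau>"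
        using power_add[of \<tau> 10 2] power_add[of \<tau> 10 1] by (simp_all add: u_def)
      have "2 * P * \<i> * (Y * A) / \<tau> ^ 2 * (\<tau> ^ 12 * B) = 2 * (P * \<i> * Y) * A * u * B"
        unfolding p using nz by simp
      then show ?thesis unfolding Y p by (simp add: algebra_simps)
    qed
    ultimately show ?thesis by (simp add: has_field_derivative_at_within)
  qed
  then obtain c where c: "\<And>\<tau>. \<tau> \<in> upper_half_plane \<Longrightarrow> R \<tau> = c"
    using has_field_derivative_zero_constant[of upper_half_plane R]
    by (auto simp: upper_half_plane_def convex_halfspace_Im_gt)
  have "\<i> \<in> upper_half_plane" by (simp add: upper_half_plane_def)
  then have "c = R \<i>" by (rule c [symmetric])
  also have "R \<i> = inverse (\<i> ^ 12)" by (simp add: R_def divide_i)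
  also have "\<i> ^ 12 = ((\<i> ^ 2) ^ 6 :: complex)" by (simp only: power_mult [symmetric]) simp
  finally have "c = 1" by simp
  with c[OF assms] have "R \<tau> = 1" by simp
  then show ?thesis using upper_half_plane_nonzero[OF assms] by (simp add: R_def)
qed

lemma tendsto_divide_q:
  fixes F :: "complex \<Rightarrow> complex"
  assumes "(F has_field_derivative c) (at 0)" "F 0 = 0"
  shows "((\<lambda>q. F q / q) \<longlongrightarrow> c) (at 0)"
  using assms by (simp add: has_field_derivative_iff)

text \<open>\<open>Delta_q\<close> has no zero over the upper half-plane and a simple zero with
  leading coefficient 1 at \<open>q = 0\<close>; hence \<open>F / Delta_q\<close> is holomorphic of
  weight 0 and tends to \<open>c\<close> at the cusp.\<close>

lemma modular_q_function_weight_12: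
  assumes F: "modular_q_function 12 F" "F 0 = 0" "(F has_field_derivative c) (at 0)"
    and t: "\<tau> \<in> upper_half_plane"
  shows "F (nome \<tau>) = c * Delta_q (nome \<tau>)"
proof -
  define h where "h = (\<lambda>\<tau>. F (nome \<tau>) / Delta_q (nome \<tau>) - c)"
  have "h \<tau> = 0"
  proof (rule modular_function_vanishing_at_cusp[OF _ _ _ _ t])
    have "nome holomorphic_on upper_half_plane" unfolding nome_def[abs_def] by (intro holomorphic_intros)
    then show "h holomorphic_on upper_half_plane"
      unfolding h_def
      by (intro holomorphic_intros holomorphic_on_compose_gen[OF _ _, unfolded o_def, of nome _ F "ball 0 1"]
           holomorphic_on_compose_gen[OF _ holomorphic_Delta_q, unfolded o_def, of nome])
         (use F nome_in_ball in \<open>auto simp: modular_q_function_def\<close>)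
    show "h (\<tau> + 1) = h \<tau>" for \<tau> by (simp add: h_def nome_add_1)
    show "h (- 1 / \<tau>) = h \<tau>" if "\<tau> \<in> upper_half_plane" for \<tau>
      using F(1) Delta_q_S[OF that] upper_half_plane_nonzero[OF that] that
      by (simp add: h_def modular_q_function_def)
    have "((\<lambda>q. (F q / q) / Delta_unit_q q - c) \<longlongrightarrow> c / Delta_unit_q 0 - c) (at 0)"
      using continuous_on_interior[OF holomorphic_on_imp_continuous_on[OF holomorphic_Delta_unit_q], of 0]
      by (intro tendsto_intros tendsto_divide_q F) (auto simp: isCont_def)
    then have "((\<lambda>\<tau>. (F (nome \<tau>) / nome \<tau>) / Delta_unit_q (nome \<tau>) - c) \<longlongrightarrow> 0) at_cusp"
      using filterlim_compose[OF _ filterlim_nome_at_cusp] by fastforce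
    then show "(h \<longlongrightarrow> 0) at_cusp" by (simp add: h_def Delta_q_def)
  qed
  then show ?thesis by (simp add: h_def field_simps)
qed

text \<open>\<open>F ^ 12 / Delta_q ^ k\<close> has weight 0. At \<open>q = 0\<close> its numerator
  has order at least 12 and its denominator order \<open>k\<close>, so a positive power
  \<open>q ^ (12 - k)\<close> makes it vanish at the cusp.\<close>

lemma modular_q_function_small_weight:
  assumes F: "modular_q_function k F" "F 0 = 0" and k: "k < 12" and q: "q \<in> ball 0 1"
  shows "F q = 0"
proof (cases "q = 0")
  case False
  then obtain \<tau> where t: "\<tau> \<in> upper_half_plane" "nome \<tau> = q" using nome_surj[OF q] by blast
  have hol: "F holomorphic_on ball 0 1" using F(1) by (simp add: modular_q_function_def)
  then have dF: "(F has_field_derivative deriv F 0) (at 0)" by (rule holomorphic_derivI) auto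
  define h where "h = (\<lambda>\<tau>. F (nome \<tau>) ^ 12 / Delta_q (nome \<tau>) ^ k)"
  have "h \<tau> = 0"
  proof (rule modular_function_vanishing_at_cusp[OF _ _ _ _ t(1)])
    have "nome holomorphic_on upper_half_plane" unfolding nome_def[abs_def] by (intro holomorphic_intros)
    then show "h holomorphic_on upper_half_plane"
      unfolding h_def
      by (intro holomorphic_intros holomorphic_on_compose_gen[OF _ hol, unfolded o_def, of nome]
           holomorphic_on_compose_gen[OF _ holomorphic_Delta_q, unfolded o_def, of nome])
         (use nome_in_ball in auto)
    show "h (\<tau> + 1) = h \<tau>" for \<tau> by (simp add: h_def nome_add_1)
    show "h (- 1 / \<tau>) = h \<tau>" if "\<tau> \<in> upper_half_plane" for \<tau>
    proof -
      have "h (- 1 / \<tau>) = (\<tau> ^ k * F (nome \<tau>)) ^ 12 / (\<tau> ^ 12 * Delta_q (nome \<tau>)) ^ k"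
        using F(1) Delta_q_S[OF that] that by (simp add: h_def modular_q_function_def)
      also have "\<dots> = (\<tau> ^ (12 * k) * F (nome \<tau>) ^ 12) / (\<tau> ^ (12 * k) * Delta_q (nome \<tau>) ^ k)"
        by (simp add: power_mult_distrib mult.commute flip: power_mult)
      also have "\<dots> = h \<tau>" using upper_half_plane_nonzero[OF that] by (simp add: h_def)
      finally show ?thesis .
    qed
    have "((\<lambda>q. q ^ (12 - k) * ((F q / q) ^ 12 / Delta_unit_q q ^ k)) \<longlongrightarrow> 0 ^ (12 - k) * ((deriv F 0) ^ 12 / Delta_unit_q 0 ^ k)) (at 0)"
      using continuous_on_interior[OF holomorphic_on_imp_continuous_on[OF holomorphic_Delta_unit_q], of 0]
      by (intro tendsto_intros tendsto_divide_q F dF) (auto simp: isCont_def)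
    then have "((\<lambda>q. q ^ (12 - k) * ((F q / q) ^ 12 / Delta_unit_q q ^ k)) \<longlongrightarrow> 0) (at 0)"
      using k by (simp add: zero_power)
    from filterlim_compose[OF this filterlim_nome_at_cusp]
    have lim: "((\<lambda>\<tau>. nome \<tau> ^ (12 - k) * ((F (nome \<tau>) / nome \<tau>) ^ 12 / Delta_unit_q (nome \<tau>) ^ k)) \<longlongrightarrow> 0) at_cusp" .
    have eq: "q ^ (12 - k) * ((x / q) ^ 12 / d ^ k) = x ^ 12 / (q * d) ^ k" if "q \<noteq> 0" for q x d :: complex
    proof -
      have "q ^ 12 = q ^ (12 - k) * q ^ k" using k by (simp flip: power_add)
      then show ?thesis using that by (simp add: power_divide power_mult_distrib)
    qed
    show "(h \<longlongrightarrow> 0) at_cusp" using lim by (simp only: h_def Delta_q_def eq[OF nome_nonzero])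
  qed
  then show ?thesis by (simp add: h_def flip: t(2))
qed (use F in simp)

section \<open>Ramanujan's identities\<close>

lemma q_derivative_S:
  assumes F: "F holomorphic_on ball 0 1" and t: "\<tau> \<in> upper_half_plane"
    and g: "\<And>\<tau>. \<tau> \<in> upper_half_plane \<Longrightarrow> F (nome (- 1 / \<tau>)) = g \<tau>"
    and dg: "(g has_field_derivative d) (at \<tau>)"
  shows "q_derivative F (nome (- 1 / \<tau>)) = \<tau> ^ 2 * d / (2 * of_real pi * \<i>)"
proof -
  have "((\<lambda>\<tau>. F (nome (- 1 / \<tau>))) has_field_derivative
      2 * of_real pi * \<i> * q_derivative F (nome (- 1 / \<tau>)) / \<tau> ^ 2) (at \<tau>)"
    by (rule DERIV_compose_S[OF t has_field_derivative_nome[OF F upper_half_plane_S[OF t]]])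
  then have "(g has_field_derivative
      2 * of_real pi * \<i> * q_derivative F (nome (- 1 / \<tau>)) / \<tau> ^ 2) (at \<tau>)"
    by (rule has_field_derivative_transform_within_open[OF _ open_upper_half_plane t g])
  from DERIV_unique[OF this dg] upper_half_plane_nonzero[OF t] show ?thesis
    by (simp add: field_simps)
qed

text \<open>Differentiating \<open>\<tau> ^ k\<close> produces the extra term
  \<open>k \<tau>^(k + 1) F / (2 pi \<i>)\<close>; the anomaly of \<open>E2\<close> multiplied by
  \<open>k / 12\<close> is the same term.\<close>

lemma modular_q_function_serre:
  assumes F: "modular_q_function k F"
  shows "modular_q_function (k + 2) (\<lambda>q. q_derivative F q - of_nat k / 12 * E2_q q * F q)"
  unfolding modular_q_function_def
proof (intro conjI ballI)
  have hol: "F holomorphic_on ball 0 1" using F by (simp add: modular_q_function_def)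
  then show "(\<lambda>q. q_derivative F q - of_nat k / 12 * E2_q q * F q) holomorphic_on ball 0 1"
    by (intro holomorphic_intros holomorphic_q_derivative holomorphic_E2_q)
  fix \<tau> assume t: "\<tau> \<in> upper_half_plane"
  define X Y P where "X = F (nome \<tau>)" and "Y = q_derivative F (nome \<tau>)" and "P = of_real pi * \<i>"
  have nz: "P \<noteq> 0" by (simp add: P_def)
  have S: "F (nome (- 1 / \<tau>)) = \<tau> ^ k * F (nome \<tau>)" if "\<tau> \<in> upper_half_plane" for \<tau>
    using F that by (simp add: modular_q_function_def)
  have "((\<lambda>\<tau>. \<tau> ^ k * F (nome \<tau>)) has_field_derivative of_nat k * \<tau> ^ (k - 1) * X + \<tau> ^ k * (2 * P * Y)) (at \<tau>)"
    unfolding X_def Y_def P_def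
    by (rule derivative_eq_intros has_field_derivative_nome[OF hol t] refl)+ (simp add: mult_ac)
  from q_derivative_S[OF hol t S this]
  have "q_derivative F (nome (- 1 / \<tau>)) = \<tau> ^ 2 * (of_nat k * \<tau> ^ (k - 1) * X + \<tau> ^ k * (2 * P * Y)) / (2 * P)"
    by (simp add: P_def mult_ac)
  also have "\<dots> = of_nat k * \<tau> ^ (k + 1) * X / (2 * P) + \<tau> ^ (k + 2) * Y"
    using nz by (cases k) (simp_all add: field_simps power2_eq_square)
  finally have eD: "q_derivative F (nome (- 1 / \<tau>)) = of_nat k * \<tau> ^ (k + 1) * X / (2 * P) + \<tau> ^ (k + 2) * Y" .
  have eE: "E2_q (nome (- 1 / \<tau>)) = \<tau> ^ 2 * E2_q (nome \<tau>) + 6 * \<tau> / P"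
    using E2_q_S[OF t] by (simp add: P_def)
  show "q_derivative F (nome (- 1 / \<tau>)) - of_nat k / 12 * E2_q (nome (- 1 / \<tau>)) * F (nome (- 1 / \<tau>)) =
      \<tau> ^ (k + 2) * (q_derivative F (nome \<tau>) - of_nat k / 12 * E2_q (nome \<tau>) * F (nome \<tau>))"
    unfolding S[OF t] eD eE X_def[symmetric] Y_def[symmetric] using nz
    by (simp add: field_simps power_add power2_eq_square)
qed

text \<open>Squaring the anomalous transformation of \<open>E2\<close> and differentiating it
  produce, with the factor 12, the same extra terms in \<open>\<tau> ^ 3\<close> and
  \<open>\<tau> ^ 2\<close>.\<close>

lemma modular_q_function_E2_ramanujan:
  "modular_q_function 4 (\<lambda>q. E2_q q ^ 2 - 12 * q_derivative E2_q q)"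
  unfolding modular_q_function_def
proof (intro conjI ballI)
  show "(\<lambda>q. E2_q q ^ 2 - 12 * q_derivative E2_q q) holomorphic_on ball 0 1"
    by (intro holomorphic_intros holomorphic_q_derivative holomorphic_E2_q)
  fix \<tau> assume t: "\<tau> \<in> upper_half_plane"
  define X Y P where "X = E2_q (nome \<tau>)" and "Y = q_derivative E2_q (nome \<tau>)" and "P = of_real pi * \<i>"
  have nz: "P \<noteq> 0" by (simp add: P_def)
  have S: "E2_q (nome (- 1 / \<tau>)) = \<tau> ^ 2 * E2_q (nome \<tau>) + 6 * \<tau> / P" if "\<tau> \<in> upper_half_plane" for \<tau>
    using E2_q_S[OF that] by (simp add: P_def)
  have "((\<lambda>\<tau>. \<tau> ^ 2 * E2_q (nome \<tau>) + 6 * \<tau> / P) has_field_derivative 2 * \<tau> * X + \<tau> ^ 2 * (2 * P * Y) + 6 / P) (at \<tau>)"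
    unfolding X_def Y_def using nz
    by (auto intro!: derivative_eq_intros has_field_derivative_nome[OF holomorphic_E2_q t] simp: P_def field_simps)
  from q_derivative_S[OF holomorphic_E2_q t S this]
  have D: "q_derivative E2_q (nome (- 1 / \<tau>)) = \<tau> ^ 2 * (2 * \<tau> * X + \<tau> ^ 2 * (2 * P * Y) + 6 / P) / (2 * P)"
    by (simp add: P_def mult_ac)
  show "E2_q (nome (- 1 / \<tau>)) ^ 2 - 12 * q_derivative E2_q (nome (- 1 / \<tau>)) =
     \<tau> ^ 4 * (E2_q (nome \<tau>) ^ 2 - 12 * q_derivative E2_q (nome \<tau>))"
    unfolding S[OF t] D X_def[symmetric] Y_def[symmetric] using nz
    by (simp add: field_simps power2_eq_square power4_eq_xxxx)
qed

lemma modular_q_function_lattice_eisenstein: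
  assumes "k \<ge> 4" "even k"
  shows "modular_q_function k (\<lambda>q. (\<Sum>\<^sub>\<infinity>n::int. inverse (of_int n ^ k)) +
     2 * lipschitz_const k * eval_fps (divisor_fps (k - 1)) q)"
  unfolding modular_q_function_def
proof (intro conjI ballI)
  show "(\<lambda>q. (\<Sum>\<^sub>\<infinity>n::int. inverse (of_int n ^ k)) +
     2 * lipschitz_const k * eval_fps (divisor_fps (k - 1)) q) holomorphic_on ball 0 1"
    by (intro holomorphic_intros holomorphic_eval_fps_ball conv_radius_divisor_fps)
  fix \<tau> assume t: "\<tau> \<in> upper_half_plane"
  from lattice_eisenstein_S[OF t, of k]
  show "(\<Sum>\<^sub>\<infinity>n::int. inverse (of_int n ^ k)) + 2 * lipschitz_const k * eval_fps (divisor_fps (k - 1)) (nome (- 1 / \<tau>)) =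
    \<tau> ^ k * ((\<Sum>\<^sub>\<infinity>n::int. inverse (of_int n ^ k)) + 2 * lipschitz_const k * eval_fps (divisor_fps (k - 1)) (nome \<tau>))"
    unfolding lattice_eisenstein_q_expansion[OF t assms]
      lattice_eisenstein_q_expansion[OF upper_half_plane_S[OF t] assms] .
qed

text \<open>In weight \<open>k < 12\<close> a form is determined by its constant coefficient.  Comparing the linear
  coefficients as well normalises the Eisenstein series without evaluating \<open>\<zeta>(k)\<close>.\<close>

lemma eisenstein_normalization:
  assumes G: "modular_q_function k G" "G 0 = 1" "(G has_field_derivative c) (at 0)"
    and k: "k \<ge> 4" "even k" "k < 12" and q: "q \<in> ball 0 1"
  shows "G q = 1 + c * eval_fps (divisor_fps (k - 1)) q"
proof -
  define a b where "a = (\<Sum>\<^sub>\<infinity>n::int. inverse (of_int n ^ k) :: complex)" and "b = 2 * lipschitz_const k"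
  define H where "H = (\<lambda>q. (a + b * eval_fps (divisor_fps (k - 1)) q) - a * G q)"
  have "modular_q_function k H"
    unfolding H_def a_def b_def
    by (intro modular_q_function_diff modular_q_function_cmult G modular_q_function_lattice_eisenstein k)
  moreover have "H 0 = 0" by (simp add: H_def G)
  ultimately have H0: "H q = 0" if "q \<in> ball 0 1" for q
    using modular_q_function_small_weight k that by blast
  have "(H has_field_derivative b * 1 - a * c) (at 0)"
    unfolding H_def by (rule derivative_eq_intros DERIV_divisor_fps_0 G refl | simp)+
  moreover have "(H has_field_derivative 0) (at 0)"
    by (rule has_field_derivative_transform_within_open[of "\<lambda>_. 0" _ _ "ball 0 1"]) (use H0 in auto)
  ultimately have b: "b = a * c" using DERIV_unique by force
  \<comment> \<open>The nonvanishing of the zeta value \<open>a\<close> is inferred from the linear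
    coefficient \<open>b = a * c\<close>, which is explicit and nonzero.\<close>
  have "b \<noteq> 0" by (simp add: b_def lipschitz_const_def)
  then have "a \<noteq> 0" using b by auto
  moreover have "a * G q = a * (1 + c * eval_fps (divisor_fps (k - 1)) q)"
    using H0[OF q] by (simp add: H_def b algebra_simps)
  ultimately show ?thesis by simp
qed

text \<open>The right side is a form of weight 4 with constant coefficient 1 and linear coefficient
  \<open>2 * (-24) - 12 * (-24) = 240\<close>, which pins it down as \<open>E4_q\<close>. The
  modularity of \<open>E4_q\<close> is then a consequence of this identity.\<close>

theorem ramanujan_E2:
  assumes q: "q \<in> ball 0 1"
  shows "E4_q q = E2_q q ^ 2 - 12 * q_derivative E2_q q"
proof -
  have "((\<lambda>q. E2_q q ^ 2 - 12 * q_derivative E2_q q) has_field_derivative 240) (at 0)"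
    by (rule derivative_eq_intros DERIV_E2_q_0 DERIV_q_derivative_0[OF holomorphic_E2_q DERIV_E2_q_0] refl | simp)+
  from eisenstein_normalization[OF modular_q_function_E2_ramanujan _ this _ _ _ q]
  show ?thesis by (simp add: E4_q_def)
qed

lemma modular_q_function_cong:
  assumes "modular_q_function k F" "\<And>q. q \<in> ball 0 1 \<Longrightarrow> F q = G q"
  shows "modular_q_function k G"
  unfolding modular_q_function_def
proof (intro conjI ballI)
  show "G holomorphic_on ball 0 1"
    by (rule holomorphic_transform[of F]) (use assms in \<open>auto simp: modular_q_function_def\<close>)
  fix \<tau> assume t: "\<tau> \<in> upper_half_plane"
  then have "F (nome (- 1 / \<tau>)) = \<tau> ^ k * F (nome \<tau>)" using assms(1) by (simp add: modular_q_function_def)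
  then show "G (nome (- 1 / \<tau>)) = \<tau> ^ k * G (nome \<tau>)"
    by (simp only: assms(2) nome_in_ball t upper_half_plane_S)
qed

lemma modular_q_function_E4: "modular_q_function 4 E4_q"
  by (rule modular_q_function_cong[OF modular_q_function_E2_ramanujan]) (simp add: ramanujan_E2)

theorem ramanujan_E4:
  assumes q: "q \<in> ball 0 1"
  shows "q_derivative E4_q q = (E2_q q * E4_q q - E6_q q) / 3"
proof -
  \<comment> \<open>The factor -3 normalises the constant coefficient to 1; the linear one is then
    \<open>- 3 * (240 - (240 - 24) / 3) = - 504\<close>.\<close>
  have "modular_q_function (4 + 2) (\<lambda>q. - 3 * (q_derivative E4_q q - of_nat 4 / 12 * E2_q q * E4_q q))"
    by (intro modular_q_function_cmult modular_q_function_serre modular_q_function_E4)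
  moreover have "((\<lambda>q. - 3 * (q_derivative E4_q q - of_nat 4 / 12 * E2_q q * E4_q q)) has_field_derivative -504) (at 0)"
    by (rule derivative_eq_intros DERIV_E2_q_0 DERIV_E4_q_0 DERIV_q_derivative_0[OF holomorphic_E4_q DERIV_E4_q_0] refl | simp)+
  ultimately have "- 3 * (q_derivative E4_q q - of_nat 4 / 12 * E2_q q * E4_q q) = 1 + (-504) * eval_fps (divisor_fps 5) q"
    using eisenstein_normalization[of 6 "\<lambda>q. - 3 * (q_derivative E4_q q - of_nat 4 / 12 * E2_q q * E4_q q)" "-504" q] q by simp
  then have "- 3 * (q_derivative E4_q q - of_nat 4 / 12 * E2_q q * E4_q q) = E6_q q"
    by (simp add: E6_q_def)
  moreover have "- 3 * (q_derivative E4_q q - of_nat 4 / 12 * E2_q q * E4_q q) = E2_q q * E4_q q - 3 * q_derivative E4_q q"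
    by (simp add: algebra_simps)
  ultimately have "E6_q q = E2_q q * E4_q q - 3 * q_derivative E4_q q" by simp
  then show ?thesis by simp
qed

lemma modular_q_function_E6: "modular_q_function 6 E6_q"
proof (rule modular_q_function_cong)
  show "modular_q_function 6 (\<lambda>q. - 3 * (q_derivative E4_q q - of_nat 4 / 12 * E2_q q * E4_q q))"
    using modular_q_function_cmult[OF modular_q_function_serre[OF modular_q_function_E4], of "-3"] by simp
qed (simp add: ramanujan_E4 field_simps)

theorem ramanujan_E6:
  assumes q: "q \<in> ball 0 1"
  shows "q_derivative E6_q q = (E2_q q * E6_q q - E4_q q ^ 2) / 2"
proof -
  \<comment> \<open>The constant coefficients \<open>- 1 / 2\<close> and \<open>1 / 2\<close>
    cancel, and a form of weight 8 without constant coefficient is 0.\<close>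
  have "modular_q_function 8 (\<lambda>q. (q_derivative E6_q q - of_nat 6 / 12 * E2_q q * E6_q q) + 1 / 2 * E4_q q ^ 2)"
    using modular_q_function_add[OF modular_q_function_serre[OF modular_q_function_E6, simplified]
        modular_q_function_cmult[OF modular_q_function_power[OF modular_q_function_E4, of 2, simplified], of "1 / 2"]]
    by simp
  from modular_q_function_small_weight[OF this _ _ q]
  have "(q_derivative E6_q q - of_nat 6 / 12 * E2_q q * E6_q q) + 1 / 2 * E4_q q ^ 2 = 0" by simp
  then show ?thesis by (simp add: field_simps)
qed

text \<open>Both sides have weight 12 and vanish at \<open>q = 0\<close>; the linear coefficient on
  the left is \<open>3 * 240 + 2 * 504 = 1728\<close>. This is where the polynomial in
  \<open>E4\<close>, \<open>E6\<close> is seen to have no zeros.\<close>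

theorem discriminant_q:
  assumes q: "q \<in> ball 0 1"
  shows "E4_q q ^ 3 - E6_q q ^ 2 = 1728 * Delta_q q"
proof (cases "q = 0")
  case False
  then obtain \<tau> where t: "\<tau> \<in> upper_half_plane" "nome \<tau> = q" using nome_surj[OF q] by blast
  have 1: "modular_q_function 12 (\<lambda>q. E4_q q ^ 3 - E6_q q ^ 2)"
    using modular_q_function_diff[OF modular_q_function_power[OF modular_q_function_E4, of 3, simplified]
        modular_q_function_power[OF modular_q_function_E6, of 2, simplified]] .
  have 2: "((\<lambda>q. E4_q q ^ 3 - E6_q q ^ 2) has_field_derivative 1728) (at 0)"
    by (rule derivative_eq_intros DERIV_E4_q_0 DERIV_E6_q_0 refl | simp)+
  show ?thesis using modular_q_function_weight_12[OF 1 _ 2 t(1)] t(2) by simp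
qed (simp add: Delta_q_def)

section \<open>The modular \<open>j\<close>-function\<close>

lemma modular_discriminant_nome: "\<tau> \<in> upper_half_plane \<Longrightarrow> modular_discriminant \<tau> = Delta_q (nome \<tau>)"
  unfolding modular_discriminant_def
  by (simp add: eisenstein_E4_nome eisenstein_E6_nome discriminant_q norm_nome_less_1)

lemma modular_discriminant_nonzero: "\<tau> \<in> upper_half_plane \<Longrightarrow> modular_discriminant \<tau> \<noteq> 0"
  by (simp add: modular_discriminant_nome)

lemma eisenstein_add_1:
  assumes "\<tau> \<in> upper_half_plane"
  shows "eisenstein_E 4 (\<tau> + 1) = eisenstein_E 4 \<tau>" "eisenstein_E 6 (\<tau> + 1) = eisenstein_E 6 \<tau>"
    "modular_discriminant (\<tau> + 1) = modular_discriminant \<tau>" "modular_j (\<tau> + 1) = modular_j \<tau>"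
proof -
  show 1: "eisenstein_E 4 (\<tau> + 1) = eisenstein_E 4 \<tau>" and 2: "eisenstein_E 6 (\<tau> + 1) = eisenstein_E 6 \<tau>"
    by (simp_all add: eisenstein_E_def nome_add_1)
  show "modular_discriminant (\<tau> + 1) = modular_discriminant \<tau>" "modular_j (\<tau> + 1) = modular_j \<tau>"
    by (simp_all add: modular_discriminant_def modular_j_def 1 2)
qed

lemma eisenstein_S:
  assumes "\<tau> \<in> upper_half_plane"
  shows "eisenstein_E 4 (- 1 / \<tau>) = \<tau> ^ 4 * eisenstein_E 4 \<tau>"
    "eisenstein_E 6 (- 1 / \<tau>) = \<tau> ^ 6 * eisenstein_E 6 \<tau>"
    "modular_discriminant (- 1 / \<tau>) = \<tau> ^ 12 * modular_discriminant \<tau>"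
    "modular_j (- 1 / \<tau>) = modular_j \<tau>"
proof -
  note S = upper_half_plane_S[OF assms]
  show 1: "eisenstein_E 4 (- 1 / \<tau>) = \<tau> ^ 4 * eisenstein_E 4 \<tau>"
    unfolding eisenstein_E4_nome[OF S] eisenstein_E4_nome[OF assms]
    using modular_q_function_E4 assms by (simp add: modular_q_function_def)
  show "eisenstein_E 6 (- 1 / \<tau>) = \<tau> ^ 6 * eisenstein_E 6 \<tau>"
    unfolding eisenstein_E6_nome[OF S] eisenstein_E6_nome[OF assms]
    using modular_q_function_E6 assms by (simp add: modular_q_function_def)
  show 2: "modular_discriminant (- 1 / \<tau>) = \<tau> ^ 12 * modular_discriminant \<tau>"
    unfolding modular_discriminant_nome[OF S] modular_discriminant_nome[OF assms] by (rule Delta_q_S[OF assms])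
  show "modular_j (- 1 / \<tau>) = modular_j \<tau>"
    unfolding modular_j_def 1 2 using upper_half_plane_nonzero[OF assms] by (simp add: power_mult_distrib flip: power_mult)
qed

lemma modular_j_diff_1728:
  assumes "\<tau> \<in> upper_half_plane"
  shows "modular_j \<tau> - 1728 = eisenstein_E 6 \<tau> ^ 2 / modular_discriminant \<tau>"
proof -
  have "modular_discriminant \<tau> * 1728 = eisenstein_E 4 \<tau> ^ 3 - eisenstein_E 6 \<tau> ^ 2"
    unfolding modular_discriminant_def by simp
  then show ?thesis using modular_discriminant_nonzero[OF assms] by (simp add: modular_j_def field_simps)
qed

lemma DERIV_eisenstein_E6:
  assumes "\<tau> \<in> upper_half_plane"
  shows "(eisenstein_E 6 has_field_derivative
     2 * of_real pi * \<i> * ((eisenstein_E2 \<tau> * eisenstein_E 6 \<tau> - eisenstein_E 4 \<tau> ^ 2) / 2)) (at \<tau>)"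
proof -
  have "((\<lambda>\<tau>. E6_q (nome \<tau>)) has_field_derivative 2 * of_real pi * \<i> * q_derivative E6_q (nome \<tau>)) (at \<tau>)"
    by (rule has_field_derivative_nome[OF holomorphic_E6_q assms])
  then have "(eisenstein_E 6 has_field_derivative 2 * of_real pi * \<i> * q_derivative E6_q (nome \<tau>)) (at \<tau>)"
    by (rule has_field_derivative_transform_within_open[OF _ open_upper_half_plane assms])
       (simp add: eisenstein_E6_nome)
  then show ?thesis
    by (simp only: ramanujan_E6[OF nome_in_ball[OF assms]] eisenstein_E2_nome[OF assms]
        eisenstein_E4_nome[OF assms] eisenstein_E6_nome[OF assms])
qed

lemma DERIV_modular_discriminant:
  assumes "\<tau> \<in> upper_half_plane"
  shows "(modular_discriminant has_field_derivative
     2 * of_real pi * \<i> * (eisenstein_E2 \<tau> * modular_discriminant \<tau>)) (at \<tau>)"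
  unfolding modular_discriminant_nome[OF assms] eisenstein_E2_nome[OF assms]
  by (rule has_field_derivative_transform_within_open[OF DERIV_Delta_q_nome[OF assms] open_upper_half_plane assms])
     (simp add: modular_discriminant_nome)

text \<open>By \<open>ramanujan_E4\<close>, \<open>D (E4 ^ 3) = E4 ^ 2 * (E2 * E4 - E6)\<close>; in
  the quotient rule the terms with \<open>E2\<close> cancel against
  \<open>D \<Delta> = E2 * \<Delta>\<close>.\<close>

lemma DERIV_modular_j:
  assumes "\<tau> \<in> upper_half_plane"
  shows "(modular_j has_field_derivative
     - (2 * of_real pi * \<i> * (eisenstein_E 4 \<tau> ^ 2 * eisenstein_E 6 \<tau> / modular_discriminant \<tau>))) (at \<tau>)"
proof -
  define X Y Z D where "X = eisenstein_E2 \<tau>" and "Y = eisenstein_E 4 \<tau>" and "Z = eisenstein_E 6 \<tau>"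
    and "D = modular_discriminant \<tau>"
  define P where "P = 2 * of_real pi * \<i>"
  have D0: "D \<noteq> 0" unfolding D_def by (rule modular_discriminant_nonzero[OF assms])
  have "((\<lambda>\<tau>. E4_q (nome \<tau>)) has_field_derivative P * q_derivative E4_q (nome \<tau>)) (at \<tau>)"
    unfolding P_def by (rule has_field_derivative_nome[OF holomorphic_E4_q assms])
  then have "(eisenstein_E 4 has_field_derivative P * q_derivative E4_q (nome \<tau>)) (at \<tau>)"
    by (rule has_field_derivative_transform_within_open[OF _ open_upper_half_plane assms])
       (simp add: eisenstein_E4_nome)
  then have d4: "(eisenstein_E 4 has_field_derivative P * ((X * Y - Z) / 3)) (at \<tau>)"
    by (simp only: ramanujan_E4[OF nome_in_ball[OF assms]] eisenstein_E2_nome[OF assms]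
        eisenstein_E4_nome[OF assms] eisenstein_E6_nome[OF assms] X_def Y_def Z_def)
  have d4': "((\<lambda>\<tau>. eisenstein_E 4 \<tau> ^ 3) has_field_derivative P * Y ^ 2 * (X * Y - Z)) (at \<tau>)"
    by (rule derivative_eq_intros d4 refl)+ (simp add: Y_def)
  have dD: "(modular_discriminant has_field_derivative P * (X * D)) (at \<tau>)"
    unfolding P_def X_def D_def by (rule DERIV_modular_discriminant[OF assms])
  have "(modular_j has_field_derivative (P * Y ^ 2 * (X * Y - Z) * D - Y ^ 3 * (P * (X * D))) / (D * D)) (at \<tau>)"
    unfolding modular_j_def[abs_def]
    using DERIV_divide[OF d4' dD] D0 by (simp add: D_def Y_def)
  moreover have "(P * Y ^ 2 * (X * Y - Z) * D - Y ^ 3 * (P * (X * D))) / (D * D) = - (P * (Y ^ 2 * Z / D))"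
    using D0 by (simp add: field_simps power2_eq_square power3_eq_cube)
  ultimately show ?thesis unfolding P_def Y_def Z_def D_def by simp
qed

lemma holomorphic_modular_j: "modular_j holomorphic_on upper_half_plane"
  unfolding holomorphic_on_open[OF open_upper_half_plane] using DERIV_modular_j by blast

lemma holomorphic_modular_discriminant: "modular_discriminant holomorphic_on upper_half_plane"
  unfolding holomorphic_on_open[OF open_upper_half_plane] using DERIV_modular_discriminant by blast

definition j_regular_q :: "complex \<Rightarrow> complex" where
  "j_regular_q q = E4_q q ^ 3 / Delta_unit_q q"

lemma holomorphic_j_regular_q: "j_regular_q holomorphic_on ball 0 1"
  unfolding j_regular_q_def[abs_def]
  by (intro holomorphic_intros holomorphic_E4_q holomorphic_Delta_unit_q) simp

lemma j_regular_q_0 [simp]: "j_regular_q 0 = 1"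
  by (simp add: j_regular_q_def)

lemma modular_j_nome: "\<tau> \<in> upper_half_plane \<Longrightarrow> nome \<tau> * modular_j \<tau> = j_regular_q (nome \<tau>)"
  by (simp add: modular_j_def j_regular_q_def eisenstein_E4_nome modular_discriminant_nome Delta_q_def)

lemma eventually_at_cusp_upper_half_plane: "\<forall>\<^sub>F \<tau> in at_cusp. \<tau> \<in> upper_half_plane"
  unfolding eventually_at_cusp upper_half_plane_def by (intro exI[of _ 1]) auto

lemma tendsto_at_cusp_holomorphic_nome:
  assumes "F holomorphic_on ball 0 1"
  shows "((\<lambda>\<tau>. F (nome \<tau>)) \<longlongrightarrow> F 0) at_cusp"
proof -
  have "isCont F 0"
    using continuous_on_interior[OF holomorphic_on_imp_continuous_on[OF assms], of 0] by simp
  then have "(F \<longlongrightarrow> F 0) (at 0)" by (simp add: isCont_def)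
  then show ?thesis by (rule filterlim_compose[OF _ filterlim_nome_at_cusp])
qed

lemma filterlim_modular_j: "filterlim modular_j at_infinity at_cusp"
proof -
  have "filterlim (\<lambda>\<tau>. j_regular_q (nome \<tau>) / nome \<tau>) at_infinity at_cusp"
    using tendsto_at_cusp_holomorphic_nome[OF holomorphic_j_regular_q] filterlim_nome_at_cusp
    by (intro filterlim_divide_at_infinity) auto
  then show ?thesis
    by (rule filterlim_mono_eventually[OF _ order_refl order_refl])
       (use eventually_at_cusp_upper_half_plane in \<open>auto elim!: eventually_mono simp flip: modular_j_nome\<close>)
qed

text \<open>If \<open>j\<close> omitted \<open>x\<close>, then \<open>1 / (j - x)\<close> would be
  holomorphic of weight 0 and vanish at the cusp, hence be 0 everywhere.\<close>

theorem modular_j_surj: "\<exists>\<tau>\<in>upper_half_plane. modular_j \<tau> = x"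
proof (rule ccontr)
  assume "\<not> (\<exists>\<tau>\<in>upper_half_plane. modular_j \<tau> = x)"
  then have ne: "modular_j \<tau> - x \<noteq> 0" if "\<tau> \<in> upper_half_plane" for \<tau>
    using that by auto
  define h where "h = (\<lambda>\<tau>. inverse (modular_j \<tau> - x))"
  have i: "\<i> \<in> upper_half_plane" by (simp add: upper_half_plane_def)
  have "h \<i> = 0"
  proof (rule modular_function_vanishing_at_cusp[OF _ _ _ _ i])
    show "h holomorphic_on upper_half_plane"
      unfolding h_def by (intro holomorphic_intros holomorphic_modular_j ne)
    show "h (\<tau> + 1) = h \<tau>" "h (- 1 / \<tau>) = h \<tau>" if "\<tau> \<in> upper_half_plane" for \<tau>
      using eisenstein_add_1[OF that] eisenstein_S[OF that] by (simp_all add: h_def)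
    have "filterlim (\<lambda>\<tau>. - x + modular_j \<tau>) at_infinity at_cusp"
      by (rule tendsto_add_filterlim_at_infinity[OF tendsto_const filterlim_modular_j])
    then show "(h \<longlongrightarrow> 0) at_cusp"
      unfolding h_def by (intro filterlim_compose[OF tendsto_inverse_0]) simp
  qed
  with ne[OF i] show False by (simp add: h_def)
qed

text \<open>Induction on the bound \<open>N\<close> for the order of the pole. Subtracting
  \<open>H 0 * j ^ N\<close> for \<open>N > 0\<close> cancels the leading term, so
  \<open>H1 0 = 0\<close> and the singularity of \<open>H1 / q\<close> is removable. Without a pole,
  \<open>G\<close> minus its value at the cusp is 0. Periodicity of \<open>G\<close> is implicit in
  the last assumption.\<close>

theorem modular_function_polynomial_in_j:
  assumes "H holomorphic_on ball 0 1"
    and "\<And>\<tau>. \<tau> \<in> upper_half_plane \<Longrightarrow> G (- 1 / \<tau>) = G \<tau>"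
    and "\<And>\<tau>. \<tau> \<in> upper_half_plane \<Longrightarrow> nome \<tau> ^ N * G \<tau> = H (nome \<tau>)"
  shows "\<exists>Q. \<forall>\<tau>\<in>upper_half_plane. G \<tau> = poly Q (modular_j \<tau>)"
  using assms
proof (induction N arbitrary: G H)
  case 0
  have "G \<tau> - H 0 = 0" if t: "\<tau> \<in> upper_half_plane" for \<tau>
  proof -
    define h where "h = (\<lambda>\<tau>. H (nome \<tau>) - H 0)"
    have "h \<tau> = 0"
    proof (rule modular_function_vanishing_at_cusp[OF _ _ _ _ t])
      show "h holomorphic_on upper_half_plane"
        unfolding h_def holomorphic_on_open[OF open_upper_half_plane]
        using DERIV_diff[OF has_field_derivative_nome[OF 0(1)] DERIV_const] by blast
      show "h (\<tau> + 1) = h \<tau>" for \<tau> by (simp add: h_def nome_add_1)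
      show "h (- 1 / \<tau>) = h \<tau>" if "\<tau> \<in> upper_half_plane" for \<tau>
        using 0(2)[OF that] 0(3)[OF that] 0(3)[OF upper_half_plane_S[OF that]] by (simp add: h_def)
      show "(h \<longlongrightarrow> 0) at_cusp"
        unfolding h_def using tendsto_diff[OF tendsto_at_cusp_holomorphic_nome[OF 0(1)] tendsto_const, of "H 0"] by simp
    qed
    then show ?thesis using 0(3)[OF t] by (simp add: h_def)
  qed
  then show ?case by (intro exI[of _ "[:H 0:]"]) auto
next
  case (Suc N)
  define G' where "G' = (\<lambda>\<tau>. G \<tau> - H 0 * modular_j \<tau> ^ Suc N)"
  define H1 where "H1 = (\<lambda>q. H q - H 0 * j_regular_q q ^ Suc N)"
  define H2 where "H2 = (\<lambda>q. if q = 0 then deriv H1 0 else H1 q / q)"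
  have H1: "H1 holomorphic_on ball 0 1"
    unfolding H1_def by (intro holomorphic_intros holomorphic_j_regular_q Suc.prems(1))
  have H2: "H2 holomorphic_on ball 0 1"
    by (rule pole_theorem_open_0[OF H1 open_ball, of 0]) (auto simp: H2_def H1_def)
  have S: "G' (- 1 / \<tau>) = G' \<tau>" if "\<tau> \<in> upper_half_plane" for \<tau>
    using Suc.prems(2)[OF that] eisenstein_S(4)[OF that] by (simp add: G'_def)
  have "nome \<tau> ^ N * G' \<tau> = H2 (nome \<tau>)" if t: "\<tau> \<in> upper_half_plane" for \<tau>
  proof -
    have "nome \<tau> ^ Suc N * G' \<tau> = nome \<tau> ^ Suc N * G \<tau> - H 0 * (nome \<tau> * modular_j \<tau>) ^ Suc N"
      unfolding G'_def power_mult_distrib by (simp only: algebra_simps)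
    also have "\<dots> = H1 (nome \<tau>)"
      unfolding Suc.prems(3)[OF t] modular_j_nome[OF t] H1_def ..
    finally show ?thesis by (simp add: H2_def field_simps)
  qed
  from Suc.IH[OF H2 S this] obtain Q where Q: "\<And>\<tau>. \<tau> \<in> upper_half_plane \<Longrightarrow> G' \<tau> = poly Q (modular_j \<tau>)"
    by blast
  have "G \<tau> = poly (Q + monom (H 0) (Suc N)) (modular_j \<tau>)" if "\<tau> \<in> upper_half_plane" for \<tau>
    using Q[OF that] unfolding G'_def by (simp add: poly_monom diff_eq_eq)
  then show ?case by blast
qed

text \<open>Among the points of the strip with a given value of \<open>j\<close>, one with maximal imaginary part
  lies in the closed fundamental domain.\<close>

theorem modular_j_fundamental_domain:
  obtains \<tau> where "\<tau> \<in> fundamental_domain" "modular_j \<tau> = x"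
proof -
  have "\<forall>\<^sub>F \<tau> in at_cusp. norm (modular_j \<tau>) > norm x"
    using filterlim_at_infinity_imp_norm_at_top[OF filterlim_modular_j] by (simp add: filterlim_at_top_dense)
  then obtain Y where Y: "\<And>\<tau>. Im \<tau> \<ge> Y \<Longrightarrow> norm (modular_j \<tau>) > norm x"
    unfolding eventually_at_cusp by blast
  define B where "B = {\<tau>. \<bar>Re \<tau>\<bar> \<le> 1 / 2 \<and> 1 / 2 \<le> Im \<tau> \<and> Im \<tau> \<le> Y}"
  define C where "C = {\<tau> \<in> B. modular_j \<tau> = x}"
  have inC: "\<tau> \<in> C" if "modular_j \<tau> = x" "\<bar>Re \<tau>\<bar> \<le> 1 / 2" "1 / 2 \<le> Im \<tau>" for \<tau>
    using that Y[of \<tau>] by (force simp: C_def B_def)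
  have "B \<subseteq> upper_half_plane" by (auto simp: B_def upper_half_plane_def)
  then have cont: "continuous_on B modular_j"
    using holomorphic_on_imp_continuous_on[OF holomorphic_modular_j] continuous_on_subset by blast
  have cB: "compact B" unfolding B_def by (rule compact_truncated_strip)
  have "closed C"
    unfolding C_def using continuous_closed_preimage_constant[OF cont compact_imp_closed[OF cB]] by simp
  then have "compact (B \<inter> C)" by (rule compact_Int_closed[OF cB])
  moreover have "B \<inter> C = C" by (auto simp: C_def)
  ultimately have "compact C" by simp
  moreover have "C \<noteq> {}"
  proof -
    obtain \<tau> where t: "\<tau> \<in> upper_half_plane" "modular_j \<tau> = x" using modular_j_surj by blast
    obtain w where "modular_j w = modular_j \<tau>" "\<bar>Re w\<bar> \<le> 1 / 2" "Im w \<ge> 1 / 2"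
      using modular_invariant_reduce[of modular_j, OF eisenstein_add_1(4) eisenstein_S(4) t(1)] by blast
    then show ?thesis using inC t by auto
  qed
  ultimately obtain \<xi> where xi: "\<xi> \<in> C" "\<And>z. z \<in> C \<Longrightarrow> Im z \<le> Im \<xi>"
    using continuous_attains_sup[of C Im] continuous_on_Im[OF continuous_on_id] by blast
  have x: "modular_j \<xi> = x" "\<bar>Re \<xi>\<bar> \<le> 1 / 2" "Im \<xi> \<ge> 1 / 2" using xi(1) by (auto simp: C_def B_def)
  then have U: "\<xi> \<in> upper_half_plane" by (simp add: upper_half_plane_def)
  have n1: "norm \<xi> \<ge> 1"
  proof (rule ccontr)
    assume "\<not> norm \<xi> \<ge> 1"
    then have "(norm \<xi>)\<^sup>2 < 1" "(norm \<xi>)\<^sup>2 > 0"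
      using upper_half_plane_nonzero[OF U] by (auto simp: power_less_one_iff abs_square_less_1)
    then have gt: "Im (- 1 / \<xi>) > Im \<xi>"
      unfolding Im_neg_inverse using x(3) by (simp add: field_simps)
    obtain n :: int where n: "\<bar>Re (- 1 / \<xi> + of_int n)\<bar> \<le> 1 / 2" using int_translate_Re .
    have "modular_j (- 1 / \<xi> + of_int n) = modular_j (- 1 / \<xi>)"
      by (rule periodic_add_int[of modular_j, OF eisenstein_add_1(4) upper_half_plane_S[OF U]])
    also have "\<dots> = x" using eisenstein_S(4)[OF U] x(1) by simp
    finally have "- 1 / \<xi> + of_int n \<in> C" using gt x(3) n by (intro inC) auto
    from xi(2)[OF this] gt show False by simp
  qed
  \<comment> \<open>The domain contains only the left part of its boundary: points with real part
    1/2 are translated by -1, and points on the right half of the arc are inverted.\<close>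
  consider "Re \<xi> \<le> 0" | "0 < Re \<xi>" "Re \<xi> < 1 / 2" "norm \<xi> > 1" | "Re \<xi> = 1 / 2"
    | "0 < Re \<xi>" "Re \<xi> < 1 / 2" "norm \<xi> = 1"
    using x(2) n1 by linarith
  then show ?thesis
  proof cases
    case 1
    then show ?thesis using U n1 x by (intro that[of \<xi>]) (auto simp: fundamental_domain_def)
  next
    case 2
    then show ?thesis using U x by (intro that[of \<xi>]) (auto simp: fundamental_domain_def)
  next
    case 3
    have U': "\<xi> - 1 \<in> upper_half_plane" using U by (simp add: upper_half_plane_def)
    have "modular_j (\<xi> - 1) = x" using eisenstein_add_1(4)[OF U'] x(1) by simp
    moreover have "norm (\<xi> - 1) = norm \<xi>" using 3 by (simp add: cmod_def power2_eq_square algebra_simps)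
    ultimately show ?thesis using U' n1 3 by (intro that[of "\<xi> - 1"]) (auto simp: fundamental_domain_def)
  next
    case 4
    have "Re (- 1 / \<xi>) = - Re \<xi>"
      using 4(3) cmod_power2[of \<xi>] by (simp add: Re_divide)
    moreover have "norm (- 1 / \<xi>) = 1" using 4(3) by (simp add: norm_divide)
    ultimately show ?thesis using 4 upper_half_plane_S[OF U] eisenstein_S(4)[OF U] x(1)
      by (intro that[of "- 1 / \<xi>"]) (auto simp: fundamental_domain_def)
  qed
qed

section \<open>Values of \<open>j\<close> on the arc\<close>

text \<open>Just after \<open>a\<close> the function is positive. Before its first later zero it
  would be negative, the derivative there being positive, and the intermediate value theorem would
  yield a still earlier zero.\<close>

lemma positive_after_simple_zero:
  fixes g :: "real \<Rightarrow> real"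
  assumes d: "\<And>x. a \<le> x \<Longrightarrow> x \<le> b \<Longrightarrow> (g has_real_derivative g' x) (at x)"
    and a: "g a = 0" and pos: "\<And>x. a \<le> x \<Longrightarrow> x \<le> b \<Longrightarrow> g x = 0 \<Longrightarrow> g' x > 0"
    and c: "a < c" "c \<le> b"
  shows "g c > 0"
proof (rule ccontr)
  assume "\<not> g c > 0"
  then have gc: "g c \<le> 0" by simp
  have cont: "continuous_on {x..y} g" if "a \<le> x" "y \<le> b" for x y
  proof (rule DERIV_continuous_on)
    show "(g has_real_derivative g' t) (at t within {x..y})" if "t \<in> {x..y}" for t
      by (rule has_field_derivative_at_within, rule d) (use that \<open>a \<le> x\<close> \<open>y \<le> b\<close> in auto)
  qed
  have "(g has_real_derivative g' a) (at a)" "g' a > 0" using a c by (auto intro: d pos)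
  from DERIV_pos_inc_right[OF this]
  obtain e where e: "e > 0" "\<And>h. 0 < h \<Longrightarrow> h < e \<Longrightarrow> g a < g (a + h)" by blast
  define h where "h = min (e / 2) ((c - a) / 2)"
  have h: "0 < h" "h < e" "h < c - a" using e(1) c by (auto simp: h_def min_less_iff_disj)
  define a' where "a' = a + h"
  have a': "a < a'" "a' < c" "g a' > 0"
    using e(2)[OF h(1,2)] h a by (auto simp: a'_def)
  define Z where "Z = {x \<in> {a'..c}. g x = 0}"
  have cZ: "closed Z"
    unfolding Z_def using a' c by (intro continuous_closed_preimage_constant cont) auto
  have zero: "\<exists>z\<in>Z. z \<le> x" if x: "a' \<le> x" "x \<le> c" "g x \<le> 0" for x
  proof -
    have "\<exists>z\<ge>a'. z \<le> x \<and> g z = 0"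
      using a' x c by (intro IVT2' cont) auto
    then show ?thesis using x(2) by (auto simp: Z_def)
  qed
  have ne: "Z \<noteq> {}" using zero[of c] gc a' by auto
  have bdd: "bdd_below Z" by (rule bdd_belowI[of _ a']) (auto simp: Z_def)
  have zZ: "Inf Z \<in> Z" by (rule closed_contains_Inf[OF ne bdd cZ])
  have lower: "Inf Z \<le> x" if "x \<in> Z" for x by (rule cInf_lower[OF that bdd])
  define z where "z = Inf Z"
  have z: "a' \<le> z" "z \<le> c" "g z = 0" using zZ by (auto simp: Z_def z_def)
  with a' have "a' < z" by (cases "a' = z") auto
  have "(g has_real_derivative g' z) (at z)" "g' z > 0" using z a' c by (auto intro: d pos)
  from DERIV_pos_inc_left[OF this]
  obtain e' where e': "e' > 0" "\<And>h. 0 < h \<Longrightarrow> h < e' \<Longrightarrow> g (z - h) < g z" by blast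
  define k where "k = min (e' / 2) ((z - a') / 2)"
  have h: "0 < k" "k < e'" "k < z - a'" using \<open>a' < z\<close> e'(1) by (auto simp: k_def min_less_iff_disj)
  then have "a' \<le> z - k" by simp
  have "g (z - k) \<le> 0" using e'(2)[OF h(1,2)] z(3) by simp
  from zero[OF \<open>a' \<le> z - k\<close> _ this] obtain y where "y \<in> Z" "y \<le> z - k" using z(2) h(1) by auto
  with lower[of y] h show False by (simp add: z_def)
qed

lemma cnj_nome: "cnj (nome \<tau>) = nome (- cnj \<tau>)"
  by (simp add: nome_def exp_cnj)

lemma cnj_eval_divisor_fps:
  assumes "norm q < 1"
  shows "cnj (eval_fps (divisor_fps r) q) = eval_fps (divisor_fps r) (cnj q)"
proof -
  have s: "(\<lambda>n. fps_nth (divisor_fps r) n * x ^ n) sums eval_fps (divisor_fps r) x" if "norm x < 1" for x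
  proof (rule sums_eval_fps)
    have "ereal (norm x) < 1" using that by simp
    then show "ereal (norm x) < fps_conv_radius (divisor_fps r)"
      using conv_radius_divisor_fps less_le_trans by blast
  qed
  have real: "cnj (fps_nth (divisor_fps r) n) = fps_nth (divisor_fps r) n" for n
    by (simp add: divisor_fps_def)
  have "(\<lambda>n. cnj (fps_nth (divisor_fps r) n * q ^ n)) sums cnj (eval_fps (divisor_fps r) q)"
    using s[OF assms] by (simp only: sums_cnj)
  then have "(\<lambda>n. fps_nth (divisor_fps r) n * cnj q ^ n) sums cnj (eval_fps (divisor_fps r) q)"
    by (simp add: real)
  from sums_unique2[OF this s] assms show ?thesis by simp
qed

lemma cnj_eisenstein:
  assumes t: "\<tau> \<in> upper_half_plane"
  shows "cnj (eisenstein_E 4 \<tau>) = eisenstein_E 4 (- cnj \<tau>)" "cnj (eisenstein_E 6 \<tau>) = eisenstein_E 6 (- cnj \<tau>)"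
proof -
  have t': "- cnj \<tau> \<in> upper_half_plane" using t by (simp add: upper_half_plane_def)
  show "cnj (eisenstein_E 4 \<tau>) = eisenstein_E 4 (- cnj \<tau>)" "cnj (eisenstein_E 6 \<tau>) = eisenstein_E 6 (- cnj \<tau>)"
    unfolding eisenstein_E4_nome[OF t] eisenstein_E4_nome[OF t'] eisenstein_E6_nome[OF t] eisenstein_E6_nome[OF t']
      E4_q_def E6_q_def using cnj_eval_divisor_fps[OF norm_nome_less_1[OF t]] by (simp_all add: cnj_nome)
qed

text \<open>On the unit circle \<open>- 1 / \<tau> = - cnj \<tau>\<close>; the powers of \<open>\<tau>\<close> below make these functions real there.\<close>

definition arc_E4 :: "real \<Rightarrow> complex" where "arc_E4 \<theta> = cis \<theta> ^ 2 * eisenstein_E 4 (cis \<theta>)"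
definition arc_E6 :: "real \<Rightarrow> complex" where "arc_E6 \<theta> = cis \<theta> ^ 3 * eisenstein_E 6 (cis \<theta>)"

definition arc_Delta :: "real \<Rightarrow> complex" where "arc_Delta \<theta> = cis \<theta> ^ 6 * modular_discriminant (cis \<theta>)"

lemma cis_upper_half_plane: "0 < \<theta> \<Longrightarrow> \<theta> < pi \<Longrightarrow> cis \<theta> \<in> upper_half_plane"
  by (simp add: upper_half_plane_def sin_gt_zero)

lemma arc_real:
  assumes "0 < \<theta>" "\<theta> < pi"
  shows "arc_E4 \<theta> \<in> \<real>" "arc_E6 \<theta> \<in> \<real>"
proof -
  define t where "t = cis \<theta>"
  have t: "t \<in> upper_half_plane" unfolding t_def by (rule cis_upper_half_plane[OF assms])
  have t0: "t \<noteq> 0" by (simp add: t_def)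
  have c: "cnj t = 1 / t" unfolding t_def by (simp add: cis_cnj cis_inverse divide_inverse)
  then have m: "- cnj t = - 1 / t" by simp
  have pw: "(1 / t) ^ n * (t ^ (n + n) * x) = t ^ n * x" for n x
    unfolding power_add power_one_over using t0 by simp
  have "cnj (arc_E4 \<theta>) = (1 / t) ^ 2 * (t ^ 4 * eisenstein_E 4 t)"
    using cnj_eisenstein(1)[OF t] eisenstein_S(1)[OF t]
    unfolding arc_E4_def t_def[symmetric] complex_cnj_mult complex_cnj_power m c by simp
  also have "\<dots> = arc_E4 \<theta>"
    unfolding arc_E4_def t_def[symmetric] using pw[of 2] by simp
  finally show "arc_E4 \<theta> \<in> \<real>" by (simp add: Reals_cnj_iff)
  have "cnj (arc_E6 \<theta>) = (1 / t) ^ 3 * (t ^ 6 * eisenstein_E 6 t)"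
    using cnj_eisenstein(2)[OF t] eisenstein_S(2)[OF t]
    unfolding arc_E6_def t_def[symmetric] complex_cnj_mult complex_cnj_power m c by simp
  also have "\<dots> = arc_E6 \<theta>"
    unfolding arc_E6_def t_def[symmetric] using pw[of 3] by simp
  finally show "arc_E6 \<theta> \<in> \<real>" by (simp add: Reals_cnj_iff)
qed

lemma arc_Delta_eq: "1728 * arc_Delta \<theta> = arc_E4 \<theta> ^ 3 - arc_E6 \<theta> ^ 2"
  unfolding arc_Delta_def arc_E4_def arc_E6_def modular_discriminant_def power_mult_distrib
  by (simp add: right_diff_distrib flip: power_mult)

lemma arc_Delta_real: "0 < \<theta> \<Longrightarrow> \<theta> < pi \<Longrightarrow> arc_Delta \<theta> \<in> \<real>"
proof -
  assume "0 < \<theta>" "\<theta> < pi"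
  then have "(1728 * arc_Delta \<theta>) / 1728 \<in> \<real>"
    unfolding arc_Delta_eq by (intro Reals_divide Reals_diff Reals_power arc_real) auto
  then show ?thesis by simp
qed

lemma modular_j_arc: "modular_j (cis \<theta>) = arc_E4 \<theta> ^ 3 / arc_Delta \<theta>"
  unfolding modular_j_def arc_E4_def arc_Delta_def power_mult_distrib by (simp flip: power_mult)

lemma eisenstein_E6_i: "eisenstein_E 6 \<i> = 0"
proof -
  have "\<i> \<in> upper_half_plane" by (simp add: upper_half_plane_def)
  from eisenstein_S(2)[OF this] have "eisenstein_E 6 \<i> = \<i> ^ 6 * eisenstein_E 6 \<i>" by (simp add: divide_i)
  moreover have "\<i> ^ 6 = ((\<i> ^ 2) ^ 3 :: complex)" by (simp only: power_mult [symmetric]) simp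
  ultimately show ?thesis by simp
qed

text \<open>At this cube root of unity \<open>r + 1 = - 1 / r\<close>, so translation and inversion
  together give \<open>E4 r = r ^ 4 * E4 r\<close> with \<open>r ^ 4 = r\<close> different from
  1.\<close>

lemma eisenstein_E4_rho: "eisenstein_E 4 (cis (2 * pi / 3)) = 0"
proof -
  define r where "r = cis (2 * pi / 3)"
  have r: "r \<in> upper_half_plane" unfolding r_def by (rule cis_upper_half_plane) auto
  have r3: "r ^ 3 = 1" by (simp add: r_def Complex.DeMoivre)
  have r1: "r \<noteq> 1"
    using r by (auto simp: upper_half_plane_def)
  have "(r - 1) * (r ^ 2 + r + 1) = 0" using r3 by (simp add: algebra_simps power2_eq_square power3_eq_cube)
  then have "r ^ 2 + r + 1 = 0" using r1 by simp
  then have "r * (r + 1) = - 1" by (simp add: algebra_simps power2_eq_square eq_neg_iff_add_eq_0)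
  then have "r + 1 = - 1 / r" using upper_half_plane_nonzero[OF r] by (simp add: field_simps)
  then have "eisenstein_E 4 r = r ^ 4 * eisenstein_E 4 r"
    using eisenstein_add_1(1)[OF r] eisenstein_S(1)[OF r] by simp
  also have "r ^ 4 = r" using r3 power_add[of r 3 1] by simp
  finally show ?thesis using r1 by (simp add: r_def[symmetric])
qed

lemma DERIV_Re_cis:
  assumes "(f has_field_derivative d) (at (cis \<theta>))"
  shows "((\<lambda>\<theta>. Re (f (cis \<theta>))) has_real_derivative Re (\<i> * cis \<theta> * d)) (at \<theta>)"
proof -
  have "(cis has_vector_derivative \<i> * cis \<theta>) (at \<theta>)"
    unfolding has_vector_derivative_def by (auto intro!: derivative_eq_intros simp: scaleR_conv_of_real mult_ac)
  from field_vector_diff_chain_at[OF this assms] show ?thesis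
    by (auto intro!: derivative_eq_intros simp: o_def)
qed

text \<open>Where \<open>E6\<close> vanishes, Ramanujan's identity reduces to
  \<open>D E6 = - E4 ^ 2 / 2\<close>, and the powers of \<open>cis \<theta>\<close>, including the
  one from the chain rule, complete this to the square of the real number
  \<open>arc_E4 \<theta>\<close>.\<close>

lemma DERIV_arc_E6_at_zero:
  assumes "0 < \<theta>" "\<theta> < pi" "eisenstein_E 6 (cis \<theta>) = 0"
  shows "((\<lambda>\<theta>. Re (arc_E6 \<theta>)) has_real_derivative pi * Re (arc_E4 \<theta>) ^ 2) (at \<theta>)"
proof -
  note t = cis_upper_half_plane[OF assms(1,2)]
  let ?P = "complex_of_real pi"
  have "((\<lambda>t. t ^ 3 * eisenstein_E 6 t) has_field_derivative
      cis \<theta> ^ 3 * (2 * ?P * \<i> * (- (eisenstein_E 4 (cis \<theta>) ^ 2) / 2))) (at (cis \<theta>))"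
    using DERIV_mult[OF DERIV_power[OF DERIV_ident, of 3] DERIV_eisenstein_E6[OF t]] assms(3) by (simp add: mult_ac)
  from DERIV_Re_cis[OF this]
  have "((\<lambda>\<theta>. Re (arc_E6 \<theta>)) has_real_derivative
     Re (\<i> * cis \<theta> * (cis \<theta> ^ 3 * (2 * ?P * \<i> * (- (eisenstein_E 4 (cis \<theta>) ^ 2) / 2))))) (at \<theta>)"
    by (simp add: arc_E6_def)
  also have "\<i> * cis \<theta> * (cis \<theta> ^ 3 * (2 * ?P * \<i> * (- (eisenstein_E 4 (cis \<theta>) ^ 2) / 2))) = ?P * arc_E4 \<theta> ^ 2"
  proof -
    have "\<i> * c * (c ^ 3 * (2 * p * \<i> * y)) = p * (c ^ 2 * x) ^ 2" if "2 * y = - (x ^ 2)" for c p x y :: complex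
      using i_squared that by algebra
    from this[of "- (eisenstein_E 4 (cis \<theta>) ^ 2) / 2"] show ?thesis unfolding arc_E4_def by simp
  qed
  also have "arc_E4 \<theta> = of_real (Re (arc_E4 \<theta>))" using arc_real(1)[OF assms(1,2)] by simp
  finally show ?thesis by (simp flip: of_real_power of_real_mult)
qed

lemma DERIV_arc_j:
  assumes "0 < \<theta>" "\<theta> < pi"
  shows "((\<lambda>\<theta>. Re (modular_j (cis \<theta>))) has_real_derivative
     2 * pi * (Re (arc_E4 \<theta>) ^ 2 * Re (arc_E6 \<theta>) / Re (arc_Delta \<theta>))) (at \<theta>)"
proof -
  note t = cis_upper_half_plane[OF assms]
  let ?P = "complex_of_real pi"
  have "arc_E4 \<theta> ^ 2 * arc_E6 \<theta> / arc_Delta \<theta> =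
     cis \<theta> * (eisenstein_E 4 (cis \<theta>) ^ 2 * eisenstein_E 6 (cis \<theta>) / modular_discriminant (cis \<theta>))"
  proof -
    \<comment> \<open>The chain rule contributes exactly the missing power of
      \<open>cis \<theta>\<close>: \<open>4 + 3 = 6 + 1\<close>.\<close>
    have "(c ^ 2 * x) ^ 2 * (c ^ 3 * z) = c ^ 6 * (c * (x ^ 2 * z))" for c x z :: complex by algebra
    then show ?thesis unfolding arc_E4_def arc_E6_def arc_Delta_def
      by (simp only: mult_divide_mult_cancel_left power_not_zero cis_neq_zero not_False_eq_True times_divide_eq_right)
  qed
  then have "\<i> * cis \<theta> * (- (2 * ?P * \<i> * (eisenstein_E 4 (cis \<theta>) ^ 2 * eisenstein_E 6 (cis \<theta>) / modular_discriminant (cis \<theta>))))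
     = 2 * ?P * (arc_E4 \<theta> ^ 2 * arc_E6 \<theta> / arc_Delta \<theta>)"
    by (simp add: mult_ac)
  also have "arc_E4 \<theta> = of_real (Re (arc_E4 \<theta>))" using arc_real(1)[OF assms] by simp
  also have "arc_E6 \<theta> = of_real (Re (arc_E6 \<theta>))" using arc_real(2)[OF assms] by simp
  also have "arc_Delta \<theta> = of_real (Re (arc_Delta \<theta>))" using arc_Delta_real[OF assms] by simp
  finally show ?thesis using DERIV_Re_cis[OF DERIV_modular_j[OF t]] by (simp flip: of_real_power of_real_mult of_real_divide)
qed


lemma arc_E4_E6_not_both_zero:
  assumes "0 < \<theta>" "\<theta> < pi"
  shows "arc_E4 \<theta> \<noteq> 0 \<or> arc_E6 \<theta> \<noteq> 0" "arc_Delta \<theta> \<noteq> 0"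
proof -
  show nz: "arc_Delta \<theta> \<noteq> 0"
    using modular_discriminant_nonzero[OF cis_upper_half_plane[OF assms]] by (simp add: arc_Delta_def)
  show "arc_E4 \<theta> \<noteq> 0 \<or> arc_E6 \<theta> \<noteq> 0"
    using arc_Delta_eq[of \<theta>] nz by auto
qed

lemma continuous_arc:
  assumes "f holomorphic_on upper_half_plane" "0 < a" "b < pi"
  shows "continuous_on {a..b} (\<lambda>\<theta>. f (cis \<theta>))"
proof (rule continuous_on_compose2[OF holomorphic_on_imp_continuous_on[OF assms(1)]])
  show "continuous_on {a..b} cis" by (intro continuous_intros)
  show "cis ` {a..b} \<subseteq> upper_half_plane" using assms(2,3) by (auto intro: cis_upper_half_plane)
qed

text \<open>At \<open>2 * pi / 3\<close> the form \<open>E4\<close> vanishes, so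
  \<open>1728 * arc_Delta = - arc_E6 ^ 2\<close> is not positive there; since
  \<open>arc_Delta\<close> is real and has no zero on the arc, it cannot change sign.\<close>

lemma arc_Delta_neg:
  assumes "pi / 2 \<le> \<theta>" "\<theta> \<le> 2 * pi / 3"
  shows "Re (arc_Delta \<theta>) < 0"
proof (rule ccontr)
  assume "\<not> Re (arc_Delta \<theta>) < 0"
  then have ge: "0 \<le> Re (arc_Delta \<theta>)" by simp
  let ?r = "2 * pi / 3"
  have "1728 * arc_Delta ?r = - (arc_E6 ?r ^ 2)"
    using arc_Delta_eq[of ?r] eisenstein_E4_rho by (simp add: arc_E4_def)
  moreover have "arc_E6 ?r = of_real (Re (arc_E6 ?r))" using arc_real(2)[of ?r] by simp
  ultimately have "1728 * arc_Delta ?r = of_real (- (Re (arc_E6 ?r) ^ 2))" by simp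
  then have "Re (1728 * arc_Delta ?r) = - (Re (arc_E6 ?r) ^ 2)" by (simp only: Re_complex_of_real)
  then have "1728 * Re (arc_Delta ?r) = - (Re (arc_E6 ?r) ^ 2)" by simp
  then have "Re (arc_Delta ?r) \<le> 0" using zero_le_power2[of "Re (arc_E6 ?r)"] by linarith
  moreover have "continuous_on {\<theta>..?r} (\<lambda>\<theta>. Re (arc_Delta \<theta>))"
  proof -
    have "0 < \<theta>" "?r < pi" using assms(1) pi_gt_zero by linarith+
    then have "continuous_on {\<theta>..?r} (\<lambda>\<theta>. modular_discriminant (cis \<theta>))"
      by (rule continuous_arc[OF holomorphic_modular_discriminant])
    then show ?thesis unfolding arc_Delta_def by (intro continuous_intros)
  qed
  ultimately have "\<exists>x\<ge>\<theta>. x \<le> ?r \<and> Re (arc_Delta x) = 0"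
    using ge assms(2) by (intro IVT2')
  then obtain x where x: "\<theta> \<le> x" "x \<le> ?r" "Re (arc_Delta x) = 0" by blast
  have "0 < x" "x < pi" using x(1,2) assms(1) pi_gt_zero by linarith+
  then show False
    using arc_E4_E6_not_both_zero(2)[of x] of_real_Re[OF arc_Delta_real[of x]] x(3) by simp
qed

text \<open>At each zero the derivative \<open>\<pi> (arc_E4 \<theta>)\<^sup>2\<close> is positive, so the zero at \<open>\<theta> = \<pi> / 2\<close> is the only one.\<close>

lemma arc_E6_pos:
  assumes "pi / 2 < \<theta>" "\<theta> \<le> 2 * pi / 3"
  shows "Re (arc_E6 \<theta>) > 0"
proof -
  have rng: "0 < x \<and> x < pi" if "pi / 2 \<le> x" "x \<le> 2 * pi / 3" for x
    using that pi_gt_zero by linarith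
  define K where "K = (\<lambda>t. t ^ 3 * eisenstein_E 6 t)"
  have dK: "(K has_field_derivative deriv K (cis x)) (at (cis x))" if "pi / 2 \<le> x" "x \<le> 2 * pi / 3" for x
  proof (rule holomorphic_derivI[OF _ open_upper_half_plane])
    have "eisenstein_E 6 holomorphic_on upper_half_plane"
      unfolding holomorphic_on_open[OF open_upper_half_plane] using DERIV_eisenstein_E6 by blast
    then show "K holomorphic_on upper_half_plane" unfolding K_def by (intro holomorphic_intros)
    show "cis x \<in> upper_half_plane" using rng[OF that] by (intro cis_upper_half_plane) auto
  qed
  have d: "((\<lambda>\<theta>. Re (arc_E6 \<theta>)) has_real_derivative Re (\<i> * cis x * deriv K (cis x))) (at x)"
    if "pi / 2 \<le> x" "x \<le> 2 * pi / 3" for x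
    using DERIV_Re_cis[OF dK[OF that]] by (simp add: arc_E6_def K_def)
  show ?thesis
  proof (rule positive_after_simple_zero[OF d])
    show "Re (arc_E6 (pi / 2)) = 0" using eisenstein_E6_i by (simp add: arc_E6_def)
    fix x assume x: "pi / 2 \<le> x" "x \<le> 2 * pi / 3" "Re (arc_E6 x) = 0"
    have r: "0 < x" "x < pi" using rng[OF x(1,2)] by auto
    have "arc_E6 x = 0" using of_real_Re[OF arc_real(2)[OF r]] x(3) by simp
    then have e6: "eisenstein_E 6 (cis x) = 0" by (simp add: arc_E6_def)
    have "arc_E4 x \<noteq> 0" using arc_E4_E6_not_both_zero(1)[OF r] \<open>arc_E6 x = 0\<close> by simp
    then have "Re (arc_E4 x) \<noteq> 0" using of_real_Re[OF arc_real(1)[OF r]] by auto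
    then show "Re (\<i> * cis x * deriv K (cis x)) > 0"
      using DERIV_unique[OF d[OF x(1,2)] DERIV_arc_E6_at_zero[OF r e6]] by simp
  qed (use assms in auto)
qed

text \<open>Along the arc, from \<open>\<i>\<close> at \<open>\<theta> = pi / 2\<close> to the cube
  root of unity at \<open>2 * pi / 3\<close>, the derivative of \<open>j\<close> has the sign of
  \<open>E6 / \<Delta>\<close>, which is not positive. So \<open>j\<close> stays between its end
  values 1728 and 0.\<close>

theorem modular_j_fundamental_arc:
  assumes "\<tau> \<in> fundamental_arc"
  shows "modular_j \<tau> \<in> complex_of_real ` {0..1728}"
proof -
  have t: "norm \<tau> = 1" "- 1 / 2 \<le> Re \<tau>" "Re \<tau> \<le> 0" "Im \<tau> > 0"
    using assms by (auto simp: fundamental_arc_def fundamental_domain_def upper_half_plane_def)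
  define \<theta> where "\<theta> = arccos (Re \<tau>)"
  have \<theta>: "0 \<le> \<theta>" "\<theta> \<le> pi" "cos \<theta> = Re \<tau>"
    unfolding \<theta>_def using t by (auto intro: arccos_lbound arccos_ubound)
  have "sin \<theta> = Im \<tau>"
  proof -
    have "(sin \<theta>)\<^sup>2 = (Im \<tau>)\<^sup>2"
      using cmod_power2[of \<tau>] t(1) \<theta>(3) sin_cos_squared_add[of \<theta>] by simp
    then show ?thesis using t(4) sin_ge_zero[OF \<theta>(1,2)] by simp
  qed
  then have \<tau>: "\<tau> = cis \<theta>" using \<theta>(3) by (simp add: complex_eq_iff)
  have "cos \<theta> \<le> cos (pi / 2)" using \<theta>(3) t(3) by simp
  then have lo: "pi / 2 \<le> \<theta>" using cos_mono_le_eq[of \<theta> "pi / 2"] \<theta> by simp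
  have "cos (2 * pi / 3) \<le> cos \<theta>" using \<theta>(3) t(2) by (simp add: cos_120)
  then have hi: "\<theta> \<le> 2 * pi / 3" using cos_mono_le_eq[of "2 * pi / 3" \<theta>] \<theta> by simp
  have rng: "0 < x \<and> x < pi" if "pi / 2 \<le> x" "x \<le> 2 * pi / 3" for x
    using that pi_gt_zero by linarith
  define J where "J = (\<lambda>\<theta>. Re (modular_j (cis \<theta>)))"
  have dJ: "\<exists>y. (J has_real_derivative y) (at x) \<and> y \<le> 0" if x: "pi / 2 \<le> x" "x \<le> 2 * pi / 3" for x
  proof -
    have r: "0 < x" "x < pi" using rng[OF x] by auto
    have "Re (arc_E6 x) \<ge> 0"
    proof (cases "x = pi / 2")
      case True
      show ?thesis unfolding True arc_E6_def by (simp add: eisenstein_E6_i)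
    next
      case False
      then show ?thesis using arc_E6_pos[OF _ x(2)] x(1) by simp
    qed
    then have "Re (arc_E4 x) ^ 2 * Re (arc_E6 x) / Re (arc_Delta x) \<le> 0"
      using arc_Delta_neg[OF x] by (intro divide_nonneg_neg) auto
    then have "2 * pi * (Re (arc_E4 x) ^ 2 * Re (arc_E6 x) / Re (arc_Delta x)) \<le> 0"
      by (intro mult_nonneg_nonpos) auto
    then show ?thesis using DERIV_arc_j[OF r] unfolding J_def by blast
  qed
  have "J \<theta> \<le> J (pi / 2)"
    by (rule DERIV_nonpos_imp_nonincreasing[OF lo]) (use dJ hi in auto)
  also have "J (pi / 2) = 1728"
  proof -
    have i: "\<i> \<in> upper_half_plane" by (simp add: upper_half_plane_def)
    have "modular_j \<i> - 1728 = 0" unfolding modular_j_diff_1728[OF i] eisenstein_E6_i by simp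
    then show ?thesis by (simp add: J_def)
  qed
  finally have up: "J \<theta> \<le> 1728" .
  have "J (2 * pi / 3) \<le> J \<theta>"
    by (rule DERIV_nonpos_imp_nonincreasing[OF hi]) (use dJ lo in auto)
  moreover have "J (2 * pi / 3) = 0"
    using eisenstein_E4_rho by (simp add: J_def modular_j_arc arc_E4_def)
  ultimately have low: "0 \<le> J \<theta>" by simp
  have r: "0 < \<theta>" "\<theta> < pi" using rng[OF lo hi] by auto
  have "modular_j (cis \<theta>) \<in> \<real>"
    unfolding modular_j_arc by (intro Reals_divide Reals_power arc_real arc_Delta_real r)
  then have "modular_j \<tau> = of_real (J \<theta>)" by (simp add: \<tau> J_def)
  then show ?thesis using low up by auto
qed

section \<open>Zeros of the Serre derivative\<close>

text \<open>The quotient \<open>Q' / Q\<close> is the sum of \<open>1 / (x - a)\<close> over the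
  roots with multiplicity. The number \<open>u\<close> encodes a half-plane that contains all the
  \<open>x - a\<close>, so each summand times \<open>u\<close> has positive real part.\<close>

lemma Gauss_Lucas_half_plane:
  fixes Q :: "complex poly"
  assumes "degree Q > 0" "\<And>a. poly Q a = 0 \<Longrightarrow> Re (u / (x - a)) > 0"
  shows "Re (u * (poly (pderiv Q) x / poly Q x)) > 0"
  using assms
proof (induction "degree Q" arbitrary: Q)
  case (Suc n)
  have "\<not> constant (poly Q)" using Suc.prems(1) by (simp add: constant_degree)
  then obtain a where a: "poly Q a = 0" using fundamental_theorem_of_algebra by blast
  then obtain R where R: "Q = [:- a, 1:] * R" unfolding poly_eq_0_iff_dvd by (auto elim: dvdE)
  have R0: "R \<noteq> 0" using Suc.prems(1) R by auto
  have deg: "degree Q = Suc (degree R)" unfolding R using R0 by (subst degree_mult_eq) auto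
  \<comment> \<open>A root \<open>a = x\<close> would make \<open>u / (x - a)\<close> equal to 0 by
    the convention for division, against the assumption.\<close>
  have ne: "poly Q x \<noteq> 0" using Suc.prems(2)[of x] by auto
  then have xa: "x - a \<noteq> 0" and Rx: "poly R x \<noteq> 0" unfolding R by auto
  have "poly (pderiv Q) x / poly Q x = 1 / (x - a) + poly (pderiv R) x / poly R x"
    unfolding R pderiv_mult using xa Rx by (simp add: pderiv_pCons field_simps)
  then have eq: "u * (poly (pderiv Q) x / poly Q x) = u / (x - a) + u * (poly (pderiv R) x / poly R x)"
    by (simp add: distrib_left)
  have pos: "Re (u / (x - a)) > 0" by (rule Suc.prems(2)[OF a])
  show ?case
  proof (cases "degree R = 0")
    case True
    then have "pderiv R = 0" by (simp add: pderiv_eq_0_iff)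
    then show ?thesis unfolding eq using pos by simp
  next
    case False
    have "Re (u * (poly (pderiv R) x / poly R x)) > 0"
      using Suc.hyps(2) deg False Suc.prems(2) by (intro Suc.hyps(1)) (auto simp: R)
    then show ?thesis unfolding eq using pos by simp
  qed
qed simp

lemma Gauss_Lucas_real_interval:
  fixes Q :: "complex poly"
  assumes "degree Q > 0" "\<And>y. poly Q y = 0 \<Longrightarrow> y \<in> complex_of_real ` {a..b}"
    and x: "poly (pderiv Q) x = 0"
  shows "x \<in> complex_of_real ` {a..b}"
proof (rule ccontr)
  assume nx: "x \<notin> complex_of_real ` {a..b}"
  \<comment> \<open>For non-real \<open>x\<close> the real axis bounds the half-plane and
    \<open>u = \<i> * Im x\<close> works for all real \<open>t\<close>. For real \<open>x\<close>
    outside the interval \<open>u\<close> is a sign, and for \<open>b < a\<close> the condition is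
    vacuous.\<close>
  have "\<exists>u. \<forall>t\<in>{a..b}. Re (u / (x - of_real t)) > 0"
  proof (cases "Im x = 0")
    case False
    then have sq: "Im x * Im x > 0" by (metis not_real_square_gt_zero)
    have "Re (\<i> * of_real (Im x) / (x - of_real t)) > 0" for t
      using sq by (auto simp: Re_divide power2_eq_square intro!: divide_pos_pos add_nonneg_pos)
    then show ?thesis by blast
  next
    case True
    then have xr: "x = of_real (Re x)" by (simp add: complex_eq_iff)
    with nx have "Re x < a \<or> b < Re x \<or> b < a" by force
    then consider "Re x < a" | "b < Re x" | "b < a" by blast
    then show ?thesis
    proof cases
      case 1
      have "Re (- 1 / (x - of_real t)) > 0" if "t \<in> {a..b}" for t
        by (subst xr) (use that 1 in \<open>simp add: divide_neg_neg flip: of_real_diff of_real_divide\<close>)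
      then show ?thesis by blast
    next
      case 2
      have "Re (1 / (x - of_real t)) > 0" if "t \<in> {a..b}" for t
        by (subst xr) (use that 2 in \<open>simp flip: of_real_diff of_real_divide\<close>)
      then show ?thesis by blast
    qed auto
  qed
  then obtain u where u: "\<And>t. t \<in> {a..b} \<Longrightarrow> Re (u / (x - of_real t)) > 0" by blast
  have "Re (u * (poly (pderiv Q) x / poly Q x)) > 0"
    by (rule Gauss_Lucas_half_plane[OF assms(1)]) (use assms(2) u in blast)
  with x show False by simp
qed

section \<open>Weakly holomorphic forms and polynomials in j\<close>

lemma weakly_holomorphic_modular_form_T_S:
  assumes "weakly_holomorphic_modular_form k f" "\<tau> \<in> upper_half_plane"
  shows "f (\<tau> + 1) = f \<tau>" "f (- 1 / \<tau>) = \<tau> powi k * f \<tau>"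
proof -
  have *: "f ((of_int a * \<tau> + of_int b) / (of_int c * \<tau> + of_int d)) = (of_int c * \<tau> + of_int d) powi k * f \<tau>"
    if "a * d - b * c = 1" for a b c d :: int
    using assms that unfolding weakly_holomorphic_modular_form_def by blast
  show "f (\<tau> + 1) = f \<tau>" using *[of 1 1 1 0] by simp
  show "f (- 1 / \<tau>) = \<tau> powi k * f \<tau>" using *[of 0 0 "-1" 1] by simp
qed

text \<open>Shifting the expansion by \<open>n0\<close> gives a power series. It converges at every
  real \<open>q\<close> strictly between 0 and 1, as these are values of \<open>nome\<close>, and
  this forces its radius of convergence to be at least 1.\<close>

lemma has_q_expansion_imp_holomorphic:
  assumes "has_q_expansion f a"
  obtains n0 F where "F holomorphic_on ball 0 1"
    "\<And>\<tau>. \<tau> \<in> upper_half_plane \<Longrightarrow> f \<tau> = nome \<tau> powi n0 * F (nome \<tau>)"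
proof -
  obtain n0 where n0: "\<And>n. n < n0 \<Longrightarrow> a n = 0"
    and sum: "\<And>\<tau>. \<tau> \<in> upper_half_plane \<Longrightarrow> ((\<lambda>n. a n * nome \<tau> powi n) has_sum f \<tau>) UNIV"
    using assms unfolding has_q_expansion_def by blast
  define F where "F = Abs_fps (\<lambda>m. a (n0 + int m))"
  have *: "(\<lambda>m. fps_nth F m * nome \<tau> ^ m) sums (nome \<tau> powi (- n0) * f \<tau>)" if t: "\<tau> \<in> upper_half_plane" for \<tau>
  proof -
    have "((\<lambda>n. a n * nome \<tau> powi n) has_sum f \<tau>) UNIV \<longleftrightarrow>
       ((\<lambda>n. a n * nome \<tau> powi n) has_sum f \<tau>) (range (\<lambda>m. n0 + int m))"
    proof (rule has_sum_cong_neutral)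
      fix n assume "n \<in> UNIV - range (\<lambda>m. n0 + int m)"
      moreover have "n = n0 + int (nat (n - n0))" if "n \<ge> n0" using that by simp
      ultimately have "n < n0" by (metis DiffD2 linorder_not_less rangeI)
      then show "a n * nome \<tau> powi n = 0" by (simp add: n0)
    qed auto
    then have "((\<lambda>m. a (n0 + int m) * nome \<tau> powi (n0 + int m)) has_sum f \<tau>) UNIV"
      using sum[OF t] by (subst (asm) has_sum_reindex) (auto simp: o_def inj_on_def)
    from has_sum_cmult_right[OF this, of "nome \<tau> powi (- n0)"]
    have "((\<lambda>m. nome \<tau> powi (- n0) * (a (n0 + int m) * nome \<tau> powi (n0 + int m))) has_sum nome \<tau> powi (- n0) * f \<tau>) UNIV" .
    moreover have "nome \<tau> powi (- n0) * (a (n0 + int m) * nome \<tau> powi (n0 + int m)) = fps_nth F m * nome \<tau> ^ m" for m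
    proof -
      have "nome \<tau> powi (- n0) * nome \<tau> powi (n0 + int m) = nome \<tau> powi (int m)"
        by (simp flip: power_int_add)
      then show ?thesis by (simp add: F_def)
    qed
    ultimately show ?thesis using has_sum_imp_sums by simp
  qed
  have "summable (\<lambda>m. fps_nth F m * of_real t ^ m)" if "0 < t" "ereal t < 1" for t
  proof -
    have "complex_of_real t \<in> ball 0 1" "complex_of_real t \<noteq> 0" using that by auto
    then obtain \<tau> where "\<tau> \<in> upper_half_plane" "nome \<tau> = of_real t" using nome_surj by blast
    then show ?thesis using *[of \<tau>] by (auto simp: sums_iff)
  qed
  then have "fps_conv_radius F \<ge> 1" unfolding fps_conv_radius_def by (rule conv_radius_geI_ex')
  then have "eval_fps F holomorphic_on ball 0 1" by (rule holomorphic_eval_fps_ball)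
  moreover have "f \<tau> = nome \<tau> powi n0 * eval_fps F (nome \<tau>)" if "\<tau> \<in> upper_half_plane" for \<tau>
    using *[OF that] by (simp add: eval_fps_def sums_iff power_int_minus field_simps)
  ultimately show ?thesis using that by blast
qed

lemma modular_form_polynomial_in_j:
  assumes f: "weakly_holomorphic_modular_form k f"
  obtains Q where "\<And>\<tau>. \<tau> \<in> upper_half_plane \<Longrightarrow>
    f \<tau> ^ 12 * modular_discriminant \<tau> powi (- k) = poly Q (modular_j \<tau>)"
proof -
  define G where "G = (\<lambda>\<tau>. f \<tau> ^ 12 * modular_discriminant \<tau> powi (- k))"
  obtain a where "has_q_expansion f a" using f unfolding weakly_holomorphic_modular_form_def by blast
  then obtain n0 F where F: "F holomorphic_on ball 0 1"
    "\<And>\<tau>. \<tau> \<in> upper_half_plane \<Longrightarrow> f \<tau> = nome \<tau> powi n0 * F (nome \<tau>)"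
    using has_q_expansion_imp_holomorphic by blast
  \<comment> \<open>The order of \<open>f ^ 12 / \<Delta> ^ k\<close> at \<open>q = 0\<close> is at
    least \<open>12 * n0 - k\<close>. \<open>N\<close> is the pole order to be cleared if this is
    negative, and \<open>M\<close> the surplus power of \<open>q\<close> otherwise.\<close>
  define N M where "N = nat (k - 12 * n0)" and "M = nat (12 * n0 - k)"
  define H where "H = (\<lambda>q. q ^ M * (F q ^ 12 * Delta_unit_q q powi (- k)))"
  have "H holomorphic_on ball 0 1"
    unfolding H_def by (intro holomorphic_intros F holomorphic_Delta_unit_q) simp
  moreover have "G (- 1 / \<tau>) = G \<tau>" if t: "\<tau> \<in> upper_half_plane" for \<tau>
  proof -
    have nz: "\<tau> \<noteq> 0" using upper_half_plane_nonzero[OF t] .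
    have "(\<tau> powi k) ^ 12 * (\<tau> ^ 12) powi (- k) = \<tau> powi (k * 12) * \<tau> powi (12 * - k)"
      unfolding power_int_mult by simp
    also have "\<dots> = 1" using nz by (simp flip: power_int_add)
    finally have "(\<tau> powi k) ^ 12 * (\<tau> ^ 12) powi (- k) = 1" .
    moreover have "G (- 1 / \<tau>) = ((\<tau> powi k) ^ 12 * (\<tau> ^ 12) powi (- k)) * G \<tau>"
      unfolding G_def weakly_holomorphic_modular_form_T_S(2)[OF f t] eisenstein_S(3)[OF t]
        power_mult_distrib power_int_mult_distrib by (simp only: mult_ac)
    ultimately show ?thesis by simp
  qed
  moreover have "nome \<tau> ^ N * G \<tau> = H (nome \<tau>)" if t: "\<tau> \<in> upper_half_plane" for \<tau>
  proof -
    define q where "q = nome \<tau>"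
    have q: "q \<noteq> 0" by (simp add: q_def)
    have "q ^ N * ((q powi n0) ^ 12 * q powi (- k)) = q powi (int N) * (q powi (n0 * 12) * q powi (- k))"
      unfolding power_int_mult by simp
    also have "\<dots> = q powi (int N + (n0 * 12 + - k))" by (simp only: power_int_add[OF disjI1[OF q]])
    also have "int N + (n0 * 12 + - k) = int M" by (simp add: N_def M_def)
    finally have "q ^ N * ((q powi n0) ^ 12 * q powi (- k)) = q ^ M" by simp
    moreover have "nome \<tau> ^ N * G \<tau> =
       (q ^ N * ((q powi n0) ^ 12 * q powi (- k))) * (F q ^ 12 * Delta_unit_q q powi (- k))"
      unfolding G_def F(2)[OF t] modular_discriminant_nome[OF t] Delta_q_def q_def
        power_mult_distrib power_int_mult_distrib by (simp only: mult_ac)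
    ultimately show ?thesis by (simp add: H_def q_def)
  qed
  ultimately obtain Q where "\<forall>\<tau>\<in>upper_half_plane. G \<tau> = poly Q (modular_j \<tau>)"
    using modular_function_polynomial_in_j by blast
  then show ?thesis using that by (simp add: G_def)
qed

theorem theorem6p1:
  fixes k :: int and f :: "complex \<Rightarrow> complex"
    and \<epsilon>' \<delta>' :: nat and m' :: int and P :: "complex poly"
  assumes "even k"
    and "weakly_holomorphic_modular_form k f"
    and "\<exists>\<tau>\<in>upper_half_plane. f \<tau> \<noteq> 0"
    and "real_fourier_coefficients f"
    and "\<exists>\<tau>\<in>upper_half_plane. f \<tau> = 0"
    and "\<forall>\<tau>\<in>fundamental_domain. f \<tau> = 0 \<longrightarrow> \<tau> \<in> fundamental_arc"
    and "j_representation (k + 2) (serre_derivative k f) \<epsilon>' \<delta>' m' P"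
  shows "\<forall>x. poly P x = 0 \<longrightarrow> x \<in> complex_of_real ` {0..1728}"
proof (intro allI impI)
  fix x assume Px: "poly P x = 0"
  obtain Q where Q: "\<And>\<tau>. \<tau> \<in> upper_half_plane \<Longrightarrow>
      f \<tau> ^ 12 * modular_discriminant \<tau> powi (- k) = poly Q (modular_j \<tau>)"
    using modular_form_polynomial_in_j[OF assms(2)] by blast
  have zero_iff: "poly Q (modular_j \<tau>) = 0 \<longleftrightarrow> f \<tau> = 0" if "\<tau> \<in> upper_half_plane" for \<tau>
    using modular_discriminant_nonzero[OF that] by (simp add: power_int_eq_0_iff flip: Q[OF that])
  \<comment> \<open>A root of \<open>Q\<close> is lifted into the fundamental domain itself, because
    only there are the zeros of \<open>f\<close> constrained.\<close>
  have roots: "y \<in> complex_of_real ` {0..1728}" if y: "poly Q y = 0" for y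
  proof -
    obtain \<tau> where t: "\<tau> \<in> fundamental_domain" "modular_j \<tau> = y" using modular_j_fundamental_domain .
    then have "f \<tau> = 0" using zero_iff[of \<tau>] y by (auto simp: fundamental_domain_def)
    then show ?thesis using assms(6) t modular_j_fundamental_arc by blast
  qed
  \<comment> \<open>\<open>f\<close> vanishes at one point and not at another, so \<open>Q\<close>
    takes the value 0 and also a nonzero value.\<close>
  have "degree Q > 0"
  proof (rule ccontr)
    assume "\<not> degree Q > 0"
    then obtain c where "Q = [:c:]" by (metis degree_eq_zeroE gr0I)
    then show False using assms(3,5) zero_iff by auto
  qed
  show "x \<in> complex_of_real ` {0..1728}"
  proof (rule ccontr)
    assume nx: "x \<notin> complex_of_real ` {0..1728}"
    \<comment> \<open>Any preimage of \<open>x\<close> will do: the factor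
      \<open>poly P (modular_j \<tau>)\<close> makes the Serre derivative vanish there.\<close>
    obtain \<tau> where t: "\<tau> \<in> upper_half_plane" "modular_j \<tau> = x" using modular_j_surj by blast
    define D E p where "D = modular_discriminant \<tau>" and "E = eisenstein_E2 \<tau>" and "p = 2 * of_real pi * \<i>"
    have D0: "D \<noteq> 0" unfolding D_def by (rule modular_discriminant_nonzero[OF t(1)])
    have p0: "p \<noteq> 0" by (simp add: p_def)
    have "serre_derivative k f \<tau> = 0"
      using assms(7) Px t unfolding j_representation_def by simp
    then have "1 / p * deriv f \<tau> = of_int k / 12 * E * f \<tau>"
      unfolding serre_derivative_def D_op_def E_def p_def by simp
    then have df: "deriv f \<tau> = p * (of_int k / 12 * E * f \<tau>)"
      using p0 by (simp add: field_simps)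
    have "f holomorphic_on upper_half_plane"
      using assms(2) unfolding weakly_holomorphic_modular_form_def by blast
    then have "(f has_field_derivative deriv f \<tau>) (at \<tau>)"
      by (rule holomorphic_derivI[OF _ open_upper_half_plane t(1)])
    then have f': "((\<lambda>\<tau>. f \<tau> ^ 12) has_field_derivative 12 * f \<tau> ^ 11 * (p * (of_int k / 12 * E * f \<tau>))) (at \<tau>)"
      unfolding df by (auto intro!: derivative_eq_intros)
    have "(modular_discriminant has_field_derivative p * (E * D)) (at \<tau>)"
      using DERIV_modular_discriminant[OF t(1)] by (simp add: p_def E_def D_def)
    then have D': "((\<lambda>\<tau>. modular_discriminant \<tau> powi (- k)) has_field_derivative
        of_int (- k) * D powi (- k - 1) * (p * (E * D))) (at \<tau>)"
      using DERIV_power_int[of modular_discriminant "p * (E * D)" \<tau> UNIV "- k"] D0 by (simp add: D_def)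
    have "D powi (- k - 1) * D = D powi (- k)"
      using D0 power_int_add[of D "- k - 1" 1] by simp
    then have e1: "of_int (- k) * D powi (- k - 1) * (p * (E * D)) = - (of_int k * p * E * D powi (- k))"
      by (metis (no_types, lifting) mult.assoc mult.commute mult_minus_left of_int_minus)
    have e2: "12 * f \<tau> ^ 11 * (p * (of_int k / 12 * E * f \<tau>)) = of_int k * p * E * f \<tau> ^ 12"
      using power_add[of "f \<tau>" 11 1] by (simp add: mult_ac)
    \<comment> \<open>Since \<open>D f = k / 12 * E2 * f\<close> at this point, \<open>D\<close>
      multiplies \<open>f ^ 12\<close> by \<open>k * E2\<close> there, while
      \<open>D \<Delta> = E2 * \<Delta>\<close> multiplies \<open>\<Delta>\<close> to the power
      \<open>- k\<close> by \<open>- k * E2\<close>; the product rule cancels the two. Dividing by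
      \<open>f\<close> is avoided.\<close>
    have "((\<lambda>\<tau>. f \<tau> ^ 12 * modular_discriminant \<tau> powi (- k)) has_field_derivative 0) (at \<tau>)"
      using DERIV_mult[OF f' D', folded D_def] unfolding e1 e2 by (simp add: mult_ac)
    then have "((\<lambda>\<tau>. poly Q (modular_j \<tau>)) has_field_derivative 0) (at \<tau>)"
      by (rule has_field_derivative_transform_within_open[OF _ open_upper_half_plane t(1) Q])
    moreover have "((\<lambda>\<tau>. poly Q (modular_j \<tau>)) has_field_derivative poly (pderiv Q) x *
        - (p * (eisenstein_E 4 \<tau> ^ 2 * eisenstein_E 6 \<tau> / D))) (at \<tau>)"
      unfolding t(2)[symmetric] p_def D_def by (rule DERIV_chain2[OF poly_DERIV DERIV_modular_j[OF t(1)]])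
    ultimately have "poly (pderiv Q) x * - (p * (eisenstein_E 4 \<tau> ^ 2 * eisenstein_E 6 \<tau> / D)) = 0"
      using DERIV_unique by blast
    \<comment> \<open>The derivative of \<open>j\<close> vanishes only where \<open>E4\<close> or
      \<open>E6\<close> does, that is where \<open>j\<close> is 0 or 1728; both values lie in the
      excluded interval.\<close>
    moreover have "eisenstein_E 4 \<tau> \<noteq> 0"
    proof
      assume "eisenstein_E 4 \<tau> = 0"
      then have "x = of_real 0" using t(2) by (simp add: modular_j_def)
      with nx show False by auto
    qed
    moreover have "eisenstein_E 6 \<tau> \<noteq> 0"
    proof
      assume "eisenstein_E 6 \<tau> = 0"
      then have "x = of_real 1728" using modular_j_diff_1728[OF t(1)] t(2) by simp
      with nx show False by (metis atLeastAtMost_iff imageI order_refl zero_le_numeral)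
    qed
    ultimately have "poly (pderiv Q) x = 0" using p0 D0 by simp
    with Gauss_Lucas_real_interval[OF \<open>degree Q > 0\<close> roots this] nx show False by simp
  qed
qed

end
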